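(* Let $P$ be a submonoid of a group $G$, with group of units $P^*=P\cap P^{-1}$, and consider the following equivalent conditions: (1) the partial action of $G$ on $\Omega_P$ is topologically free; (2) the action of $P^*$ on $\Omega_P$ is topologically free; (3) if $u\in P^*\setminus\{e\}$ and $\mathcal C$ is a finite collection of proper constructible right ideals of $P$, then there exists $t\in P\setminus\bigcup_{R\in\mathcal C}R$ such that $utP\neq tP$; (4) every ideal of $\mathcal T_u(P)$ that has trivial intersection with $D_u$ is contained in the kernel of $\lambda^+\colon\mathcal T_u(P)\to\mathcal T_\lambda(P)$. These conditions imply that every nontrivial (nonzero) ideal of $\mathcal T_\lambda(P)$ has nontrivial (nonzero) intersection with $D_r$. If $\lambda^+\colon\mathcal T_u(P)\to\mathcal T_\lambda(P)$ is an isomorphism, then the converse holds.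
   Context: $P$ is a submonoid of a group $G$ with identity $e$. Ideals of $\mathrm C^*$-algebras are closed and two-sided. A word is a finite sequence $\alpha=(p_1,p_2,\ldots,p_{2k-1},p_{2k})$ of even length $2k\ge 0$ with entries in $P$; $\mathcal W$ is the set of all words (including the empty word). Put $\dot\alpha:=p_1^{-1}p_2\cdots p_{2k-1}^{-1}p_{2k}\in G$ (equal to $e$ for the empty word); $\alpha$ is neutral if $\dot\alpha=e$. Put $\tilde\alpha:=(p_{2k},p_{2k-1},\ldots,p_2,p_1)$ and $K(\alpha):=P\cap p_{2k}^{-1}p_{2k-1}P\cap p_{2k}^{-1}p_{2k-1}p_{2k-2}^{-1}p_{2k-3}P\cap\cdots\cap p_{2k}^{-1}p_{2k-1}\cdots p_2^{-1}p_1P$ (equal to $P$ for the empty word). The constructible right ideals of $P$ are the members of $\mathfrak J:=\{K(\alpha):\alpha\in\mathcal W\}$. For a map $w\colon P\to B$ into a unital $\mathrm C^*$-algebra, $\dot w_\alpha:=w_{p_1}^*w_{p_2}\cdots w_{p_{2k-1}}^*w_{p_{2k}}$ ($=1$ for the empty word). $\mathcal T_u(P)$ is the universal $\mathrm C^*$-algebra with generators $\{t_p:p\in P\}$ subject to: (T1) $t_e=1$; (T2) $\dot t_\alpha=0$ if $\alpha$ is neutral and $K(\alpha)=\emptyset$; (T3) $\dot t_\alpha=\dot t_\beta$ if $\alpha,\beta$ are neutral and $K(\alpha)=K(\beta)$; (T4) $\prod_{\beta\in F}(\dot t_\alpha-\dot t_\beta)=0$ if $\alpha$ is neutral and $F$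 is a finite set of neutral words with $K(\alpha)=\bigcup_{\beta\in F}K(\beta)$. $D_u:=\overline{\mathrm{span}}\{\dot t_\alpha:\dot\alpha=e\}$. $\mathcal T_\lambda(P)$ is the $\mathrm C^*$-algebra generated by the isometries $L_p\delta_q=\delta_{pq}$ on $\ell^2(P)$, $D_r:=\overline{\mathrm{span}}\{\mathbb 1_S:S\in\mathfrak J\}\subseteq\ell^\infty(P)$ is its diagonal subalgebra, and $\lambda^+\colon\mathcal T_u(P)\to\mathcal T_\lambda(P)$ is the canonical surjection $t_p\mapsto L_p$. $\Omega_P$ is the compact space (topology of pointwise convergence) of all nonzero functions $\chi\colon\mathfrak J\to\{0,1\}$ with $\chi(R\cap S)=\chi(R)\chi(S)$, $\chi(\emptyset)=0$ if $\emptyset\in\mathfrak J$, and such that whenever $S=\bigcup_{i=1}^nS_i$ with $S,S_i\in\mathfrak J$ and $\chi(S)=1$, then $\chi(S_i)=1$ for some $i$ (this is the spectrum of $D_r$). The partial action of $G$ on $\Omega_P$ is given by $U_{g^{-1}}:=\{\chi\in\Omega_P:\chi(K(\alpha))=1\text{ for some }\alpha\text{ with }\dot\alpha=g\}$ and homeomorphisms $\hat\gamma_g\colon U_{g^{-1}}\to U_g$ determined by $\hat\gamma_g(\chi)(K(\beta))=\chi(g^{-1}K(\beta))=\chi(K(\tilde\beta))$ for $\dot\beta=g^{-1}$; it restricts to an action of the group $P^*$. A partial action $\theta$ of a discrete group on a space is topologically free if for every $h\neq e$ the set of points in the domain of $\theta_h$ fixed by $\theta_h$ has empty interior. *)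

theory Defs
  imports "HOL-Analysis.Analysis" "HOL-Algebra.Subrings"
begin

section \<open>Unital C*-algebras\<close>

record 'a cstar = "'a ring" +
  scl :: "complex \<Rightarrow> 'a \<Rightarrow> 'a"
  adj :: "'a \<Rightarrow> 'a"
  nrm :: "'a \<Rightarrow> real"

(* Constantly 0 off the carrier: the locale Metric_space demands symmetry and
   nonnegativity on the whole type. *)
definition cstar_dist :: "('a, 'n) cstar_scheme \<Rightarrow> 'a \<Rightarrow> 'a \<Rightarrow> real" where
  "cstar_dist A x y =
     (if x \<in> carrier A \<and> y \<in> carrier A then nrm A (x \<ominus>\<^bsub>A\<^esub> y) else 0)"

abbreviation cstar_topology :: "('a, 'n) cstar_scheme \<Rightarrow> 'a topology" where
  "cstar_topology A \<equiv> Metric_space.mtopology (carrier A) (cstar_dist A)"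

locale unital_cstar_algebra = ring A for A :: "('a, 'n) cstar_scheme" (structure) +
  assumes scl_closed: "x \<in> carrier A \<Longrightarrow> scl A c x \<in> carrier A"
    and scl_add_right: "\<lbrakk>x \<in> carrier A; y \<in> carrier A\<rbrakk> \<Longrightarrow> scl A c (x \<oplus> y) = scl A c x \<oplus> scl A c y"
    and scl_add_left: "x \<in> carrier A \<Longrightarrow> scl A (c + d) x = scl A c x \<oplus> scl A d x"
    and scl_scl: "x \<in> carrier A \<Longrightarrow> scl A c (scl A d x) = scl A (c * d) x"
    and scl_one: "x \<in> carrier A \<Longrightarrow> scl A 1 x = x"
    and scl_mult_left: "\<lbrakk>x \<in> carrier A; y \<in> carrier A\<rbrakk> \<Longrightarrow> scl A c x \<otimes> y = scl A c (x \<otimes> y)"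
    and scl_mult_right: "\<lbrakk>x \<in> carrier A; y \<in> carrier A\<rbrakk> \<Longrightarrow> x \<otimes> scl A c y = scl A c (x \<otimes> y)"
    and adj_closed: "x \<in> carrier A \<Longrightarrow> adj A x \<in> carrier A"
    and adj_adj: "x \<in> carrier A \<Longrightarrow> adj A (adj A x) = x"
    and adj_add: "\<lbrakk>x \<in> carrier A; y \<in> carrier A\<rbrakk> \<Longrightarrow> adj A (x \<oplus> y) = adj A x \<oplus> adj A y"
    and adj_scl: "x \<in> carrier A \<Longrightarrow> adj A (scl A c x) = scl A (cnj c) (adj A x)"
    and adj_mult: "\<lbrakk>x \<in> carrier A; y \<in> carrier A\<rbrakk> \<Longrightarrow> adj A (x \<otimes> y) = adj A y \<otimes> adj A x"
    and nrm_nonneg: "x \<in> carrier A \<Longrightarrow> 0 \<le> nrm A x"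
    and nrm_eq_0: "x \<in> carrier A \<Longrightarrow> nrm A x = 0 \<longleftrightarrow> x = \<zero>"
    and nrm_scl: "x \<in> carrier A \<Longrightarrow> nrm A (scl A c x) = cmod c * nrm A x"
    and nrm_triangle: "\<lbrakk>x \<in> carrier A; y \<in> carrier A\<rbrakk> \<Longrightarrow> nrm A (x \<oplus> y) \<le> nrm A x + nrm A y"
    and nrm_mult: "\<lbrakk>x \<in> carrier A; y \<in> carrier A\<rbrakk> \<Longrightarrow> nrm A (x \<otimes> y) \<le> nrm A x * nrm A y"
    and cstar_identity: "x \<in> carrier A \<Longrightarrow> nrm A (adj A x \<otimes> x) = (nrm A x)\<^sup>2"
    and complete: "Metric_space.mcomplete (carrier A) (cstar_dist A)"

definition star_hom :: "('a, 'm) cstar_scheme \<Rightarrow> ('b, 'n) cstar_scheme \<Rightarrow> ('a \<Rightarrow> 'b) set" where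
  "star_hom A B = {f \<in> ring_hom A B.
     (\<forall>c. \<forall>x\<in>carrier A. f (scl A c x) = scl B c (f x)) \<and>
     (\<forall>x\<in>carrier A. f (adj A x) = adj B (f x))}"

definition cstar_ideal :: "'a set \<Rightarrow> ('a, 'n) cstar_scheme \<Rightarrow> bool" where
  "cstar_ideal I A \<longleftrightarrow> ideal I A \<and> closedin (cstar_topology A) I"

definition cstar_subalgebra :: "'a set \<Rightarrow> ('a, 'n) cstar_scheme \<Rightarrow> bool" where
  "cstar_subalgebra C A \<longleftrightarrow> subring C A \<and>
     (\<forall>c. \<forall>x\<in>C. scl A c x \<in> C) \<and> (\<forall>x\<in>C. adj A x \<in> C) \<and>
     closedin (cstar_topology A) C"

definition cstar_generated :: "('a, 'n) cstar_scheme \<Rightarrow> 'a set \<Rightarrow> 'a set" where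
  "cstar_generated A S = \<Inter>{C. cstar_subalgebra C A \<and> S \<subseteq> C}"

definition cspan :: "('a, 'n) cstar_scheme \<Rightarrow> 'a set \<Rightarrow> 'a set" where
  "cspan A S = \<Inter>{V. subgroup V (add_monoid A) \<and> (\<forall>c. \<forall>x\<in>V. scl A c x \<in> V) \<and> S \<subseteq> V}"

definition closed_cspan :: "('a, 'n) cstar_scheme \<Rightarrow> 'a set \<Rightarrow> 'a set" where
  "closed_cspan A S = cstar_topology A closure_of cspan A S"


section \<open>Bounded operators on the Hilbert space of square-summable functions on a set\<close>

definition ell2 :: "'g set \<Rightarrow> ('g \<Rightarrow> complex) set" where
  "ell2 X = {f. (\<forall>x. x \<notin> X \<longrightarrow> f x = 0) \<and> (\<lambda>x. (cmod (f x))\<^sup>2) summable_on X}"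

definition ell2_inner :: "'g set \<Rightarrow> ('g \<Rightarrow> complex) \<Rightarrow> ('g \<Rightarrow> complex) \<Rightarrow> complex" where
  "ell2_inner X f g = (\<Sum>\<^sub>\<infinity>x\<in>X. f x * cnj (g x))"

definition ell2_norm :: "'g set \<Rightarrow> ('g \<Rightarrow> complex) \<Rightarrow> real" where
  "ell2_norm X f = sqrt (\<Sum>\<^sub>\<infinity>x\<in>X. (cmod (f x))\<^sup>2)"

type_synonym 'g operator = "('g \<Rightarrow> complex) \<Rightarrow> ('g \<Rightarrow> complex)"

(* Operators are extended by 0 off ell2 X, so that equality of operators is equality in the type. *)
definition bounded_ops :: "'g set \<Rightarrow> 'g operator set" where
  "bounded_ops X = {T. T \<in> ell2 X \<rightarrow> ell2 X \<and>
     (\<forall>f\<in>ell2 X. \<forall>g\<in>ell2 X. T (\<lambda>x. f x + g x) = (\<lambda>x. T f x + T g x)) \<and>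
     (\<forall>c. \<forall>f\<in>ell2 X. T (\<lambda>x. c * f x) = (\<lambda>x. c * T f x)) \<and>
     (\<exists>C. \<forall>f\<in>ell2 X. ell2_norm X (T f) \<le> C * ell2_norm X f) \<and>
     (\<forall>f. f \<notin> ell2 X \<longrightarrow> T f = (\<lambda>x. 0))}"

definition bounded_operators :: "'g set \<Rightarrow> 'g operator cstar" where
  "bounded_operators X =
    \<lparr> carrier = bounded_ops X,
      mult = (\<lambda>S T f. S (T f)),
      one = (\<lambda>f. if f \<in> ell2 X then f else (\<lambda>x. 0)),
      zero = (\<lambda>f x. 0),
      add = (\<lambda>S T f x. S f x + T f x),
      scl = (\<lambda>c T f x. c * T f x),
      adj = (\<lambda>T. THE S. S \<in> bounded_ops X \<and>
               (\<forall>f\<in>ell2 X. \<forall>g\<in>ell2 X. ell2_inner X (T f) g = ell2_inner X f (S g))),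
      nrm = (\<lambda>T. SUP f\<in>{f \<in> ell2 X. ell2_norm X f \<le> 1}. ell2_norm X (T f)) \<rparr>"

definition mult_operator :: "'g set \<Rightarrow> ('g \<Rightarrow> complex) \<Rightarrow> 'g operator" where
  "mult_operator X h = (\<lambda>f. if f \<in> ell2 X then (\<lambda>x. h x * f x) else (\<lambda>x. 0))"


section \<open>Words and constructible right ideals\<close>

definition words :: "'g set \<Rightarrow> 'g list set" where
  "words P = {\<alpha>. set \<alpha> \<subseteq> P \<and> even (length \<alpha>)}"

(* The value at lists of odd length is irrelevant. *)
fun word_dot :: "('g, 'm) monoid_scheme \<Rightarrow> 'g list \<Rightarrow> 'g" where
  "word_dot G (p # q # \<alpha>) = inv\<^bsub>G\<^esub> p \<otimes>\<^bsub>G\<^esub> q \<otimes>\<^bsub>G\<^esub> word_dot G \<alpha>"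
| "word_dot G _ = \<one>\<^bsub>G\<^esub>"

fun word_eval :: "('a, 'n) cstar_scheme \<Rightarrow> ('g \<Rightarrow> 'a) \<Rightarrow> 'g list \<Rightarrow> 'a" where
  "word_eval A w (p # q # \<alpha>) = adj A (w p) \<otimes>\<^bsub>A\<^esub> w q \<otimes>\<^bsub>A\<^esub> word_eval A w \<alpha>"
| "word_eval A w _ = \<one>\<^bsub>A\<^esub>"

definition neutral_words :: "('g, 'm) monoid_scheme \<Rightarrow> 'g set \<Rightarrow> 'g list set" where
  "neutral_words G P = {\<alpha> \<in> words P. word_dot G \<alpha> = \<one>\<^bsub>G\<^esub>}"

(* For \<alpha> = (p_1, ..., p_2k), dropping the first 2i entries and reversing gives
   (p_2k, ..., p_(2i+1)), whose value is p_2k^-1 p_(2k-1) ... p_(2i+2)^-1 p_(2i+1).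
   The index i = k contributes P itself. *)
definition word_K :: "('g, 'm) monoid_scheme \<Rightarrow> 'g set \<Rightarrow> 'g list \<Rightarrow> 'g set" where
  "word_K G P \<alpha> = (\<Inter>i\<in>{0..length \<alpha> div 2}. word_dot G (rev (drop (2 * i) \<alpha>)) <#\<^bsub>G\<^esub> P)"

definition constructible_ideals :: "('g, 'm) monoid_scheme \<Rightarrow> 'g set \<Rightarrow> 'g set set" where
  "constructible_ideals G P = word_K G P ` words P"

definition unit_group :: "('g, 'm) monoid_scheme \<Rightarrow> 'g set \<Rightarrow> 'g set" where
  "unit_group G P = {u \<in> P. inv\<^bsub>G\<^esub> u \<in> P}"


section \<open>The universal Toeplitz algebra\<close>

(* In the last relation the finite set F of neutral words is listed as \<beta>s. It is nonempty:
   an empty F would turn the relation into 1 = 0 whenever the empty set is constructible.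
   By the preceding relations the factors commute, so the order of \<beta>s does not matter. *)
definition toeplitz_relations ::
  "('g, 'm) monoid_scheme \<Rightarrow> 'g set \<Rightarrow> ('a, 'n) cstar_scheme \<Rightarrow> ('g \<Rightarrow> 'a) \<Rightarrow> bool" where
  "toeplitz_relations G P A w \<longleftrightarrow>
     w \<in> P \<rightarrow> carrier A \<and>
     w \<one>\<^bsub>G\<^esub> = \<one>\<^bsub>A\<^esub> \<and>
     (\<forall>\<alpha>\<in>neutral_words G P. word_K G P \<alpha> = {} \<longrightarrow> word_eval A w \<alpha> = \<zero>\<^bsub>A\<^esub>) \<and>
     (\<forall>\<alpha>\<in>neutral_words G P. \<forall>\<beta>\<in>neutral_words G P.
        word_K G P \<alpha> = word_K G P \<beta> \<longrightarrow> word_eval A w \<alpha> = word_eval A w \<beta>) \<and>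
     (\<forall>\<alpha>\<in>neutral_words G P. \<forall>\<beta>s\<in>lists (neutral_words G P).
        distinct \<beta>s \<and> \<beta>s \<noteq> [] \<and> word_K G P \<alpha> = (\<Union>\<beta>\<in>set \<beta>s. word_K G P \<beta>) \<longrightarrow>
        foldr (\<lambda>\<beta> x. (word_eval A w \<alpha> \<ominus>\<^bsub>A\<^esub> word_eval A w \<beta>) \<otimes>\<^bsub>A\<^esub> x) \<beta>s \<one>\<^bsub>A\<^esub> = \<zero>\<^bsub>A\<^esub>)"

(* (A, t) is a universal C*-algebra for the relations; this determines it up to isomorphism.
   HOL cannot quantify over types, so the test algebras B live on one fixed type, which is
   large enough: a C*-algebra generated by a family indexed by P has at most
   max (|P|, aleph_0) ^ aleph_0 elements, hence an isomorphic copy with carrier inside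
   'g => complex and a fortiori inside 'g operator. Only the C*-algebra generated by w ` P
   matters for the universal property. *)
definition universal_toeplitz_algebra ::
  "('g, 'm) monoid_scheme \<Rightarrow> 'g set \<Rightarrow> 'a cstar \<Rightarrow> ('g \<Rightarrow> 'a) \<Rightarrow> bool" where
  "universal_toeplitz_algebra G P A t \<longleftrightarrow>
     unital_cstar_algebra A \<and>
     toeplitz_relations G P A t \<and>
     carrier A = cstar_generated A (t ` P) \<and>
     (\<forall>(B :: 'g operator cstar) w. unital_cstar_algebra B \<and> toeplitz_relations G P B w \<longrightarrow>
        (\<exists>f\<in>star_hom A B. \<forall>p\<in>P. f (t p) = w p))"

definition universal_diagonal ::
  "('g, 'm) monoid_scheme \<Rightarrow> 'g set \<Rightarrow> 'a cstar \<Rightarrow> ('g \<Rightarrow> 'a) \<Rightarrow> 'a set" where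
  "universal_diagonal G P A t = closed_cspan A (word_eval A t ` neutral_words G P)"


section \<open>The reduced Toeplitz algebra\<close>

(* (L_p f)(p q) = f q for q in P, and L_p f vanishes off p P; so L_p maps delta_q to delta_(p q). *)
definition left_regular :: "('g, 'm) monoid_scheme \<Rightarrow> 'g set \<Rightarrow> 'g \<Rightarrow> 'g operator" where
  "left_regular G P p = (\<lambda>f. if f \<in> ell2 P
     then (\<lambda>x. if x \<in> p <#\<^bsub>G\<^esub> P then f (inv\<^bsub>G\<^esub> p \<otimes>\<^bsub>G\<^esub> x) else 0) else (\<lambda>x. 0))"

definition reduced_toeplitz :: "('g, 'm) monoid_scheme \<Rightarrow> 'g set \<Rightarrow> 'g operator cstar" where
  "reduced_toeplitz G P = (bounded_operators P)
     \<lparr> carrier := cstar_generated (bounded_operators P) (left_regular G P ` P) \<rparr>"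

(* Bounded functions on P are identified with multiplication operators. *)
definition reduced_diagonal :: "('g, 'm) monoid_scheme \<Rightarrow> 'g set \<Rightarrow> 'g operator set" where
  "reduced_diagonal G P = closed_cspan (bounded_operators P)
     ((\<lambda>S. mult_operator P (indicator S)) ` constructible_ideals G P)"

definition canonical_surjection ::
  "('g, 'm) monoid_scheme \<Rightarrow> 'g set \<Rightarrow> 'a cstar \<Rightarrow> ('g \<Rightarrow> 'a) \<Rightarrow> ('a \<Rightarrow> 'g operator) \<Rightarrow> bool" where
  "canonical_surjection G P A t \<Lambda> \<longleftrightarrow>
     \<Lambda> \<in> star_hom A (reduced_toeplitz G P) \<and> (\<forall>p\<in>P. \<Lambda> (t p) = left_regular G P p)"


section \<open>The spectrum and the partial action\<close>

definition spectrum :: "('g, 'm) monoid_scheme \<Rightarrow> 'g set \<Rightarrow> ('g set \<Rightarrow> nat) set" where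
  "spectrum G P = {\<phi> \<in> constructible_ideals G P \<rightarrow>\<^sub>E {0, 1}.
     (\<exists>S\<in>constructible_ideals G P. \<phi> S \<noteq> 0) \<and>
     (\<forall>R\<in>constructible_ideals G P. \<forall>S\<in>constructible_ideals G P. \<phi> (R \<inter> S) = \<phi> R * \<phi> S) \<and>
     ({} \<in> constructible_ideals G P \<longrightarrow> \<phi> {} = 0) \<and>
     (\<forall>S\<in>constructible_ideals G P. \<forall>F. finite F \<and> F \<subseteq> constructible_ideals G P \<and>
        S = \<Union>F \<and> \<phi> S = 1 \<longrightarrow> (\<exists>R\<in>F. \<phi> R = 1))}"

definition spectrum_topology :: "('g, 'm) monoid_scheme \<Rightarrow> 'g set \<Rightarrow> ('g set \<Rightarrow> nat) topology" where
  "spectrum_topology G P = subtopology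
     (product_topology (\<lambda>_. discrete_topology {0, 1}) (constructible_ideals G P)) (spectrum G P)"

(* The domain of the partial homeomorphism attached to g. *)
definition action_dom :: "('g, 'm) monoid_scheme \<Rightarrow> 'g set \<Rightarrow> 'g \<Rightarrow> ('g set \<Rightarrow> nat) set" where
  "action_dom G P g =
     {\<phi> \<in> spectrum G P. \<exists>\<alpha>\<in>words P. word_dot G \<alpha> = g \<and> \<phi> (word_K G P \<alpha>) = 1}"

(* The point in the range (the domain attached to g^-1) determined by its values on the ideals
   K(\<beta>) with value of \<beta> equal to g^-1. It is unique: if K(\<beta>) has value 1, then the value at any
   constructible S is the value at S \<inter> K(\<beta>), which is again of this form. *)
definition action_map ::
  "('g, 'm) monoid_scheme \<Rightarrow> 'g set \<Rightarrow> 'g \<Rightarrow> ('g set \<Rightarrow> nat) \<Rightarrow> ('g set \<Rightarrow> nat)" where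
  "action_map G P g \<phi> = (THE \<psi>. \<psi> \<in> action_dom G P (inv\<^bsub>G\<^esub> g) \<and>
     (\<forall>\<beta>\<in>words P. word_dot G \<beta> = inv\<^bsub>G\<^esub> g \<longrightarrow> \<psi> (word_K G P \<beta>) = \<phi> (word_K G P (rev \<beta>))))"

(* H is the acting group with identity e; D h is the domain of \<theta> h. *)
definition topologically_free ::
  "'h set \<Rightarrow> 'h \<Rightarrow> 'x topology \<Rightarrow> ('h \<Rightarrow> 'x set) \<Rightarrow> ('h \<Rightarrow> 'x \<Rightarrow> 'x) \<Rightarrow> bool" where
  "topologically_free H e X D \<theta> \<longleftrightarrow>
     (\<forall>h\<in>H - {e}. X interior_of {x \<in> D h. \<theta> h x = x} = {})"

definition action_topologically_free ::
  "('g, 'm) monoid_scheme \<Rightarrow> 'g set \<Rightarrow> 'g set \<Rightarrow> bool" where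
  "action_topologically_free G P H \<longleftrightarrow>
     topologically_free H \<one>\<^bsub>G\<^esub> (spectrum_topology G P) (action_dom G P) (action_map G P)"

definition ideals_meet_reduced_diagonal :: "('g, 'm) monoid_scheme \<Rightarrow> 'g set \<Rightarrow> bool" where
  "ideals_meet_reduced_diagonal G P \<longleftrightarrow>
     (\<forall>I. cstar_ideal I (reduced_toeplitz G P) \<and> I \<noteq> {\<zero>\<^bsub>reduced_toeplitz G P\<^esub>} \<longrightarrow>
        I \<inter> reduced_diagonal G P \<noteq> {\<zero>\<^bsub>reduced_toeplitz G P\<^esub>})"

end

theory Submission
  imports Defs
begin

text \<open>
  Everything is tested on the points \<open>x\<close> of \<open>P\<close>. Their characters are dense in the spectrum, \<open>g\<close> moves the
  character of \<open>x\<close> to that of \<open>g x\<close>, and \<open>x\<close>, \<open>y\<close> have the same character iff \<open>x P = y P\<close>. So an element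
  \<open>g \<noteq> e\<close> fixing an open set is conjugate, by a point of that set, to a unit that fixes \<open>s P\<close> for all \<open>s\<close>
  outside finitely many proper constructible ideals; this relates conditions (1), (2) and (3).

  Assume (3), let \<open>b \<ge> 0\<close> lie in an ideal, with a nonzero diagonal matrix coefficient in the left regular
  representation, and approximate \<open>b\<close> by a linear combination of words. Shrinking a nonempty set
  \<open>S - (R\<^sub>1 \<union> \<dots> \<union> R\<^sub>n)\<close> of points makes all neutral words constant on it and disjoins it from its translates by
  the other words. For the projection \<open>h\<close> of that set, \<open>h b h\<close> is then close to a nonzero multiple of \<open>h\<close>,
  so \<open>h\<close> lies in the ideal. This works for every C*-algebra generated by a Toeplitz family that maps to
  the left regular one, in particular for both Toeplitz algebras.

  If a unit \<open>u\<close> violates (3) because of \<open>R\<^sub>1, \<dots>, R\<^sub>n\<close>, consider the representation on the square-summable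
  functions on the set of principal right ideals. It is faithful on the diagonal and kills
  \<open>(t\<^sub>u - 1) (1 - t\<^sub>R\<^sub>1) \<cdots> (1 - t\<^sub>R\<^sub>n)\<close>, which does not vanish in the left regular representation.
\<close>


section \<open>Abstract C*-algebras\<close>

text \<open>The obstacle: the coefficient of \<open>b\<close> is known at one point \<open>x\<close>
  only, but a word of value \<open>g \<noteq> e\<close> may satisfy \<open>g x P = x P\<close>. Then
  every set of the allowed form around \<open>x\<close> contains \<open>g x\<close> as well, and so
  meets its translate by \<open>g\<close>. Therefore the shrinking has two stages. The first stays
  around \<open>x\<close> and makes the neutral words constant; the second moves inside that set and
  may abandon \<open>x\<close>, since constants persist on smaller sets. Only the second stage needs
  (3). Spectral theory is avoided throughout. Star homomorphisms are contractive because
  \<open>z\<^sup>2 + y\<^sup>2 = 1\<close> bounds commuting self-adjoint \<open>z\<close>,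
  \<open>y\<close>; the norm on the diagonal is found by cutting along ideals and by repeated
  squaring instead of Gelfand theory; and a single matrix coefficient replaces a conditional
  expectation. The left regular representation and the one on principal ideals differ only in which
  points are identified, so both are instances of one construction.\<close>

lemma le_of_power_bound:
  fixes a M :: real
  assumes "0 \<le> M" and *: "\<And>n. a ^ (2 ^ n) \<le> 2 * M ^ (2 ^ n)"
  shows "a \<le> M"
proof (cases "M = 0")
  case True
  have "a ^ (2 ^ 0) \<le> 2 * M ^ (2 ^ 0)" by (rule *)
  then show ?thesis using True by simp
next
  case False
  with assms have M: "M > 0" by simp
  show ?thesis
  proof (rule ccontr)
    assume "\<not> a \<le> M"
    then have "a / M > 1" using M by (simp add: field_simps)
    \<comment> \<open>The constant 2 disappears in the limit: powers of \<open>a / M\<close> outgrow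
      it, and \<open>n \<le> 2 ^ n\<close> carries this over to the exponents in the
      hypothesis.\<close>
    then obtain n where n: "(a / M) ^ n > 2" using real_arch_pow by blast
    have "(a / M) ^ n \<le> (a / M) ^ (2 ^ n)"
      using \<open>a / M > 1\<close> by (intro power_increasing) (auto intro: less_imp_le less_exp)
    then have "(a / M) ^ (2 ^ n) > 2" using n by simp
    then have "a ^ (2 ^ n) > 2 * M ^ (2 ^ n)"
      using M by (simp add: power_divide field_simps)
    then show False using *[of n] by simp
  qed
qed

section \<open>Identities for scalars, adjoints and the norm\<close>

context unital_cstar_algebra
begin

lemma scl_zero_left [simp]: "x \<in> carrier A \<Longrightarrow> scl A 0 x = \<zero>"
  using scl_add_left[of x 0 0] scl_closed[of x 0] by simp

lemma scl_zero_right [simp]: "scl A c \<zero> = \<zero>"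
  using scl_add_right[of \<zero> \<zero> c] scl_closed[of \<zero> c] by simp

lemma scl_minus_one: "x \<in> carrier A \<Longrightarrow> scl A (-1) x = \<ominus> x"
  using scl_add_left[of x "-1" 1] scl_closed[of x "-1"]
  by (simp add: scl_one) (metis minus_equality)

lemma scl_minus_left: "x \<in> carrier A \<Longrightarrow> scl A (- c) x = \<ominus> (scl A c x)"
  by (metis scl_closed scl_minus_one scl_scl mult_minus1)

lemma diff_self [simp]: "x \<in> carrier A \<Longrightarrow> x \<ominus> x = \<zero>"
  by (simp add: a_minus_def r_neg)

lemma scl_minus_right: "x \<in> carrier A \<Longrightarrow> scl A c (\<ominus> x) = \<ominus> (scl A c x)"
  by (metis scl_closed scl_minus_one scl_scl mult.commute)

lemma scl_diff_right:
  "\<lbrakk>x \<in> carrier A; y \<in> carrier A\<rbrakk> \<Longrightarrow> scl A c (x \<ominus> y) = scl A c x \<ominus> scl A c y"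
  by (simp add: a_minus_def scl_add_right scl_minus_right)

lemma scl_as_mult: "x \<in> carrier A \<Longrightarrow> scl A c x = scl A c \<one> \<otimes> x"
  by (simp add: scl_mult_left)

lemma adj_zero [simp]: "adj A \<zero> = \<zero>"
  using adj_scl[of \<zero> 0] adj_closed[of \<zero>] by simp

lemma adj_one [simp]: "adj A \<one> = \<one>"
  using adj_mult[of "adj A \<one>" \<one>] adj_adj[of \<one>] adj_closed[of \<one>] by simp

lemma adj_minus: "x \<in> carrier A \<Longrightarrow> adj A (\<ominus> x) = \<ominus> adj A x"
  using adj_scl[of x "-1"] by (simp add: scl_minus_one adj_closed)

lemma adj_diff:
  "\<lbrakk>x \<in> carrier A; y \<in> carrier A\<rbrakk> \<Longrightarrow> adj A (x \<ominus> y) = adj A x \<ominus> adj A y"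
  by (simp add: a_minus_def adj_add adj_minus adj_closed)

lemma nrm_zero [simp]: "nrm A \<zero> = 0"
  by (simp add: nrm_eq_0)

lemma nrm_minus: "x \<in> carrier A \<Longrightarrow> nrm A (\<ominus> x) = nrm A x"
  using nrm_scl[of x "-1"] by (simp add: scl_minus_one)

lemma nrm_minus_commute:
  "\<lbrakk>x \<in> carrier A; y \<in> carrier A\<rbrakk> \<Longrightarrow> nrm A (x \<ominus> y) = nrm A (y \<ominus> x)"
  using nrm_minus[of "x \<ominus> y"] by (simp add: a_minus_def minus_add a_comm)

lemma nrm_diff_triangle:
  assumes "x \<in> carrier A" "y \<in> carrier A" "z \<in> carrier A"
  shows "nrm A (x \<ominus> z) \<le> nrm A (x \<ominus> y) + nrm A (y \<ominus> z)"
proof -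
  have "x \<ominus> z = (x \<ominus> y) \<oplus> (y \<ominus> z)"
    using assms by (simp add: a_minus_def a_assoc) (simp add: l_neg flip: a_assoc)
  then show ?thesis using nrm_triangle[of "x \<ominus> y" "y \<ominus> z"] assms by simp
qed

lemma nrm_le_diff:
  assumes "x \<in> carrier A" "y \<in> carrier A"
  shows "nrm A x \<le> nrm A (x \<ominus> y) + nrm A y"
  using nrm_diff_triangle[of x y \<zero>] assms by (simp add: a_minus_def)

lemma nrm_adj_le: "x \<in> carrier A \<Longrightarrow> nrm A x \<le> nrm A (adj A x)"
  using cstar_identity[of x] nrm_mult[of "adj A x" x] nrm_nonneg[of x] nrm_nonneg[of "adj A x"]
  by (cases "nrm A x = 0") (auto simp: adj_closed power2_eq_square)

lemma nrm_adj: "x \<in> carrier A \<Longrightarrow> nrm A (adj A x) = nrm A x"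
  using nrm_adj_le[of x] nrm_adj_le[of "adj A x"] by (simp add: adj_closed adj_adj)

lemma nrm_idem_le:
  assumes "p \<in> carrier A" "adj A p = p" "p \<otimes> p = p" shows "nrm A p \<le> 1"
proof -
  have "nrm A p = (nrm A p)\<^sup>2" using cstar_identity[of p] assms by simp
  then show ?thesis by (metis abs_0 abs_1 le_numeral_extra(4) mult_cancel_right1 power2_eq_square zero_le_one)
qed

lemma nrm_unitary_le: "x \<in> carrier A \<Longrightarrow> adj A x \<otimes> x = \<one> \<Longrightarrow> nrm A x \<le> 1"
  using cstar_identity[of x] nrm_idem_le[of \<one>] nrm_nonneg[of x] power_mono_iff[of "nrm A x" 1 2]
  by simp

section \<open>The norm metric, closures and limits of sequences\<close>

sublocale M: Metric_space "carrier A" "cstar_dist A"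
proof
  show "0 \<le> cstar_dist A x y" for x y
    by (simp add: cstar_dist_def nrm_nonneg)
  show "cstar_dist A x y = cstar_dist A y x" for x y
    using nrm_minus_commute[of x y] by (simp add: cstar_dist_def)
  show "cstar_dist A x y = 0 \<longleftrightarrow> x = y" if "x \<in> carrier A" "y \<in> carrier A" for x y
    using that by (simp add: cstar_dist_def nrm_eq_0) 
  show "cstar_dist A x z \<le> cstar_dist A x y + cstar_dist A y z"
    if "x \<in> carrier A" "y \<in> carrier A" "z \<in> carrier A" for x y z
    using that nrm_diff_triangle[of x y z] by (simp add: cstar_dist_def)
qed

lemma in_closure_iff:
  assumes "S \<subseteq> carrier A"
  shows "x \<in> cstar_topology A closure_of S \<longleftrightarrow>
    x \<in> carrier A \<and> (\<forall>e>0. \<exists>y\<in>S. nrm A (x \<ominus> y) < e)"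
  using assms unfolding M.metric_closure_of M.mball_def
  by (auto simp: cstar_dist_def subset_iff Bex_def)

lemma closure_subset_carrier: "cstar_topology A closure_of S \<subseteq> carrier A"
  using M.metric_closure_of by auto

lemma closedin_iff:
  assumes "S \<subseteq> carrier A"
  shows "closedin (cstar_topology A) S \<longleftrightarrow>
    (\<forall>x\<in>carrier A. (\<forall>e>0. \<exists>y\<in>S. nrm A (x \<ominus> y) < e) \<longrightarrow> x \<in> S)"
proof -
  have "closedin (cstar_topology A) S \<longleftrightarrow> cstar_topology A closure_of S \<subseteq> S"
    using assms by (metis M.topspace_mtopology closure_of_eq closure_of_subset closure_of_subset_eq subset_antisym order_refl)
  then show ?thesis using in_closure_iff[OF assms] by blast
qed

abbreviation converges :: "(nat \<Rightarrow> 'a) \<Rightarrow> 'a \<Rightarrow> bool" where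
  "converges f x \<equiv> (\<lambda>n. nrm A (f n \<ominus> x)) \<longlonglongrightarrow> 0"

lemma cauchy_converges:
  fixes f :: "nat \<Rightarrow> 'a"
  assumes f: "\<And>n. f n \<in> carrier A"
    and cauchy: "\<And>e. e > 0 \<Longrightarrow> \<exists>N. \<forall>m\<ge>N. \<forall>n\<ge>N. nrm A (f m \<ominus> f n) < e"
  obtains x where "x \<in> carrier A" "converges f x"
proof -
  have "M.MCauchy f"
    unfolding M.MCauchy_def using assms by (auto simp: cstar_dist_def)
  then obtain x where x: "limitin M.mtopology f x sequentially"
    using complete unfolding M.mcomplete_def by blast
  then have xc: "x \<in> carrier A"
    and *: "\<And>e. e > 0 \<Longrightarrow> \<forall>\<^sub>F n in sequentially. f n \<in> carrier A \<and> cstar_dist A (f n) x < e"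
    unfolding M.limitin_metric by auto
  have "converges f x"
    using * f xc by (auto simp: LIMSEQ_def nrm_nonneg eventually_sequentially cstar_dist_def)
  then show ?thesis using that xc by blast
qed

lemma converges_unique:
  assumes "\<And>n. f n \<in> carrier A" "x \<in> carrier A" "y \<in> carrier A" "converges f x" "converges f y"
  shows "x = y"
proof -
  have "(\<lambda>n. nrm A (f n \<ominus> x) + nrm A (f n \<ominus> y)) \<longlonglongrightarrow> 0 + 0"
    using assms by (intro tendsto_add)
  moreover have "nrm A (x \<ominus> y) \<le> nrm A (f n \<ominus> x) + nrm A (f n \<ominus> y)" for n
    using nrm_diff_triangle[of x "f n" y] nrm_minus_commute[of x "f n"] assms by simp
  ultimately have "nrm A (x \<ominus> y) \<le> 0"
    by (intro LIMSEQ_le_const) auto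
  then have "nrm A (x \<ominus> y) = 0" using nrm_nonneg[of "x \<ominus> y"] assms by simp
  then show ?thesis using assms by (simp add: nrm_eq_0)
qed

lemma diff_add_diff:
  assumes "x \<in> carrier A" "y \<in> carrier A" "x' \<in> carrier A" "y' \<in> carrier A"
  shows "(x \<oplus> y) \<ominus> (x' \<oplus> y') = (x \<ominus> x') \<oplus> (y \<ominus> y')"
  using assms by (simp add: a_minus_def minus_add a_ac)

text \<open>Telescoping that respects the order of the factors; it drives both the continuity of the
  product and the contraction estimate for square roots.\<close>

lemma diff_mult_mult:
  assumes "x \<in> carrier A" "y \<in> carrier A" "x' \<in> carrier A" "y' \<in> carrier A"
  shows "(x \<otimes> y) \<ominus> (x' \<otimes> y') = (x \<ominus> x') \<otimes> y \<oplus> x' \<otimes> (y \<ominus> y')"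
  using assms by (simp add: a_minus_def l_distr r_distr r_minus l_minus a_assoc r_neg1)

lemma converges_add:
  assumes "\<And>n. f n \<in> carrier A" "\<And>n. g n \<in> carrier A" "x \<in> carrier A" "y \<in> carrier A"
    and "converges f x" "converges g y"
  shows "converges (\<lambda>n. f n \<oplus> g n) (x \<oplus> y)"
proof (rule tendsto_sandwich[of "\<lambda>_. 0" _ _ "\<lambda>n. nrm A (f n \<ominus> x) + nrm A (g n \<ominus> y)"])
  show "\<forall>\<^sub>F n in sequentially. nrm A ((f n \<oplus> g n) \<ominus> (x \<oplus> y)) \<le> nrm A (f n \<ominus> x) + nrm A (g n \<ominus> y)"
    using assms by (simp add: diff_add_diff nrm_triangle)
  show "(\<lambda>n. nrm A (f n \<ominus> x) + nrm A (g n \<ominus> y)) \<longlonglongrightarrow> 0"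
    using tendsto_add[OF assms(5,6)] by simp
qed (use assms in \<open>auto simp: nrm_nonneg\<close>)

lemma converges_scl:
  assumes "\<And>n. f n \<in> carrier A" "x \<in> carrier A" "converges f x"
  shows "converges (\<lambda>n. scl A c (f n)) (scl A c x)"
  using tendsto_mult_left[OF assms(3), of "cmod c"] assms
  by (simp flip: scl_diff_right add: nrm_scl)

lemma converges_adj:
  assumes "\<And>n. f n \<in> carrier A" "x \<in> carrier A" "converges f x"
  shows "converges (\<lambda>n. adj A (f n)) (adj A x)"
  using assms by (simp flip: adj_diff add: nrm_adj)

lemma converges_mult:
  assumes "\<And>n. f n \<in> carrier A" "\<And>n. g n \<in> carrier A" "x \<in> carrier A" "y \<in> carrier A"
    and "converges f x" "converges g y"
  shows "converges (\<lambda>n. f n \<otimes> g n) (x \<otimes> y)"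
proof (rule tendsto_sandwich[of "\<lambda>_. 0" _ _
    "\<lambda>n. nrm A (f n \<ominus> x) * (nrm A (g n \<ominus> y) + nrm A y) + nrm A x * nrm A (g n \<ominus> y)"])
  have "nrm A (f n \<otimes> g n \<ominus> x \<otimes> y)
      \<le> nrm A (f n \<ominus> x) * (nrm A (g n \<ominus> y) + nrm A y) + nrm A x * nrm A (g n \<ominus> y)" for n
  proof -
    have "nrm A (f n \<otimes> g n \<ominus> x \<otimes> y)
        \<le> nrm A ((f n \<ominus> x) \<otimes> g n) + nrm A (x \<otimes> (g n \<ominus> y))"
      using assms by (simp add: diff_mult_mult nrm_triangle)
    also have "\<dots> \<le> nrm A (f n \<ominus> x) * nrm A (g n) + nrm A x * nrm A (g n \<ominus> y)"
      using assms by (intro add_mono nrm_mult) auto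
    also have "\<dots> \<le> nrm A (f n \<ominus> x) * (nrm A (g n \<ominus> y) + nrm A y) + nrm A x * nrm A (g n \<ominus> y)"
      using assms by (intro add_mono mult_left_mono nrm_le_diff nrm_nonneg) auto
    finally show ?thesis .
  qed
  then show "\<forall>\<^sub>F n in sequentially. nrm A (f n \<otimes> g n \<ominus> x \<otimes> y)
      \<le> nrm A (f n \<ominus> x) * (nrm A (g n \<ominus> y) + nrm A y) + nrm A x * nrm A (g n \<ominus> y)" by simp
  have "(\<lambda>n. nrm A (f n \<ominus> x) * (nrm A (g n \<ominus> y) + nrm A y) + nrm A x * nrm A (g n \<ominus> y))
      \<longlonglongrightarrow> 0 * (0 + nrm A y) + nrm A x * 0"
    by (intro tendsto_intros assms)
  then show "(\<lambda>n. nrm A (f n \<ominus> x) * (nrm A (g n \<ominus> y) + nrm A y) + nrm A x * nrm A (g n \<ominus> y))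
      \<longlonglongrightarrow> 0" by simp
qed (use assms in \<open>auto simp: nrm_nonneg\<close>)

lemma converges_const: "x \<in> carrier A \<Longrightarrow> converges (\<lambda>_. x) x"
  by (simp add: a_minus_def r_neg)

section \<open>Square roots and contractivity of star homomorphisms\<close>

text \<open>The square root is \<open>1 - w\<close> for the fixed point \<open>w\<close> of the contraction \<open>w \<mapsto> (z + w\<^sup>2) / 2\<close>.\<close>

lemma sqrt_one_minus:
  assumes z: "z \<in> carrier A" "adj A z = z" "nrm A z < 1"
  obtains y where "y \<in> carrier A" "adj A y = y" "y \<otimes> y = \<one> \<ominus> z"
    "\<And>x. x \<in> carrier A \<Longrightarrow> x \<otimes> z = z \<otimes> x \<Longrightarrow> x \<otimes> y = y \<otimes> x"
proof -
  define r where "r = nrm A z"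
  have r: "0 \<le> r" "r < 1" using z by (auto simp: r_def nrm_nonneg)
  define w where "w = rec_nat \<zero> (\<lambda>_ v. scl A (1/2) (z \<oplus> v \<otimes> v))"
  have w0: "w 0 = \<zero>" and wS: "w (Suc n) = scl A (1/2) (z \<oplus> w n \<otimes> w n)" for n
    by (simp_all add: w_def)
  have wc [simp]: "w n \<in> carrier A" for n
    by (induction n) (use z in \<open>auto simp: w0 wS scl_closed\<close>)
  have wa: "adj A (w n) = w n" for n
    by (induction n) (use z in \<open>auto simp: w0 wS scl_closed adj_scl adj_add adj_mult\<close>)
  \<comment> \<open>The ball of radius \<open>r\<close> is mapped into itself, because
    \<open>(r + r * r) / 2 \<le> r\<close>.\<close>
  have wn: "nrm A (w n) \<le> r" for n
  proof (induction n)
    case (Suc n)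
    have "nrm A (w (Suc n)) \<le> 1/2 * (nrm A z + nrm A (w n) * nrm A (w n))"
      unfolding wS using z nrm_triangle[of z "w n \<otimes> w n"] nrm_mult[of "w n" "w n"]
      by (simp add: nrm_scl)
    also have "\<dots> \<le> 1/2 * (r + r * 1)"
      using Suc r by (intro mult_left_mono add_mono mult_mono) (auto simp: r_def nrm_nonneg)
    finally show ?case by simp
  qed (simp add: w0 r)
  \<comment> \<open>On that ball the map contracts by the factor \<open>r\<close>: a difference of
    squares is bounded by the difference times the sum of two norms, and half of that sum is at most
    \<open>r\<close>.\<close>
  have step: "nrm A (w (Suc n) \<ominus> w n) \<le> r ^ n" for n
  proof (induction n)
    case 0
    have "nrm A (w (Suc 0) \<ominus> w 0) = nrm A (w (Suc 0))" by (simp add: w0 a_minus_def del: wS)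
    then show ?case using wn[of "Suc 0"] r by simp
  next
    case (Suc n)
    let ?d = "w (Suc n) \<ominus> w n"
    have "w (Suc (Suc n)) \<ominus> w (Suc n)
        = scl A (1/2) (?d \<otimes> w (Suc n) \<oplus> w n \<otimes> ?d)"
    proof -
      have "w (Suc (Suc n)) \<ominus> w (Suc n)
          = scl A (1/2) ((z \<oplus> w (Suc n) \<otimes> w (Suc n)) \<ominus> (z \<oplus> w n \<otimes> w n))"
        using z scl_diff_right[of "z \<oplus> w (Suc n) \<otimes> w (Suc n)" "z \<oplus> w n \<otimes> w n" "1/2"]
        by (simp flip: wS)
      then show ?thesis using z by (simp add: diff_add_diff diff_mult_mult scl_closed)
    qed
    also have "nrm A \<dots> = 1/2 * nrm A (?d \<otimes> w (Suc n) \<oplus> w n \<otimes> ?d)"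
      by (simp add: nrm_scl)
    also have "\<dots> \<le> 1/2 * (nrm A ?d * nrm A (w (Suc n)) + nrm A (w n) * nrm A ?d)"
      by (intro mult_left_mono order.trans[OF nrm_triangle] add_mono nrm_mult) auto
    also have "\<dots> \<le> 1/2 * (r ^ n * r + r * r ^ n)"
      using r by (intro mult_left_mono add_mono mult_mono Suc wn) (auto simp: nrm_nonneg)
    finally show ?case by simp
  qed
  have far: "nrm A (w (n + k) \<ominus> w n) \<le> r ^ n / (1 - r)" for n k
  proof -
    have "nrm A (w (n + k) \<ominus> w n) \<le> (\<Sum>i<k. r ^ (n + i))"
    proof (induction k)
      case 0 then show ?case by (simp add: a_minus_def r_neg)
    next
      case (Suc k)
      have "nrm A (w (n + Suc k) \<ominus> w n) \<le> nrm A (w (Suc (n + k)) \<ominus> w (n + k)) + nrm A (w (n + k) \<ominus> w n)"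
        using nrm_diff_triangle[of "w (Suc (n + k))" "w (n + k)" "w n"] by simp
      then show ?case using step[of "n + k"] Suc by simp
    qed
    also have "\<dots> = r ^ n * (\<Sum>i<k. r ^ i)" by (simp add: power_add sum_distrib_left)
    also have "\<dots> \<le> r ^ n * (1 / (1 - r))"
      using r by (intro mult_left_mono) (auto simp: sum_gp_strict intro!: divide_right_mono)
    finally show ?thesis by simp
  qed
  have "\<exists>N. \<forall>m\<ge>N. \<forall>n\<ge>N. nrm A (w m \<ominus> w n) < e" if "e > 0" for e :: real
  proof -
    have "(\<lambda>n. r ^ n) \<longlonglongrightarrow> 0" using r by (intro LIMSEQ_realpow_zero) auto
    then have "(\<lambda>n. 2 * r ^ n / (1 - r)) \<longlonglongrightarrow> 2 * 0 / (1 - r)" using r by (intro tendsto_intros) auto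
    then have "\<forall>\<^sub>F n in sequentially. 2 * r ^ n / (1 - r) < e"
      using that by (intro order_tendstoD(2)) auto
    then obtain N where N: "2 * r ^ N / (1 - r) < e"
      by (auto simp: eventually_sequentially)
    have "nrm A (w m \<ominus> w n) < e" if "m \<ge> N" "n \<ge> N" for m n
      using far[of N "m - N"] far[of N "n - N"] nrm_diff_triangle[of "w m" "w N" "w n"]
        nrm_minus_commute[of "w N" "w n"] that N by simp
    then show ?thesis by blast
  qed
  then obtain v where v: "v \<in> carrier A" "converges w v"
    by (rule cauchy_converges[of w, OF wc]) blast
  have va: "adj A v = v"
    using converges_adj[of w v] v by (intro converges_unique[of w]) (auto simp: wa adj_closed)
  have "converges (\<lambda>n. w (Suc n)) v" using LIMSEQ_Suc[OF v(2)] .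
  moreover have "converges (\<lambda>n. w (Suc n)) (scl A (1/2) (z \<oplus> v \<otimes> v))"
    unfolding wS using v z by (intro converges_scl converges_add converges_mult converges_const) auto
  ultimately have fix_v: "v = scl A (1/2) (z \<oplus> v \<otimes> v)"
    by (rule converges_unique[rotated -2]) (use v z in \<open>auto simp: scl_closed\<close>)
  have vz: "v \<oplus> v = z \<oplus> v \<otimes> v"
  proof -
    have "v \<oplus> v = scl A (1/2 + 1/2) (z \<oplus> v \<otimes> v)"
      using fix_v v z scl_add_left[of "z \<oplus> v \<otimes> v" "1/2" "1/2"] by simp
    then show ?thesis using v z by (simp add: scl_one)
  qed
  show ?thesis
  proof (rule that[of "\<one> \<ominus> v"])
    have "(\<one> \<ominus> v) \<otimes> (\<one> \<ominus> v) = \<one> \<ominus> ((v \<oplus> v) \<ominus> v \<otimes> v)"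
      using v by (simp add: a_minus_def l_distr r_distr r_minus l_minus minus_add a_ac)
    also have "(v \<oplus> v) \<ominus> v \<otimes> v = z"
      unfolding vz using v z by (simp add: a_minus_def a_assoc r_neg)
    finally show "(\<one> \<ominus> v) \<otimes> (\<one> \<ominus> v) = \<one> \<ominus> z" .
    show "adj A (\<one> \<ominus> v) = \<one> \<ominus> v" using v va by (simp add: adj_diff)
    \<comment> \<open>All iterates are built from \<open>z\<close>, so they commute with
      \<open>x\<close>, and the limit inherits this. Below, \<open>z\<close> will be a square
      \<open>x \<otimes> x\<close>, and the root has to commute with that \<open>x\<close>.\<close>
    fix x assume x: "x \<in> carrier A" "x \<otimes> z = z \<otimes> x"
    have "x \<otimes> w n = w n \<otimes> x" for n
    proof (induction n)
      case (Suc n)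
      have "x \<otimes> (w n \<otimes> w n) = (w n \<otimes> w n) \<otimes> x"
        using x Suc by (metis m_assoc wc)
      then show ?case
        using x z by (simp add: wS scl_mult_left scl_mult_right l_distr r_distr)
    qed (use x in \<open>simp add: w0\<close>)
    moreover have "converges (\<lambda>n. x \<otimes> w n) (x \<otimes> v)" "converges (\<lambda>n. w n \<otimes> x) (v \<otimes> x)"
      using v x by (intro converges_mult converges_const; simp)+
    ultimately have "x \<otimes> v = v \<otimes> x"
      using x v by (intro converges_unique[of "\<lambda>n. x \<otimes> w n"]) auto
    then show "x \<otimes> (\<one> \<ominus> v) = (\<one> \<ominus> v) \<otimes> x"
      using x v by (simp add: a_minus_def l_distr r_distr l_minus r_minus)
  qed (use v in auto)
qed

text \<open>The element \<open>v = z + \<i> y\<close> satisfies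
  \<open>adj A v \<otimes> v = \<one>\<close>, so its norm is at most 1, and \<open>z\<close> is its
  real part.\<close>

lemma nrm_le_one_of_circle:
  assumes "z \<in> carrier A" "adj A z = z" "y \<in> carrier A" "adj A y = y" "z \<otimes> y = y \<otimes> z"
    and circ: "z \<otimes> z \<oplus> y \<otimes> y = \<one>"
  shows "nrm A z \<le> 1"
proof -
  define v where "v = z \<oplus> scl A \<i> y"
  have v: "v \<in> carrier A" using assms by (simp add: v_def scl_closed)
  have av: "adj A v = z \<oplus> scl A (-\<i>) y" using assms by (simp add: v_def adj_add adj_scl scl_closed)
  have "adj A v \<otimes> v = z \<otimes> z \<oplus> scl A (-\<i>) (y \<otimes> z) \<oplus> (scl A \<i> (y \<otimes> z) \<oplus> y \<otimes> y)"
    unfolding av unfolding v_def using assms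
    by (simp add: l_distr r_distr scl_closed scl_mult_left scl_mult_right scl_scl scl_one scl_add_right
        a_ac del: scl_minus_left)
  also have "\<dots> = \<one>"
    using assms by (simp add: scl_minus_left a_assoc r_neg1 r_neg2 scl_closed)
  finally have nv: "nrm A v \<le> 1" using v by (intro nrm_unitary_le)
  have "v \<oplus> adj A v = z \<oplus> z"
    unfolding av unfolding v_def using assms by (simp add: scl_minus_left scl_closed a_ac r_neg r_neg1 r_neg2)
  also have "\<dots> = scl A 2 z" using assms scl_add_left[of z 1 1] by (simp add: scl_one)
  finally have "2 * nrm A z = nrm A (v \<oplus> adj A v)" using assms by (simp add: nrm_scl)
  also have "\<dots> \<le> nrm A v + nrm A (adj A v)" using v by (intro nrm_triangle) (auto simp: adj_closed)
  finally show ?thesis using nv v by (simp add: nrm_adj)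
qed

end

lemma star_hom_closed: "f \<in> star_hom A B \<Longrightarrow> x \<in> carrier A \<Longrightarrow> f x \<in> carrier B"
  and star_hom_add: "f \<in> star_hom A B \<Longrightarrow> x \<in> carrier A \<Longrightarrow> y \<in> carrier A \<Longrightarrow> f (x \<oplus>\<^bsub>A\<^esub> y) = f x \<oplus>\<^bsub>B\<^esub> f y"
  and star_hom_mult: "f \<in> star_hom A B \<Longrightarrow> x \<in> carrier A \<Longrightarrow> y \<in> carrier A \<Longrightarrow> f (x \<otimes>\<^bsub>A\<^esub> y) = f x \<otimes>\<^bsub>B\<^esub> f y"
  and star_hom_one: "f \<in> star_hom A B \<Longrightarrow> f \<one>\<^bsub>A\<^esub> = \<one>\<^bsub>B\<^esub>"
  and star_hom_scl: "f \<in> star_hom A B \<Longrightarrow> x \<in> carrier A \<Longrightarrow> f (scl A c x) = scl B c (f x)"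
  and star_hom_adj: "f \<in> star_hom A B \<Longrightarrow> x \<in> carrier A \<Longrightarrow> f (adj A x) = adj B (f x)"
  by (auto simp: star_hom_def ring_hom_def)

locale cstar_hom = A: unital_cstar_algebra A + B: unital_cstar_algebra B
  for A :: "('a, 'm) cstar_scheme" and B :: "('b, 'n) cstar_scheme" +
  fixes f :: "'a \<Rightarrow> 'b"
  assumes f: "f \<in> star_hom A B"
begin

lemmas f_simps = star_hom_closed[OF f] star_hom_add[OF f] star_hom_mult[OF f] star_hom_one[OF f]
  star_hom_scl[OF f] star_hom_adj[OF f]

lemma f_zero: "f \<zero>\<^bsub>A\<^esub> = \<zero>\<^bsub>B\<^esub>"
  using f_simps(5)[of "\<zero>\<^bsub>A\<^esub>" 0] f_simps(1) by simp

lemma f_minus: "x \<in> carrier A \<Longrightarrow> f (\<ominus>\<^bsub>A\<^esub> x) = \<ominus>\<^bsub>B\<^esub> f x"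
  using f_simps(5)[of x "-1"] f_simps(1) by (simp add: A.scl_minus_one B.scl_minus_one)

lemma f_diff: "x \<in> carrier A \<Longrightarrow> y \<in> carrier A \<Longrightarrow> f (x \<ominus>\<^bsub>A\<^esub> y) = f x \<ominus>\<^bsub>B\<^esub> f y"
  by (simp add: a_minus_def f_simps f_minus)

text \<open>With \<open>y\<close> a square root of \<open>1 - x\<^sup>2\<close> that commutes with
  \<open>x\<close>, the identity \<open>x\<^sup>2 + y\<^sup>2 = 1\<close> is purely algebraic. So
  \<open>f\<close> transports it to \<open>B\<close>, where it bounds the norm of
  \<open>f x\<close>.\<close>

lemma contractive_aux:
  assumes x: "x \<in> carrier A" "adj A x = x" "nrm A x < 1"
  shows "nrm B (f x) \<le> 1"
proof -
  have "nrm A (x \<otimes>\<^bsub>A\<^esub> x) < 1"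
    using A.cstar_identity[of x] x A.nrm_nonneg[of x] by (simp add: power_less_one_iff)
  then obtain y where y: "y \<in> carrier A" "adj A y = y" "y \<otimes>\<^bsub>A\<^esub> y = \<one>\<^bsub>A\<^esub> \<ominus>\<^bsub>A\<^esub> x \<otimes>\<^bsub>A\<^esub> x" "x \<otimes>\<^bsub>A\<^esub> y = y \<otimes>\<^bsub>A\<^esub> x"
    using A.sqrt_one_minus[of "x \<otimes>\<^bsub>A\<^esub> x"] x by (metis A.adj_mult A.m_assoc A.m_closed)
  have "x \<otimes>\<^bsub>A\<^esub> x \<oplus>\<^bsub>A\<^esub> y \<otimes>\<^bsub>A\<^esub> y = \<one>\<^bsub>A\<^esub>"
    unfolding y(3) using x by (simp add: a_minus_def A.a_ac A.r_neg A.r_neg1 A.r_neg2)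
  then have "f x \<otimes>\<^bsub>B\<^esub> f x \<oplus>\<^bsub>B\<^esub> f y \<otimes>\<^bsub>B\<^esub> f y = \<one>\<^bsub>B\<^esub>"
    using x y by (metis A.m_closed f_simps(2-4))
  then show ?thesis
    using x y by (intro B.nrm_le_one_of_circle[of _ "f y"]) (simp_all flip: f_simps(3,6) add: f_simps(1))
qed

lemma contractive_self_adjoint:
  assumes x: "x \<in> carrier A" "adj A x = x"
  shows "nrm B (f x) \<le> nrm A x"
proof (rule dense_ge)
  fix r assume r: "nrm A x < r"
  then have "r > 0" using A.nrm_nonneg[of x] x by simp
  let ?y = "scl A (of_real (1 / r)) x"
  have "nrm B (f ?y) \<le> 1"
    using x r \<open>r > 0\<close> by (intro contractive_aux) (auto simp: A.scl_closed A.adj_scl A.nrm_scl norm_divide field_simps)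
  then show "nrm B (f x) \<le> r"
    using x \<open>r > 0\<close> by (simp add: f_simps B.nrm_scl norm_divide field_simps)
qed

lemma contractive:
  assumes x: "x \<in> carrier A"
  shows "nrm B (f x) \<le> nrm A x"
proof -
  have "(nrm B (f x))\<^sup>2 = nrm B (f (adj A x \<otimes>\<^bsub>A\<^esub> x))"
    using x by (simp add: f_simps B.cstar_identity A.adj_closed)
  also have "\<dots> \<le> (nrm A x)\<^sup>2"
    using contractive_self_adjoint[of "adj A x \<otimes>\<^bsub>A\<^esub> x"] x
    by (simp add: A.adj_closed A.adj_mult A.adj_adj A.cstar_identity)
  finally show ?thesis using A.nrm_nonneg x by (meson power2_le_imp_le)
qed

text \<open>The inverse of a bijective star homomorphism is one as well, and both are
  contractive.\<close>

lemma isometric: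
  assumes bij: "bij_betw f (carrier A) (carrier B)" and x: "x \<in> carrier A"
  shows "nrm B (f x) = nrm A x"
proof -
  let ?g = "inv_into (carrier A) f"
  have g: "?g y \<in> carrier A" "f (?g y) = y" if "y \<in> carrier B" for y
    using bij that by (auto simp: bij_betw_def inv_into_into f_inv_into_f)
  have gf: "?g (f y) = y" if "y \<in> carrier A" for y
    using bij that by (auto simp: bij_betw_def)
  have eq: "?g y = z" if "z \<in> carrier A" "f z = y" for y z
    using that gf by auto
  have "?g \<in> star_hom B A"
    unfolding star_hom_def ring_hom_def
    by (auto intro!: eq simp: g f_simps A.scl_closed A.adj_closed)
  then interpret g: cstar_hom B A ?g by unfold_locales
  show ?thesis using contractive[OF x] g.contractive[of "f x"] x by (simp add: gf f_simps)
qed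

end


section \<open>Subspaces, subalgebras and ideals\<close>

context unital_cstar_algebra
begin

text \<open>These are the sets over which \<open>cspan\<close> takes its intersection, so that
  \<open>cspan_least\<close> serves as an induction principle for spans.\<close>

definition csubspace :: "'a set \<Rightarrow> bool" where
  "csubspace V \<longleftrightarrow> subgroup V (add_monoid A) \<and> (\<forall>c. \<forall>x\<in>V. scl A c x \<in> V)"

lemma csubspaceI:
  assumes "V \<subseteq> carrier A" "\<zero> \<in> V" "\<And>x y. x \<in> V \<Longrightarrow> y \<in> V \<Longrightarrow> x \<oplus> y \<in> V"
    and scl: "\<And>c x. x \<in> V \<Longrightarrow> scl A c x \<in> V"
  shows "csubspace V"
proof -
  have "\<ominus> x \<in> V" if "x \<in> V" for x
    using scl[OF that, of "-1"] that assms(1) by (auto simp: scl_minus_one)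
  then have "subgroup V (add_monoid A)"
    using assms by (intro add.subgroupI) (auto simp: a_inv_def)
  then show ?thesis using scl by (simp add: csubspace_def)
qed

lemma csubspaceD:
  assumes "csubspace V"
  shows "V \<subseteq> carrier A" "\<zero> \<in> V" "\<And>x y. x \<in> V \<Longrightarrow> y \<in> V \<Longrightarrow> x \<oplus> y \<in> V"
    "\<And>c x. x \<in> V \<Longrightarrow> scl A c x \<in> V" "\<And>x y. x \<in> V \<Longrightarrow> y \<in> V \<Longrightarrow> x \<ominus> y \<in> V"
  using assms subgroup.m_inv_closed[of V "add_monoid A"]
  by (auto simp: csubspace_def subgroup_def a_minus_def a_inv_def)

lemma csubspace_carrier: "csubspace (carrier A)"
  by (intro csubspaceI) (auto simp: scl_closed)

lemma cspan_least: "csubspace V \<Longrightarrow> S \<subseteq> V \<Longrightarrow> cspan A S \<subseteq> V"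
  by (auto simp: cspan_def csubspace_def)

lemma cspan_superset: "S \<subseteq> cspan A S"
  by (auto simp: cspan_def)

lemma cspan_subset_carrier: "S \<subseteq> carrier A \<Longrightarrow> cspan A S \<subseteq> carrier A"
  by (intro cspan_least csubspace_carrier)

lemma csubspace_cspan:
  assumes "S \<subseteq> carrier A" shows "csubspace (cspan A S)"
proof (rule csubspaceI)
  have *: "cspan A S = \<Inter>{V. csubspace V \<and> S \<subseteq> V}"
    by (simp add: cspan_def csubspace_def conj_assoc)
  show "\<zero> \<in> cspan A S" "\<And>x y. x \<in> cspan A S \<Longrightarrow> y \<in> cspan A S \<Longrightarrow> x \<oplus> y \<in> cspan A S"
    "\<And>c x. x \<in> cspan A S \<Longrightarrow> scl A c x \<in> cspan A S"
    unfolding * using csubspaceD by blast+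
qed (rule cspan_subset_carrier[OF assms])

lemma in_closure_seq:
  assumes "S \<subseteq> carrier A"
  shows "x \<in> cstar_topology A closure_of S \<longleftrightarrow>
    x \<in> carrier A \<and> (\<exists>f. (\<forall>n. f n \<in> S) \<and> converges f x)"
proof safe
  assume x: "x \<in> cstar_topology A closure_of S"
  then have "\<forall>n. \<exists>y. y \<in> S \<and> nrm A (x \<ominus> y) < inverse (real (Suc n))"
    using in_closure_iff[OF assms] by (auto simp: Bex_def)
  then obtain f where f: "\<And>n. f n \<in> S" "\<And>n. nrm A (x \<ominus> f n) < inverse (real (Suc n))" by metis
  have "x \<in> carrier A" using x closure_subset_carrier by auto
  then have "nrm A (f n \<ominus> x) < inverse (real (Suc n))" for n
    using f[of n] assms nrm_minus_commute[of x "f n"] by (auto dest!: subsetD)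
  moreover have "0 \<le> nrm A (f n \<ominus> x)" for n
    using f(1)[of n] \<open>x \<in> carrier A\<close> assms by (intro nrm_nonneg minus_closed) auto
  ultimately have "converges f x"
    using LIMSEQ_inverse_real_of_nat
    by (rule_tac real_tendsto_sandwich[of "\<lambda>_. 0" _ _ "\<lambda>n. inverse (real (Suc n))"]) (auto intro!: always_eventually less_imp_le)
  then show "\<exists>f. (\<forall>n. f n \<in> S) \<and> converges f x" using f by blast
next
  fix f assume x: "x \<in> carrier A" and f: "\<forall>n. f n \<in> S" "converges f x"
  have "\<exists>y\<in>S. nrm A (x \<ominus> y) < e" if "e > 0" for e
  proof -
    have "\<forall>\<^sub>F n in sequentially. nrm A (f n \<ominus> x) < e"
      using f(2) that by (intro order_tendstoD(2)) auto
    then obtain n where "nrm A (f n \<ominus> x) < e" by (auto simp: eventually_sequentially)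
    moreover have "f n \<in> carrier A" using f(1) assms by auto
    ultimately show ?thesis using f(1) x nrm_minus_commute[of x "f n"] by (auto intro!: bexI[of _ "f n"])
  qed
  then show "x \<in> cstar_topology A closure_of S" using in_closure_iff[OF assms] x by blast
qed (use closure_subset_carrier in auto)

lemma csubspace_closure:
  assumes "csubspace V" shows "csubspace (cstar_topology A closure_of V)"
proof -
  note V = csubspaceD[OF assms]
  note seq = in_closure_seq[OF V(1)]
  show ?thesis
  proof (rule csubspaceI)
    show "\<zero> \<in> cstar_topology A closure_of V"
      unfolding seq using V(2) converges_const[of \<zero>] by (auto intro!: exI[of _ "\<lambda>_. \<zero>"])
    fix x y assume "x \<in> cstar_topology A closure_of V" "y \<in> cstar_topology A closure_of V"
    then obtain f g where "x \<in> carrier A" "\<And>n. f n \<in> V" "converges f x" "y \<in> carrier A" "\<And>n. g n \<in> V" "converges g y"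
      unfolding seq by auto
    then show "x \<oplus> y \<in> cstar_topology A closure_of V"
      unfolding seq using V by (auto intro!: exI[of _ "\<lambda>n. f n \<oplus> g n"] converges_add)
  next
    fix c x assume "x \<in> cstar_topology A closure_of V"
    then obtain f where "x \<in> carrier A" "\<And>n. f n \<in> V" "converges f x"
      unfolding seq by auto
    then show "scl A c x \<in> cstar_topology A closure_of V"
      unfolding seq using V by (auto simp: scl_closed intro!: exI[of _ "\<lambda>n. scl A c (f n)"] converges_scl)
  qed (rule closure_subset_carrier)
qed

lemma closed_cspan_props:
  assumes "S \<subseteq> carrier A"
  shows "csubspace (closed_cspan A S)" "S \<subseteq> closed_cspan A S" "closedin (cstar_topology A) (closed_cspan A S)"
    "cspan A S \<subseteq> closed_cspan A S"
proof -
  show "csubspace (closed_cspan A S)"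
    unfolding closed_cspan_def by (intro csubspace_closure csubspace_cspan assms)
  show *: "cspan A S \<subseteq> closed_cspan A S"
    unfolding closed_cspan_def
    using closure_of_subset[of "cspan A S" "cstar_topology A"] cspan_subset_carrier[OF assms] by simp
  show "S \<subseteq> closed_cspan A S" using cspan_superset[of S] * by blast
  show "closedin (cstar_topology A) (closed_cspan A S)"
    unfolding closed_cspan_def by (rule closedin_closure_of)
qed

lemma in_closed_cspan_iff:
  assumes "S \<subseteq> carrier A"
  shows "x \<in> closed_cspan A S \<longleftrightarrow> x \<in> carrier A \<and> (\<forall>e>0. \<exists>y\<in>cspan A S. nrm A (x \<ominus> y) < e)"
  unfolding closed_cspan_def by (intro in_closure_iff cspan_subset_carrier assms)

text \<open>One factor at a time: for a fixed factor, the admissible other factors form a subspace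
  containing \<open>W\<close>.\<close>

lemma cspan_mult:
  assumes W: "W \<subseteq> carrier A" "\<And>x y. x \<in> W \<Longrightarrow> y \<in> W \<Longrightarrow> x \<otimes> y \<in> W"
    and "x \<in> cspan A W" "y \<in> cspan A W"
  shows "x \<otimes> y \<in> cspan A W"
proof -
  note S = csubspaceD[OF csubspace_cspan[OF W(1)]]
  have 1: "x \<otimes> y \<in> cspan A W" if "x \<in> W" "y \<in> cspan A W" for x y
  proof -
    have "cspan A W \<subseteq> {y \<in> carrier A. x \<otimes> y \<in> cspan A W}"
      using that W S cspan_superset[of W]
      by (intro cspan_least csubspaceI) (auto simp: r_distr scl_mult_right scl_closed subset_iff)
    then show ?thesis using that by blast
  qed
  have "cspan A W \<subseteq> {x \<in> carrier A. x \<otimes> y \<in> cspan A W}"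
    using assms S cspan_superset[of W] 1
    by (intro cspan_least csubspaceI) (auto simp: l_distr scl_mult_left scl_closed subset_iff)
  then show ?thesis using assms by blast
qed

lemma cspan_adj:
  assumes W: "W \<subseteq> carrier A" "\<And>x. x \<in> W \<Longrightarrow> adj A x \<in> W" and "x \<in> cspan A W"
  shows "adj A x \<in> cspan A W"
proof -
  note S = csubspaceD[OF csubspace_cspan[OF W(1)]]
  have "cspan A W \<subseteq> {x \<in> carrier A. adj A x \<in> cspan A W}"
    using assms S cspan_superset[of W]
    by (intro cspan_least csubspaceI) (auto simp: adj_add adj_scl scl_closed subset_iff)
  then show ?thesis using assms by blast
qed

lemma cstar_subalgebra_closed_cspan:
  assumes W: "W \<subseteq> carrier A" "\<And>x y. x \<in> W \<Longrightarrow> y \<in> W \<Longrightarrow> x \<otimes> y \<in> W"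
    "\<And>x. x \<in> W \<Longrightarrow> adj A x \<in> W" "\<one> \<in> W"
  shows "cstar_subalgebra (closed_cspan A W) A"
proof -
  note C = csubspaceD[OF closed_cspan_props(1)[OF W(1)]]
  note S = cspan_subset_carrier[OF W(1)]
  note seq = in_closure_seq[OF S, folded closed_cspan_def]
  have "subring (closed_cspan A W) A"
  proof (rule subringI)
    show "\<one> \<in> closed_cspan A W" using W closed_cspan_props(2)[OF W(1)] by auto
    show "\<ominus> x \<in> closed_cspan A W" if "x \<in> closed_cspan A W" for x
      using C(4)[OF that, of "-1"] C(1) that by (auto simp: scl_minus_one)
    fix x y assume xy: "x \<in> closed_cspan A W" "y \<in> closed_cspan A W"
    then show "x \<oplus> y \<in> closed_cspan A W" by (rule C)
    from xy obtain f g where "x \<in> carrier A" "\<And>n. f n \<in> cspan A W" "converges f x"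
      "y \<in> carrier A" "\<And>n. g n \<in> cspan A W" "converges g y"
      unfolding seq by auto
    then show "x \<otimes> y \<in> closed_cspan A W"
      unfolding seq using S
      by (auto intro!: exI[of _ "\<lambda>n. f n \<otimes> g n"] converges_mult cspan_mult W)
  qed (rule C)
  moreover have "adj A x \<in> closed_cspan A W" if x: "x \<in> closed_cspan A W" for x
  proof -
    from x obtain f where "x \<in> carrier A" "\<And>n. f n \<in> cspan A W" "converges f x"
      unfolding seq by auto
    then show ?thesis
      unfolding seq using S
      by (auto simp: adj_closed intro!: exI[of _ "\<lambda>n. adj A (f n)"] converges_adj cspan_adj W)
  qed
  ultimately show ?thesis
    using C closed_cspan_props(3)[OF W(1)] by (auto simp: cstar_subalgebra_def)
qed

text \<open>A multiplicative monoid closed under adjoints spans a star algebra, and the closure of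
  that is a C*-subalgebra. It will be applied to the words in a Toeplitz family.\<close>

lemma cstar_generated_subset:
  assumes "W \<subseteq> carrier A" "\<And>x y. x \<in> W \<Longrightarrow> y \<in> W \<Longrightarrow> x \<otimes> y \<in> W"
    "\<And>x. x \<in> W \<Longrightarrow> adj A x \<in> W" "\<one> \<in> W" "T \<subseteq> W"
  shows "cstar_generated A T \<subseteq> closed_cspan A W"
  using cstar_subalgebra_closed_cspan[OF assms(1-4)] closed_cspan_props(2)[OF assms(1)] assms(5)
  unfolding cstar_generated_def by blast

lemma cstar_subalgebra_carrier: "cstar_subalgebra (carrier A) A"
  using carrier_is_subring by (auto simp: cstar_subalgebra_def scl_closed adj_closed)

lemma cstar_subalgebra_generated:
  assumes "T \<subseteq> carrier A" shows "cstar_subalgebra (cstar_generated A T) A" "T \<subseteq> cstar_generated A T"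
proof -
  have ne: "carrier A \<in> {C. cstar_subalgebra C A \<and> T \<subseteq> C}"
    using cstar_subalgebra_carrier assms by simp
  have "subring (cstar_generated A T) A"
    unfolding cstar_generated_def using ne by (intro subring_Inter) (auto simp: cstar_subalgebra_def)
  moreover have "closedin (cstar_topology A) (cstar_generated A T)"
    unfolding cstar_generated_def using ne by (intro closedin_Inter) (auto simp: cstar_subalgebra_def)
  ultimately show "cstar_subalgebra (cstar_generated A T) A"
    by (auto simp: cstar_subalgebra_def cstar_generated_def)
  show "T \<subseteq> cstar_generated A T" by (auto simp: cstar_generated_def)
qed

text \<open>Negation is defined through the carrier and thus changes its meaning in a subalgebra;
  uniqueness of additive inverses shows that its values do not change.\<close>

lemma a_minus_subalgebra:
  assumes "subring C A" "x \<in> C" "y \<in> C"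
  shows "x \<ominus>\<^bsub>A\<lparr>carrier := C\<rparr>\<^esub> y = x \<ominus> y"
proof -
  interpret C: ring "A\<lparr>carrier := C\<rparr>" by (rule subring_is_ring[OF assms(1)])
  note sub = subringE[OF assms(1)]
  have "\<ominus>\<^bsub>A\<lparr>carrier := C\<rparr>\<^esub> y = \<ominus> y"
    using sub assms(3) by (intro C.minus_equality) (auto simp: l_neg)
  then show ?thesis by (simp add: a_minus_def)
qed

lemma cstar_subalgebra_is_cstar_algebra:
  assumes C: "cstar_subalgebra C A"
  shows "unital_cstar_algebra (A\<lparr>carrier := C\<rparr>)"
proof -
  have sr: "subring C A" and scl: "\<And>c x. x \<in> C \<Longrightarrow> scl A c x \<in> C"
    and adj: "\<And>x. x \<in> C \<Longrightarrow> adj A x \<in> C" and cl: "closedin (cstar_topology A) C"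
    using C by (auto simp: cstar_subalgebra_def)
  interpret C: ring "A\<lparr>carrier := C\<rparr>" by (rule subring_is_ring[OF sr])
  note sub = subringE[OF sr]
  have in_A: "x \<in> carrier A" if "x \<in> C" for x using sub(1) that by auto
  have dist: "cstar_dist (A\<lparr>carrier := C\<rparr>) x y = cstar_dist A x y" if "x \<in> C" "y \<in> C" for x y
    using that in_A by (simp add: cstar_dist_def a_minus_subalgebra[OF sr])
  interpret MC: Metric_space C "cstar_dist (A\<lparr>carrier := C\<rparr>)"
  proof
    show "0 \<le> cstar_dist (A\<lparr>carrier := C\<rparr>) x y" for x y
      using dist[of x y] by (cases "x \<in> C \<and> y \<in> C") (auto simp: cstar_dist_def nrm_nonneg in_A)
    show "cstar_dist (A\<lparr>carrier := C\<rparr>) x y = cstar_dist (A\<lparr>carrier := C\<rparr>) y x" for x y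
      using dist[of x y] dist[of y x] M.commute[of x y]
      by (cases "x \<in> C \<and> y \<in> C") (auto simp: cstar_dist_def)
  qed (use dist in_A in \<open>auto intro: M.triangle\<close>)
  have "MC.mcomplete"
    unfolding MC.mcomplete_def
  proof safe
    fix f assume f: "MC.MCauchy f"
    then have fC: "f n \<in> C" for n by (auto simp: MC.MCauchy_def)
    have "M.MCauchy f"
      using f fC in_A unfolding M.MCauchy_def MC.MCauchy_def by (auto simp: dist)
    then obtain x where x: "limitin M.mtopology f x sequentially"
      using complete unfolding M.mcomplete_def by blast
    have "x \<in> C"
      using M.metric_closedin_iff_sequentially_closed[of C] cl fC x by blast
    then have "limitin MC.mtopology f x sequentially"
      using x fC \<open>x \<in> C\<close> unfolding M.limitin_metric MC.limitin_metric
      by (auto simp: dist elim!: eventually_mono)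
    then show "\<exists>x. limitin MC.mtopology f x sequentially" by blast
  qed
  then show ?thesis
    by unfold_locales
      (auto simp: in_A scl adj scl_add_right scl_add_left scl_scl scl_one scl_mult_left scl_mult_right
        adj_adj adj_add adj_scl adj_mult nrm_nonneg nrm_eq_0 nrm_scl nrm_triangle nrm_mult cstar_identity)
qed

lemma cstar_idealD:
  assumes "cstar_ideal I A"
  shows "I \<subseteq> carrier A" "\<zero> \<in> I" "\<And>x y. x \<in> I \<Longrightarrow> y \<in> I \<Longrightarrow> x \<oplus> y \<in> I"
    "\<And>x y. x \<in> I \<Longrightarrow> y \<in> I \<Longrightarrow> x \<ominus> y \<in> I"
    "\<And>x y. x \<in> carrier A \<Longrightarrow> y \<in> I \<Longrightarrow> x \<otimes> y \<in> I" "\<And>x y. x \<in> carrier A \<Longrightarrow> y \<in> I \<Longrightarrow> y \<otimes> x \<in> I"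
    "\<And>c x. x \<in> I \<Longrightarrow> scl A c x \<in> I"
    "\<And>x. x \<in> carrier A \<Longrightarrow> (\<And>e. e > 0 \<Longrightarrow> \<exists>y\<in>I. nrm A (x \<ominus> y) < e) \<Longrightarrow> x \<in> I"
proof -
  from assms have id: "ideal I A" and cl: "closedin (cstar_topology A) I" by (auto simp: cstar_ideal_def)
  interpret ideal I A by (rule id)
  show sub: "I \<subseteq> carrier A" by (rule a_subset)
  show "\<zero> \<in> I" by simp
  show "x \<oplus> y \<in> I" if "x \<in> I" "y \<in> I" for x y using that by simp
  show "x \<ominus> y \<in> I" if "x \<in> I" "y \<in> I" for x y using that by (simp add: a_minus_def)
  show mult: "x \<otimes> y \<in> I" "y \<otimes> x \<in> I" if "x \<in> carrier A" "y \<in> I" for x y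
    using that by (auto intro: I_l_closed I_r_closed)
  \<comment> \<open>Ring ideals of a unital algebra are complex subspaces: scaling by
    \<open>c\<close> is multiplication by \<open>scl A c \<one>\<close>.\<close>
  show "scl A c x \<in> I" if "x \<in> I" for c x
    using mult(1)[of "scl A c \<one>" x] that sub scl_as_mult[of x c] by (auto simp: scl_closed)
  show "x \<in> I" if "x \<in> carrier A" "\<And>e. e > 0 \<Longrightarrow> \<exists>y\<in>I. nrm A (x \<ominus> y) < e" for x
    using that cl closedin_iff[OF sub] by blast
qed

lemma cstar_idealI:
  assumes "csubspace I" "\<And>x y. x \<in> carrier A \<Longrightarrow> y \<in> I \<Longrightarrow> x \<otimes> y \<in> I"
    "\<And>x y. x \<in> carrier A \<Longrightarrow> y \<in> I \<Longrightarrow> y \<otimes> x \<in> I"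
    "\<And>x. x \<in> carrier A \<Longrightarrow> (\<And>e. e > 0 \<Longrightarrow> \<exists>y\<in>I. nrm A (x \<ominus> y) < e) \<Longrightarrow> x \<in> I"
  shows "cstar_ideal I A"
  unfolding cstar_ideal_def
proof
  show "ideal I A" using assms(1-3) ring_axioms by (intro idealI) (auto simp: csubspace_def)
  show "closedin (cstar_topology A) I" using closedin_iff csubspaceD(1)[OF assms(1)] assms(4) by blast
qed

text \<open>Iterating \<open>h - z\<close> gives elements of the ideal tending to \<open>h\<close>.\<close>

lemma idempotent_in_ideal:
  assumes I: "cstar_ideal I A" and h: "h \<in> carrier A" "h \<otimes> h = h"
    and y: "y \<in> I" and small: "nrm A (h \<ominus> h \<otimes> y \<otimes> h) < 1"
  shows "h \<in> I"
proof -
  note ID = cstar_idealD[OF I]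
  define z where "z = h \<otimes> y \<otimes> h"
  define q where "q = nrm A (h \<ominus> z)"
  have zI: "z \<in> I" using y h ID by (simp add: z_def)
  have z: "z \<in> carrier A" using zI ID by blast
  have yc: "y \<in> carrier A" using y ID by blast
  have hz: "h \<otimes> z = z" unfolding z_def using h yc by (simp flip: m_assoc)
  have zh: "z \<otimes> h = z" unfolding z_def using h yc by (simp add: m_assoc)
  have q: "0 \<le> q" "q < 1" using small h z by (auto simp: q_def z_def nrm_nonneg)
  \<comment> \<open>Replacing \<open>v\<close> by \<open>v + z - z v\<close> multiplies
    \<open>h - v\<close> by \<open>h - z\<close>, so \<open>h - v\<close> runs through the powers of
    \<open>h - z\<close> while \<open>v\<close> stays in the ideal.\<close>
  have *: "\<exists>v\<in>I. h \<otimes> v = v \<and> nrm A (h \<ominus> v) \<le> q ^ Suc n" for n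
  proof (induction n)
    case 0 then show ?case using zI hz by (auto simp: q_def)
  next
    case (Suc n)
    then obtain v where v: "v \<in> I" "h \<otimes> v = v" "nrm A (h \<ominus> v) \<le> q ^ Suc n" by blast
    have vc: "v \<in> carrier A" using v ID by blast
    have "(h \<ominus> z) \<otimes> (h \<ominus> v) = h \<ominus> ((v \<oplus> z) \<ominus> z \<otimes> v)"
      using h z zh v vc by (simp add: a_minus_def l_distr r_distr l_minus r_minus minus_add a_ac)
    moreover have "nrm A ((h \<ominus> z) \<otimes> (h \<ominus> v)) \<le> q * q ^ Suc n"
      using h z vc v q by (intro order.trans[OF nrm_mult] mult_mono) (auto simp: q_def nrm_nonneg)
    moreover have "h \<otimes> ((v \<oplus> z) \<ominus> z \<otimes> v) = (v \<oplus> z) \<ominus> z \<otimes> v"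
      using h z hz v vc by (simp add: a_minus_def r_distr r_minus flip: m_assoc)
    moreover have "(v \<oplus> z) \<ominus> z \<otimes> v \<in> I" using v zI z ID by simp
    ultimately show ?case by (intro bexI[of _ "(v \<oplus> z) \<ominus> z \<otimes> v"]) auto
  qed
  show ?thesis
  proof (rule ID(8)[OF h(1)])
    fix e :: real assume "e > 0"
    then obtain n where "q ^ n < e" using q real_arch_pow_inv by blast
    then have "q ^ Suc n < e" using q mult_left_le_one_le[of "q ^ n" q] by simp
    with *[of n] show "\<exists>y\<in>I. nrm A (h \<ominus> y) < e" by force
  qed
qed

text \<open>The triangle inequality alone gives the bound \<open>2 * M\<close>. Powers of
  \<open>y\<close> split along \<open>p\<close> in the same way, and for self-adjoint
  \<open>y\<close> the norm of the power with exponent \<open>2 ^ n\<close> is exactly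
  \<open>nrm A y ^ (2 ^ n)\<close>. So the factor 2 is removed by taking roots.\<close>

lemma nrm_le_max_split_self_adjoint:
  assumes y: "y \<in> carrier A" "adj A y = y"
    and p: "p \<in> carrier A" "p \<otimes> p = p" "p \<otimes> y = y \<otimes> p"
    and M: "nrm A (y \<otimes> p) \<le> M" "nrm A (y \<otimes> (\<one> \<ominus> p)) \<le> M"
  shows "nrm A y \<le> M"
proof -
  define s where "s = rec_nat y (\<lambda>_ v. v \<otimes> v)"
  have s0: "s 0 = y" and sS: "s (Suc n) = s n \<otimes> s n" for n by (simp_all add: s_def)
  have sc: "s n \<in> carrier A" for n by (induction n) (auto simp: s0 sS y)
  have sa: "adj A (s n) = s n" for n by (induction n) (auto simp: s0 sS y adj_mult sc)
  have sn: "nrm A (s n) = nrm A y ^ (2 ^ n)" for n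
  proof (induction n)
    case (Suc n)
    have "nrm A (s (Suc n)) = (nrm A (s n))\<^sup>2"
      using cstar_identity[of "s n"] by (simp add: sS sa sc)
    then show ?case by (simp add: Suc mult.commute flip: power_mult)
  qed (simp add: s0)
  have comp: "nrm A (s n \<otimes> e) \<le> M ^ (2 ^ n)"
    if e: "e \<in> carrier A" "e \<otimes> e = e" "e \<otimes> y = y \<otimes> e" "nrm A (y \<otimes> e) \<le> M" for e n
  proof -
    have se: "e \<otimes> s n = s n \<otimes> e" for n
      by (induction n) (use e y sc in \<open>auto simp: s0 sS\<close>, metis m_assoc)
    show ?thesis
    proof (induction n)
      case (Suc n)
      have "s (Suc n) \<otimes> e = (s n \<otimes> e) \<otimes> (s n \<otimes> e)"
        using e sc se by (metis (no_types, lifting) m_assoc m_closed sS)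
      then have "nrm A (s (Suc n) \<otimes> e) \<le> (nrm A (s n \<otimes> e))\<^sup>2"
        using nrm_mult[of "s n \<otimes> e" "s n \<otimes> e"] sc e by (simp add: power2_eq_square)
      also have "\<dots> \<le> (M ^ 2 ^ n)\<^sup>2" using Suc sc e by (intro power_mono) (auto simp: nrm_nonneg)
      finally show ?case by (simp add: mult.commute flip: power_mult)
    qed (use e in \<open>simp add: s0\<close>)
  qed
  have "nrm A y ^ (2 ^ n) \<le> 2 * M ^ (2 ^ n)" for n
  proof -
    have "s n = s n \<otimes> p \<oplus> s n \<otimes> (\<one> \<ominus> p)"
      using sc p by (simp add: a_minus_def r_distr r_minus a_ac r_neg r_neg1 r_neg2)
    then have "nrm A (s n) \<le> nrm A (s n \<otimes> p) + nrm A (s n \<otimes> (\<one> \<ominus> p))"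
      using nrm_triangle[of "s n \<otimes> p" "s n \<otimes> (\<one> \<ominus> p)"] sc p by simp
    also have "\<dots> \<le> M ^ (2 ^ n) + M ^ (2 ^ n)"
    proof (intro add_mono comp)
      show "(\<one> \<ominus> p) \<otimes> (\<one> \<ominus> p) = \<one> \<ominus> p"
        using p by (simp add: a_minus_def l_distr r_distr l_minus r_minus r_neg)
      show "(\<one> \<ominus> p) \<otimes> y = y \<otimes> (\<one> \<ominus> p)"
        using p y by (simp add: a_minus_def l_distr r_distr l_minus r_minus)
    qed (use p y M in auto)
    finally show ?thesis by (simp add: sn)
  qed
  moreover have "0 \<le> M" using M(1) nrm_nonneg[of "y \<otimes> p"] y p by simp
  ultimately show ?thesis using le_of_power_bound by blast
qed

text \<open>Reduction to the self-adjoint element \<open>adj A x \<otimes> x\<close>: its norm is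
  the square of that of \<open>x\<close>, and its piece under \<open>e = p\<close> or
  \<open>e = \<one> \<ominus> p\<close> is
  \<open>adj A (x \<otimes> e) \<otimes> (x \<otimes> e)\<close>.\<close>

lemma nrm_le_max_split:
  assumes x: "x \<in> carrier A"
    and p: "p \<in> carrier A" "p \<otimes> p = p" "adj A p = p" "p \<otimes> x = x \<otimes> p"
  shows "nrm A x \<le> max (nrm A (x \<otimes> p)) (nrm A (x \<otimes> (\<one> \<ominus> p)))" (is "_ \<le> ?M")
proof -
  let ?y = "adj A x \<otimes> x"
  have px: "p \<otimes> adj A x = adj A x \<otimes> p"
    using arg_cong[OF p(4), of "adj A"] p(1,3) x by (simp only: adj_mult)
  have M0: "?M \<ge> 0" using nrm_nonneg[of "x \<otimes> p"] x p(1) by (auto simp: le_max_iff_disj)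
  have comp: "nrm A (?y \<otimes> e) \<le> ?M\<^sup>2"
    if e: "e \<in> carrier A" "e \<otimes> e = e" "adj A e = e" "e \<otimes> x = x \<otimes> e" "e \<otimes> adj A x = adj A x \<otimes> e"
      "nrm A (x \<otimes> e) \<le> ?M" for e
  proof -
    have "?y \<otimes> e = adj A (x \<otimes> e) \<otimes> (x \<otimes> e)"
      using e x by (simp add: adj_mult adj_closed) (metis adj_closed m_assoc m_closed)
    then have "nrm A (?y \<otimes> e) = (nrm A (x \<otimes> e))\<^sup>2" using e x by (simp add: cstar_identity)
    then show ?thesis using e x by (auto intro: power_mono simp: nrm_nonneg)
  qed
  have "nrm A ?y \<le> ?M\<^sup>2"
  proof (rule nrm_le_max_split_self_adjoint[of _ p])
    show "p \<otimes> ?y = ?y \<otimes> p" using p px x by (metis adj_closed m_assoc)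
    show "nrm A (?y \<otimes> (\<one> \<ominus> p)) \<le> ?M\<^sup>2"
    proof (rule comp)
      show "(\<one> \<ominus> p) \<otimes> (\<one> \<ominus> p) = \<one> \<ominus> p"
        using p by (simp add: a_minus_def l_distr r_distr l_minus r_minus r_neg)
      show "(\<one> \<ominus> p) \<otimes> x = x \<otimes> (\<one> \<ominus> p)" "(\<one> \<ominus> p) \<otimes> adj A x = adj A x \<otimes> (\<one> \<ominus> p)"
        using p x px by (simp_all add: a_minus_def l_distr r_distr l_minus r_minus adj_closed)
    qed (use p x in \<open>auto simp: adj_diff\<close>)
    show "nrm A (?y \<otimes> p) \<le> ?M\<^sup>2" using comp[of p] p x px by simp
  qed (use x p in \<open>auto simp: adj_closed adj_mult adj_adj\<close>)
  then show ?thesis using x M0 by (intro power2_le_imp_le[OF _ M0]) (simp add: cstar_identity)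
qed

end

context cstar_hom
begin

lemma kernel_cstar_ideal: "cstar_ideal (a_kernel A B f) A"
proof (rule A.cstar_idealI)
  show "A.csubspace (a_kernel A B f)"
    by (intro A.csubspaceI) (auto simp: a_kernel_def' f_simps f_zero A.scl_closed)
  show "x \<in> a_kernel A B f"
    if x: "x \<in> carrier A" and *: "\<And>e. e > 0 \<Longrightarrow> \<exists>y\<in>a_kernel A B f. nrm A (x \<ominus>\<^bsub>A\<^esub> y) < e" for x
  proof -
    have "nrm B (f x) \<le> 0 + e" if "e > 0" for e
    proof -
      obtain y where y: "y \<in> carrier A" "f y = \<zero>\<^bsub>B\<^esub>" "nrm A (x \<ominus>\<^bsub>A\<^esub> y) < e"
        using *[OF \<open>e > 0\<close>] unfolding a_kernel_def' by blast
      have "f (x \<ominus>\<^bsub>A\<^esub> y) = f x \<ominus>\<^bsub>B\<^esub> \<zero>\<^bsub>B\<^esub>" using f_diff[OF x y(1)] by (simp only: y(2))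
      also have "\<dots> = f x" using f_simps(1)[OF x] unfolding a_minus_def by simp
      finally show ?thesis using contractive[of "x \<ominus>\<^bsub>A\<^esub> y"] x y by simp
    qed
    then have "nrm B (f x) \<le> 0" by (rule field_le_epsilon)
    then have "nrm B (f x) = 0" using B.nrm_nonneg[of "f x"] f_simps(1)[OF x] by linarith
    then show ?thesis using x B.nrm_eq_0[of "f x"] f_simps(1)[OF x] by (simp add: a_kernel_def')
  qed
qed (auto simp: a_kernel_def' f_simps)

end


section \<open>Bounded operators on square-summable functions\<close>

lemma ell2_L2_set:
  assumes "f \<in> ell2 X" "finite F" "F \<subseteq> X"
  shows "L2_set (\<lambda>x. cmod (f x)) F \<le> ell2_norm X f"
proof -
  have "(\<Sum>x\<in>F. (cmod (f x))\<^sup>2) \<le> (\<Sum>\<^sub>\<infinity>x\<in>X. (cmod (f x))\<^sup>2)"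
    using assms by (intro finite_sum_le_infsum) (auto simp: ell2_def)
  then show ?thesis by (simp add: L2_set_def ell2_norm_def)
qed

text \<open>Finite sections decide both membership and norm, so the inequalities known for
  \<open>L2_set\<close> carry over to square-summable functions.\<close>

lemma ell2_L2I:
  assumes supp: "\<And>x. x \<notin> X \<Longrightarrow> f x = 0"
    and L2: "\<And>F. finite F \<Longrightarrow> F \<subseteq> X \<Longrightarrow> L2_set (\<lambda>x. cmod (f x)) F \<le> c"
  shows "f \<in> ell2 X" "ell2_norm X f \<le> c"
proof -
  have c: "0 \<le> c" using L2[of "{}"] by simp
  have le: "(\<Sum>x\<in>F. (cmod (f x))\<^sup>2) \<le> c\<^sup>2" if "finite F" "F \<subseteq> X" for F
    using L2[OF that] c unfolding L2_set_def by (simp add: real_sqrt_le_iff' sqrt_le_D)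
  have summ: "(\<lambda>x. (cmod (f x))\<^sup>2) summable_on X"
    using le by (intro nonneg_bdd_above_summable_on) (auto simp: bdd_above_def)
  then show "f \<in> ell2 X" using supp by (simp add: ell2_def)
  have "(\<Sum>\<^sub>\<infinity>x\<in>X. (cmod (f x))\<^sup>2) \<le> c\<^sup>2"
    using summ le by (intro infsum_le_finite_sums) auto
  then show "ell2_norm X f \<le> c" using c by (simp add: ell2_norm_def real_le_lsqrt real_sqrt_le_iff')
qed

lemma ell2_norm_nonneg [simp]: "0 \<le> ell2_norm X f"
  by (simp add: ell2_norm_def infsum_nonneg)

lemma ell2_off: "f \<in> ell2 X \<Longrightarrow> x \<notin> X \<Longrightarrow> f x = 0"
  by (simp add: ell2_def)

lemma ell2_norm_sq: "(ell2_norm X f)\<^sup>2 = (\<Sum>\<^sub>\<infinity>x\<in>X. (cmod (f x))\<^sup>2)"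
  by (simp add: ell2_norm_def infsum_nonneg)

lemma ell2_component: "f \<in> ell2 X \<Longrightarrow> cmod (f x) \<le> ell2_norm X f"
  using ell2_L2_set[of f X "{x}"] ell2_off[of f X x] by (cases "x \<in> X") auto

lemma ell2_zero [simp]: "(\<lambda>x. 0) \<in> ell2 X" "ell2_norm X (\<lambda>x. 0) = 0"
  by (auto simp: ell2_def ell2_norm_def)

lemma ell2_norm_zeroD: "f \<in> ell2 X \<Longrightarrow> ell2_norm X f = 0 \<Longrightarrow> f = (\<lambda>x. 0)"
  using ell2_component[of f X] by (auto intro!: ext)

lemma ell2_add:
  assumes "f \<in> ell2 X" "g \<in> ell2 X"
  shows "(\<lambda>x. f x + g x) \<in> ell2 X" "ell2_norm X (\<lambda>x. f x + g x) \<le> ell2_norm X f + ell2_norm X g"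
proof -
  have *: "L2_set (\<lambda>x. cmod (f x + g x)) F \<le> ell2_norm X f + ell2_norm X g" if "finite F" "F \<subseteq> X" for F
  proof -
    have "L2_set (\<lambda>x. cmod (f x + g x)) F \<le> L2_set (\<lambda>x. cmod (f x) + cmod (g x)) F"
      by (intro L2_set_mono norm_triangle_ineq) auto
    also have "\<dots> \<le> L2_set (\<lambda>x. cmod (f x)) F + L2_set (\<lambda>x. cmod (g x)) F" by (rule L2_set_triangle_ineq)
    also have "\<dots> \<le> ell2_norm X f + ell2_norm X g" using assms that by (intro add_mono ell2_L2_set)
    finally show ?thesis .
  qed
  show "(\<lambda>x. f x + g x) \<in> ell2 X" "ell2_norm X (\<lambda>x. f x + g x) \<le> ell2_norm X f + ell2_norm X g"
    using * assms by (auto intro!: ell2_L2I(1)[where c = "ell2_norm X f + ell2_norm X g"] ell2_L2I(2) simp: ell2_off)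
qed

lemma ell2_scale:
  assumes "f \<in> ell2 X"
  shows "(\<lambda>x. c * f x) \<in> ell2 X" "ell2_norm X (\<lambda>x. c * f x) = cmod c * ell2_norm X f"
proof -
  show "(\<lambda>x. c * f x) \<in> ell2 X"
    using assms by (auto simp: ell2_def norm_mult power_mult_distrib intro: summable_on_cmult_right)
  show "ell2_norm X (\<lambda>x. c * f x) = cmod c * ell2_norm X f"
    by (simp add: ell2_norm_def norm_mult power_mult_distrib infsum_cmult_right' real_sqrt_mult)
qed

lemma ell2_diff:
  assumes "f \<in> ell2 X" "g \<in> ell2 X"
  shows "(\<lambda>x. f x - g x) \<in> ell2 X" 
  using ell2_add(1)[OF assms(1) ell2_scale(1)[OF assms(2), of "-1"]] by simp

lemma ell2_inner_abs_summable:
  assumes "f \<in> ell2 X" "g \<in> ell2 X"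
  shows "(\<lambda>x. norm (f x * cnj (g x))) summable_on X"
    and "(\<Sum>\<^sub>\<infinity>x\<in>X. norm (f x * cnj (g x))) \<le> ell2_norm X f * ell2_norm X g"
proof -
  have le: "(\<Sum>x\<in>F. norm (f x * cnj (g x))) \<le> ell2_norm X f * ell2_norm X g" if "finite F" "F \<subseteq> X" for F
  proof -
    have "(\<Sum>x\<in>F. norm (f x * cnj (g x))) = (\<Sum>x\<in>F. \<bar>cmod (f x)\<bar> * \<bar>cmod (g x)\<bar>)"
      by (simp add: norm_mult)
    also have "\<dots> \<le> L2_set (\<lambda>x. cmod (f x)) F * L2_set (\<lambda>x. cmod (g x)) F" by (rule L2_set_mult_ineq)
    also have "\<dots> \<le> ell2_norm X f * ell2_norm X g"
      using assms that by (intro mult_mono ell2_L2_set) auto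
    finally show ?thesis .
  qed
  show summ: "(\<lambda>x. norm (f x * cnj (g x))) summable_on X"
    using le by (intro nonneg_bdd_above_summable_on) (auto simp: bdd_above_def)
  show "(\<Sum>\<^sub>\<infinity>x\<in>X. norm (f x * cnj (g x))) \<le> ell2_norm X f * ell2_norm X g"
    using summ le by (intro infsum_le_finite_sums) auto
qed

lemma ell2_inner_summable:
  "f \<in> ell2 X \<Longrightarrow> g \<in> ell2 X \<Longrightarrow> (\<lambda>x. f x * cnj (g x)) summable_on X"
  by (rule abs_summable_summable[OF ell2_inner_abs_summable(1)])

lemma ell2_cauchy_schwarz:
  "f \<in> ell2 X \<Longrightarrow> g \<in> ell2 X \<Longrightarrow> cmod (ell2_inner X f g) \<le> ell2_norm X f * ell2_norm X g"
  unfolding ell2_inner_def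
  using norm_infsum_bound[of "\<lambda>x. f x * cnj (g x)" X] ell2_inner_abs_summable[of f X g] by linarith

lemma ell2_inner_add_left:
  "f \<in> ell2 X \<Longrightarrow> g \<in> ell2 X \<Longrightarrow> h \<in> ell2 X \<Longrightarrow>
    ell2_inner X (\<lambda>x. f x + g x) h = ell2_inner X f h + ell2_inner X g h"
  unfolding ell2_inner_def by (simp add: distrib_right infsum_add ell2_inner_summable)

lemma ell2_inner_scale_left: "ell2_inner X (\<lambda>x. c * f x) h = c * ell2_inner X f h"
  unfolding ell2_inner_def by (simp add: infsum_cmult_right' mult.assoc)

lemma cnj_ell2_inner: "cnj (ell2_inner X f g) = ell2_inner X g f"
  unfolding ell2_inner_def infsum_cnj[symmetric] by (simp add: mult.commute del: infsum_cnj)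

lemma ell2_inner_add_right:
  "f \<in> ell2 X \<Longrightarrow> g \<in> ell2 X \<Longrightarrow> h \<in> ell2 X \<Longrightarrow>
    ell2_inner X h (\<lambda>x. f x + g x) = ell2_inner X h f + ell2_inner X h g"
  using ell2_inner_add_left[of f X g h] by (metis cnj_ell2_inner complex_cnj_add)

lemma ell2_inner_scale_right: "ell2_inner X h (\<lambda>x. c * f x) = cnj c * ell2_inner X h f"
  by (metis cnj_ell2_inner complex_cnj_mult ell2_inner_scale_left)

lemma ell2_inner_self:
  assumes "f \<in> ell2 X"
  shows "ell2_inner X f f = complex_of_real ((ell2_norm X f)\<^sup>2)"
proof -
  have "((\<lambda>x. (cmod (f x))\<^sup>2) has_sum (ell2_norm X f)\<^sup>2) X"
    using assms unfolding ell2_norm_sq by (auto simp: ell2_def)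
  then have "((\<lambda>x. complex_of_real ((cmod (f x))\<^sup>2)) has_sum complex_of_real ((ell2_norm X f)\<^sup>2)) X"
    by (simp only: has_sum_of_real_iff)
  then show ?thesis unfolding ell2_inner_def complex_norm_square by (rule infsumI)
qed

definition ell2_delta :: "'g \<Rightarrow> 'g \<Rightarrow> complex" where
  "ell2_delta y = (\<lambda>x. if x = y then 1 else 0)"

lemma ell2_restrict:
  assumes "f \<in> ell2 X" shows "(\<lambda>x. if x \<in> F then f x else 0) \<in> ell2 X"
proof (rule ell2_L2I(1))
  show "L2_set (\<lambda>x. cmod (if x \<in> F then f x else 0)) F' \<le> ell2_norm X f" if "finite F'" "F' \<subseteq> X" for F'
    by (rule order.trans[OF L2_set_mono ell2_L2_set[OF assms that]]) auto
qed (use ell2_off[OF assms] in auto)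

lemma ell2_finite_support:
  assumes "finite F" "\<And>x. x \<notin> F \<Longrightarrow> f x = 0" "F \<subseteq> X"
  shows "f \<in> ell2 X" "(ell2_norm X f)\<^sup>2 = (\<Sum>x\<in>F. (cmod (f x))\<^sup>2)"
proof -
  have "(\<lambda>x. (cmod (f x))\<^sup>2) summable_on X \<longleftrightarrow> (\<lambda>x. (cmod (f x))\<^sup>2) summable_on F"
    using assms by (intro summable_on_cong_neutral) auto
  then show "f \<in> ell2 X" using assms by (auto simp: ell2_def)
  have "infsum (\<lambda>x. (cmod (f x))\<^sup>2) X = infsum (\<lambda>x. (cmod (f x))\<^sup>2) F"
    using assms by (intro infsum_cong_neutral) auto
  then show "(ell2_norm X f)\<^sup>2 = (\<Sum>x\<in>F. (cmod (f x))\<^sup>2)" using assms by (simp add: ell2_norm_sq)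
qed

lemma ell2_delta [simp]: "y \<in> X \<Longrightarrow> ell2_delta y \<in> ell2 X" "y \<in> X \<Longrightarrow> ell2_norm X (ell2_delta y) = 1"
proof -
  assume "y \<in> X"
  then show "ell2_delta y \<in> ell2 X" by (intro ell2_finite_support(1)[of "{y}"]) (auto simp: ell2_delta_def)
  have "(ell2_norm X (ell2_delta y))\<^sup>2 = 1"
    using ell2_finite_support(2)[of "{y}" "ell2_delta y" X] \<open>y \<in> X\<close> by (simp add: ell2_delta_def)
  then show "ell2_norm X (ell2_delta y) = 1"
    using ell2_norm_nonneg[of X "ell2_delta y"] by (metis abs_of_nonneg power2_eq_1_iff abs_1 abs_minus_cancel)
qed

lemma ell2_inner_delta: "y \<in> X \<Longrightarrow> ell2_inner X f (ell2_delta y) = f y"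
proof -
  assume "y \<in> X"
  then have "infsum (\<lambda>x. f x * cnj (ell2_delta y x)) X = infsum (\<lambda>x. f x * cnj (ell2_delta y x)) {y}"
    by (intro infsum_cong_neutral) (auto simp: ell2_delta_def)
  then show ?thesis by (simp add: ell2_inner_def ell2_delta_def)
qed

lemma ell2_tail:
  assumes "f \<in> ell2 X" "finite F" "F \<subseteq> X"
  shows "(ell2_norm X (\<lambda>x. if x \<in> F then 0 else f x))\<^sup>2 = (ell2_norm X f)\<^sup>2 - (\<Sum>x\<in>F. (cmod (f x))\<^sup>2)"
proof -
  have "infsum (\<lambda>x. (cmod (if x \<in> F then 0 else f x))\<^sup>2) X = infsum (\<lambda>x. (cmod (f x))\<^sup>2) (X - F)"
    by (intro infsum_cong_neutral) auto
  also have "\<dots> = infsum (\<lambda>x. (cmod (f x))\<^sup>2) X - infsum (\<lambda>x. (cmod (f x))\<^sup>2) F"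
    using assms by (intro infsum_Diff) (auto simp: ell2_def)
  finally show ?thesis using assms by (simp add: ell2_norm_sq)
qed

text \<open>The part of \<open>f\<close> outside a finite set has squared norm equal to the total
  minus the partial sum, which tends to 0. Hence a bounded functional is summed up from its values
  at the basis vectors. The second claim is the exact version for truncations.\<close>

lemma ell2_functional_has_sum:
  assumes add: "\<And>f g. f \<in> ell2 X \<Longrightarrow> g \<in> ell2 X \<Longrightarrow> \<phi> (\<lambda>x. f x + g x) = \<phi> f + \<phi> g"
    and scale: "\<And>c f. f \<in> ell2 X \<Longrightarrow> \<phi> (\<lambda>x. c * f x) = c * \<phi> f"
    and bound: "\<And>f. f \<in> ell2 X \<Longrightarrow> cmod (\<phi> f) \<le> C * ell2_norm X f"
    and f: "f \<in> ell2 X"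
  shows "((\<lambda>y. f y * \<phi> (ell2_delta y)) has_sum \<phi> f) X"
    and "finite F \<Longrightarrow> F \<subseteq> X \<Longrightarrow> \<phi> (\<lambda>x. if x \<in> F then f x else 0) = (\<Sum>y\<in>F. f y * \<phi> (ell2_delta y))"
proof -
  have fin: "\<phi> (\<lambda>x. if x \<in> F then f x else 0) = (\<Sum>y\<in>F. f y * \<phi> (ell2_delta y))"
    if "finite F" "F \<subseteq> X" for F
    using that
  proof (induction F)
    case empty
    have "\<phi> (\<lambda>x. 0) = 0" using scale[of "\<lambda>x. 0" 0] by simp
    then show ?case by simp
  next
    case (insert y F)
    have "(\<lambda>x. if x \<in> insert y F then f x else 0)
        = (\<lambda>x. (if x \<in> F then f x else 0) + f y * ell2_delta y x)"
      using insert by (auto simp: ell2_delta_def)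
    then show ?case
      using insert add[OF ell2_restrict[OF f] ell2_scale(1)[of "ell2_delta y" X "f y"], of F] scale[of "ell2_delta y" "f y"]
      by (simp add: add.commute)
  qed
  then show "finite F \<Longrightarrow> F \<subseteq> X \<Longrightarrow> \<phi> (\<lambda>x. if x \<in> F then f x else 0) = (\<Sum>y\<in>F. f y * \<phi> (ell2_delta y))"
    by blast
  have diff: "cmod ((\<Sum>y\<in>F. f y * \<phi> (ell2_delta y)) - \<phi> f)
      \<le> \<bar>C\<bar> * sqrt ((ell2_norm X f)\<^sup>2 - (\<Sum>x\<in>F. (cmod (f x))\<^sup>2))" if F: "finite F" "F \<subseteq> X" for F
  proof -
    let ?g = "\<lambda>x. if x \<in> F then 0 else f x"
    have "?g = (\<lambda>x. if x \<in> - F then f x else 0)" by auto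
    then have g: "?g \<in> ell2 X" using ell2_restrict[OF f, of "- F"] by simp
    have "f = (\<lambda>x. (if x \<in> F then f x else 0) + ?g x)" by auto
    then have "\<phi> f = (\<Sum>y\<in>F. f y * \<phi> (ell2_delta y)) + \<phi> ?g"
      using add[OF ell2_restrict[OF f] g, of F] fin[OF F] by simp
    then have "cmod ((\<Sum>y\<in>F. f y * \<phi> (ell2_delta y)) - \<phi> f) = cmod (\<phi> ?g)" by simp
    also have "\<dots> \<le> C * ell2_norm X ?g" by (rule bound[OF g])
    also have "\<dots> \<le> \<bar>C\<bar> * ell2_norm X ?g" by (intro mult_right_mono) auto
    also have "ell2_norm X ?g = sqrt ((ell2_norm X f)\<^sup>2 - (\<Sum>x\<in>F. (cmod (f x))\<^sup>2))"
      unfolding ell2_tail[OF f F, symmetric] by simp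
    finally show ?thesis .
  qed
  have "((\<lambda>x. (cmod (f x))\<^sup>2) has_sum (ell2_norm X f)\<^sup>2) X"
    using f unfolding ell2_norm_sq by (auto simp: ell2_def)
  then have "(sum (\<lambda>x. (cmod (f x))\<^sup>2) \<longlongrightarrow> (ell2_norm X f)\<^sup>2) (finite_subsets_at_top X)"
    by (simp add: has_sum_def)
  then have "((\<lambda>F. \<bar>C\<bar> * sqrt ((ell2_norm X f)\<^sup>2 - (\<Sum>x\<in>F. (cmod (f x))\<^sup>2)))
      \<longlongrightarrow> \<bar>C\<bar> * sqrt ((ell2_norm X f)\<^sup>2 - (ell2_norm X f)\<^sup>2)) (finite_subsets_at_top X)"
    by (intro tendsto_intros)
  then have lim: "((\<lambda>F. \<bar>C\<bar> * sqrt ((ell2_norm X f)\<^sup>2 - (\<Sum>x\<in>F. (cmod (f x))\<^sup>2))) \<longlongrightarrow> 0) (finite_subsets_at_top X)"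
    by simp
  have "((\<lambda>F. (\<Sum>y\<in>F. f y * \<phi> (ell2_delta y)) - \<phi> f) \<longlongrightarrow> 0) (finite_subsets_at_top X)"
    by (rule Lim_null_comparison[OF _ lim]) (use diff in \<open>auto intro!: eventually_finite_subsets_at_top_weakI\<close>)
  then show "((\<lambda>y. f y * \<phi> (ell2_delta y)) has_sum \<phi> f) X"
    unfolding has_sum_def by (rule LIM_zero_cancel)
qed

section \<open>Bounded operators: norm and ring structure\<close>

lemma bounded_operators_simps [simp]:
  "carrier (bounded_operators X) = bounded_ops X"
  "S \<otimes>\<^bsub>bounded_operators X\<^esub> T = (\<lambda>f. S (T f))"
  "\<one>\<^bsub>bounded_operators X\<^esub> = (\<lambda>f. if f \<in> ell2 X then f else (\<lambda>x. 0))"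
  "\<zero>\<^bsub>bounded_operators X\<^esub> = (\<lambda>f x. 0)"
  "S \<oplus>\<^bsub>bounded_operators X\<^esub> T = (\<lambda>f x. S f x + T f x)"
  "scl (bounded_operators X) c T = (\<lambda>f x. c * T f x)"
  by (simp_all add: bounded_operators_def)

abbreviation opnorm :: "'g set \<Rightarrow> 'g operator \<Rightarrow> real" where
  "opnorm X \<equiv> nrm (bounded_operators X)"

lemma opnorm_def: "opnorm X T = (SUP f\<in>{f \<in> ell2 X. ell2_norm X f \<le> 1}. ell2_norm X (T f))"
  by (simp add: bounded_operators_def)

lemma bounded_opsD:
  assumes "T \<in> bounded_ops X"
  shows "\<And>f. f \<in> ell2 X \<Longrightarrow> T f \<in> ell2 X"
    "\<And>f g. f \<in> ell2 X \<Longrightarrow> g \<in> ell2 X \<Longrightarrow> T (\<lambda>x. f x + g x) = (\<lambda>x. T f x + T g x)"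
    "\<And>c f. f \<in> ell2 X \<Longrightarrow> T (\<lambda>x. c * f x) = (\<lambda>x. c * T f x)"
    "\<And>f. f \<notin> ell2 X \<Longrightarrow> T f = (\<lambda>x. 0)"
    "T (\<lambda>x. 0) = (\<lambda>x. 0)"
proof -
  show scale: "\<And>c f. f \<in> ell2 X \<Longrightarrow> T (\<lambda>x. c * f x) = (\<lambda>x. c * T f x)"
    using assms by (simp add: bounded_ops_def)
  show "T (\<lambda>x. 0) = (\<lambda>x. 0)" using scale[of "\<lambda>x. 0" 0] by simp
qed (use assms in \<open>auto simp: bounded_ops_def\<close>)

lemma bounded_ops_range: "T \<in> bounded_ops X \<Longrightarrow> T f \<in> ell2 X"
  using bounded_opsD(1,4)[of T X f] by (cases "f \<in> ell2 X") auto

lemma bounded_opsI: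
  assumes "\<And>f. f \<in> ell2 X \<Longrightarrow> T f \<in> ell2 X"
    "\<And>f g. f \<in> ell2 X \<Longrightarrow> g \<in> ell2 X \<Longrightarrow> T (\<lambda>x. f x + g x) = (\<lambda>x. T f x + T g x)"
    "\<And>c f. f \<in> ell2 X \<Longrightarrow> T (\<lambda>x. c * f x) = (\<lambda>x. c * T f x)"
    "\<And>f. f \<in> ell2 X \<Longrightarrow> ell2_norm X (T f) \<le> C * ell2_norm X f"
    "\<And>f. f \<notin> ell2 X \<Longrightarrow> T f = (\<lambda>x. 0)"
  shows "T \<in> bounded_ops X"
proof -
  have "\<exists>C. \<forall>f\<in>ell2 X. ell2_norm X (T f) \<le> C * ell2_norm X f" using assms(4) by blast
  then show ?thesis using assms(1-3,5) unfolding bounded_ops_def by auto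
qed

lemma opnorm_bound:
  assumes T: "T \<in> bounded_ops X" and f: "f \<in> ell2 X"
  shows "ell2_norm X (T f) \<le> opnorm X T * ell2_norm X f"
proof (cases "ell2_norm X f = 0")
  case True
  then have "f = (\<lambda>x. 0)" using f ell2_norm_zeroD by blast
  then show ?thesis using bounded_opsD(5)[OF T] by simp
next
  case False
  then have n: "ell2_norm X f > 0" using ell2_norm_nonneg[of X f] by linarith
  obtain C where C: "\<And>f. f \<in> ell2 X \<Longrightarrow> ell2_norm X (T f) \<le> C * ell2_norm X f"
    using T unfolding bounded_ops_def by blast
  let ?g = "\<lambda>x. complex_of_real (1 / ell2_norm X f) * f x"
  have g: "?g \<in> ell2 X" "ell2_norm X ?g = 1"
    using ell2_scale[OF f, of "complex_of_real (1 / ell2_norm X f)"] n by (auto simp: norm_divide)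
  have "bdd_above ((\<lambda>f. ell2_norm X (T f)) ` {f \<in> ell2 X. ell2_norm X f \<le> 1})"
  proof (rule bdd_aboveI2)
    fix h assume h: "h \<in> {f \<in> ell2 X. ell2_norm X f \<le> 1}"
    then have "ell2_norm X (T h) \<le> C * ell2_norm X h" using C by simp
    also have "\<dots> \<le> \<bar>C\<bar> * 1" using h by (intro mult_mono) auto
    finally show "ell2_norm X (T h) \<le> \<bar>C\<bar>" by simp
  qed
  then have "ell2_norm X (T ?g) \<le> opnorm X T"
    unfolding opnorm_def using g by (intro cSUP_upper) auto
  also have "T ?g = (\<lambda>x. complex_of_real (1 / ell2_norm X f) * T f x)"
    using bounded_opsD(3)[OF T f] by blast
  also have "ell2_norm X \<dots> = ell2_norm X (T f) / ell2_norm X f"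
    by (subst ell2_scale(2)[OF bounded_opsD(1)[OF T f]]) (use n in \<open>simp add: norm_divide\<close>)
  finally show ?thesis using n by (simp add: field_simps)
qed

lemma opnorm_le:
  assumes "0 \<le> c" "\<And>f. f \<in> ell2 X \<Longrightarrow> ell2_norm X (T f) \<le> c * ell2_norm X f"
  shows "opnorm X T \<le> c"
  unfolding opnorm_def
proof (rule cSUP_least)
  show "{f \<in> ell2 X. ell2_norm X f \<le> 1} \<noteq> {}" by (auto intro!: exI[of _ "\<lambda>x. 0"])
  fix f assume "f \<in> {f \<in> ell2 X. ell2_norm X f \<le> 1}"
  then show "ell2_norm X (T f) \<le> c"
    using assms(2)[of f] mult_left_mono[of "ell2_norm X f" 1 c] assms(1) by simp
qed

lemma opnorm_nonneg:
  assumes T: "T \<in> bounded_ops X" shows "0 \<le> opnorm X T"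
proof (cases "\<exists>f\<in>ell2 X. ell2_norm X f \<noteq> 0")
  case True
  then obtain f where "f \<in> ell2 X" "ell2_norm X f > 0" using ell2_norm_nonneg by (metis order_le_less)
  then show ?thesis using opnorm_bound[OF T, of f] by (meson ell2_norm_nonneg order_trans zero_le_mult_iff not_le)
next
  case False
  \<comment> \<open>This happens for empty \<open>X\<close>, where the supremum runs over the zero
    function only.\<close>
  then have "{f \<in> ell2 X. ell2_norm X f \<le> 1} = {\<lambda>x. 0}" using ell2_norm_zeroD by auto
  then show ?thesis by (simp add: opnorm_def)
qed

lemma bounded_ops_zero: "(\<lambda>f x. 0) \<in> bounded_ops X"
  by (intro bounded_opsI[where C = 0]) auto

lemma bounded_ops_one: "(\<lambda>f. if f \<in> ell2 X then f else (\<lambda>x. 0)) \<in> bounded_ops X"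
  by (intro bounded_opsI[where C = 1]) (auto simp: ell2_add ell2_scale)

lemma bounded_ops_add:
  assumes "S \<in> bounded_ops X" "T \<in> bounded_ops X"
  shows "(\<lambda>f x. S f x + T f x) \<in> bounded_ops X"
    "opnorm X (\<lambda>f x. S f x + T f x) \<le> opnorm X S + opnorm X T"
proof -
  note S = bounded_opsD[OF assms(1)] and T = bounded_opsD[OF assms(2)]
  have *: "ell2_norm X (\<lambda>x. S f x + T f x) \<le> (opnorm X S + opnorm X T) * ell2_norm X f" if "f \<in> ell2 X" for f
    using ell2_add(2)[of "S f" X "T f"] S T that opnorm_bound[OF assms(1) that] opnorm_bound[OF assms(2) that]
    by (simp add: distrib_right)
  then show "(\<lambda>f x. S f x + T f x) \<in> bounded_ops X"
    using S T by (intro bounded_opsI[OF _ _ _ *]) (auto simp: ell2_add algebra_simps)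
  show "opnorm X (\<lambda>f x. S f x + T f x) \<le> opnorm X S + opnorm X T"
    using * by (intro opnorm_le) (auto simp: opnorm_nonneg assms)
qed

lemma bounded_ops_mult:
  assumes "S \<in> bounded_ops X" "T \<in> bounded_ops X"
  shows "(\<lambda>f. S (T f)) \<in> bounded_ops X" "opnorm X (\<lambda>f. S (T f)) \<le> opnorm X S * opnorm X T"
proof -
  note S = bounded_opsD[OF assms(1)] and T = bounded_opsD[OF assms(2)]
  have *: "ell2_norm X (S (T f)) \<le> (opnorm X S * opnorm X T) * ell2_norm X f" if "f \<in> ell2 X" for f
  proof -
    have "ell2_norm X (S (T f)) \<le> opnorm X S * ell2_norm X (T f)"
      using that T by (intro opnorm_bound assms)
    also have "\<dots> \<le> opnorm X S * (opnorm X T * ell2_norm X f)"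
      using that by (intro mult_left_mono opnorm_bound opnorm_nonneg assms)
    finally show ?thesis by (simp add: mult.assoc)
  qed
  then show "(\<lambda>f. S (T f)) \<in> bounded_ops X"
    using S T by (intro bounded_opsI[OF _ _ _ *]) auto
  show "opnorm X (\<lambda>f. S (T f)) \<le> opnorm X S * opnorm X T"
    using * by (intro opnorm_le) (auto simp: opnorm_nonneg assms)
qed

lemma bounded_ops_scale:
  assumes "T \<in> bounded_ops X"
  shows "(\<lambda>f x. c * T f x) \<in> bounded_ops X" "opnorm X (\<lambda>f x. c * T f x) = cmod c * opnorm X T"
proof -
  note T = bounded_opsD[OF assms(1)]
  have *: "(\<lambda>f x. c * S f x) \<in> bounded_ops X \<and> opnorm X (\<lambda>f x. c * S f x) \<le> cmod c * opnorm X S"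
    if "S \<in> bounded_ops X" for S c
  proof -
    note S = bounded_opsD[OF that]
    have *: "ell2_norm X (\<lambda>x. c * S f x) \<le> (cmod c * opnorm X S) * ell2_norm X f" if f: "f \<in> ell2 X" for f
      using ell2_scale(2)[OF S(1)[OF f], of c] opnorm_bound[OF \<open>S \<in> bounded_ops X\<close> f]
      by (simp add: mult.assoc mult_left_mono)
    then show ?thesis
      using S that by (intro conjI bounded_opsI[OF _ _ _ *] opnorm_le *) (auto simp: ell2_scale algebra_simps opnorm_nonneg)
  qed
  then show 1: "(\<lambda>f x. c * T f x) \<in> bounded_ops X" using assms by blast
  show "opnorm X (\<lambda>f x. c * T f x) = cmod c * opnorm X T"
  proof (cases "c = 0")
    case True
    have "opnorm X (\<lambda>f x. 0) = 0"
      using opnorm_le[of 0 X "\<lambda>f x. 0"] opnorm_nonneg[OF bounded_ops_zero, of X] by simp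
    then show ?thesis using True by simp
  next
    case False
    \<comment> \<open>The reverse inequality is the one already proved, applied to the scaled
      operator and the factor \<open>1 / c\<close>.\<close>
    have "opnorm X T = opnorm X (\<lambda>f x. (1 / c) * (c * T f x))" using False by simp
    also have "\<dots> \<le> cmod (1 / c) * opnorm X (\<lambda>f x. c * T f x)" using *[OF 1, of "1 / c"] by blast
    finally have "cmod c * opnorm X T \<le> opnorm X (\<lambda>f x. c * T f x)"
      using False by (simp add: norm_divide field_simps)
    then show ?thesis using *[OF assms, of c] by simp
  qed
qed

lemma ring_bounded_operators: "ring (bounded_operators X)"
proof (rule ringI)
  have "\<exists>y\<in>bounded_ops X. (\<lambda>f x. y f x + T f x) = (\<lambda>f x. 0)" if "T \<in> bounded_ops X" for T
    using bounded_ops_scale(1)[OF that, of "-1"] by (intro bexI[of _ "\<lambda>f x. - 1 * T f x"]) auto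
  then show "abelian_group (bounded_operators X)"
    by (intro abelian_groupI) (auto simp: bounded_ops_add bounded_ops_zero algebra_simps)
  show "Group.monoid (bounded_operators X)"
    by (intro monoidI) (auto simp: bounded_ops_mult bounded_ops_one bounded_opsD bounded_ops_range intro!: ext)
qed (auto simp: bounded_opsD bounded_ops_range intro!: ext)

lemma minus_bounded_operators:
  assumes "S \<in> bounded_ops X" "T \<in> bounded_ops X"
  shows "S \<ominus>\<^bsub>bounded_operators X\<^esub> T = (\<lambda>f x. S f x - T f x)"
proof -
  interpret ring "bounded_operators X" by (rule ring_bounded_operators)
  have "\<ominus>\<^bsub>bounded_operators X\<^esub> T = (\<lambda>f x. - 1 * T f x)"
    using assms bounded_ops_scale(1)[OF assms(2), of "-1"] by (intro minus_equality) auto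
  then show ?thesis by (simp add: a_minus_def)
qed


section \<open>Adjoints and the C*-identity\<close>

lemma ell2_inner_right_unique:
  assumes "g \<in> ell2 X" "h \<in> ell2 X" "\<And>f. f \<in> ell2 X \<Longrightarrow> ell2_inner X f g = ell2_inner X f h"
  shows "g = h"
proof
  fix y
  show "g y = h y"
  proof (cases "y \<in> X")
    case True
    have "ell2_inner X g (ell2_delta y) = ell2_inner X h (ell2_delta y)"
      using assms(3)[of "ell2_delta y"] True by (metis cnj_ell2_inner ell2_delta(1))
    then show ?thesis using ell2_inner_delta[OF True] by simp
  qed (simp add: ell2_off[OF assms(1)] ell2_off[OF assms(2)])
qed

text \<open>The coordinates of \<open>S g\<close> are forced: testing against basis vectors gives
  \<open>ell2_inner X g (T (ell2_delta y))\<close>. What has to be proved is that they are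
  square-summable with norm at most \<open>opnorm X T * ell2_norm X g\<close>.\<close>

lemma adjoint_exists:
  assumes T: "T \<in> bounded_ops X"
  shows "\<exists>S\<in>bounded_ops X. \<forall>f\<in>ell2 X. \<forall>g\<in>ell2 X. ell2_inner X (T f) g = ell2_inner X f (S g)"
proof -
  note TD = bounded_opsD[OF T]
  define S where "S = (\<lambda>g. if g \<in> ell2 X
    then (\<lambda>y. if y \<in> X then ell2_inner X g (T (ell2_delta y)) else 0) else (\<lambda>x. 0))"
  have Sg: "S g y = ell2_inner X g (T (ell2_delta y))" if "g \<in> ell2 X" "y \<in> X" for g y
    using that by (simp add: S_def)
  have Soff: "S g y = 0" if "y \<notin> X" for g y using that by (simp add: S_def)
  have func: "((\<lambda>y. f y * ell2_inner X (T (ell2_delta y)) g) has_sum ell2_inner X (T f) g) X"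
      "finite F \<Longrightarrow> F \<subseteq> X \<Longrightarrow> ell2_inner X (T (\<lambda>x. if x \<in> F then f x else 0)) g
        = (\<Sum>y\<in>F. f y * ell2_inner X (T (ell2_delta y)) g)"
    if f: "f \<in> ell2 X" and g: "g \<in> ell2 X" for f g F
  proof -
    have bd: "cmod (ell2_inner X (T h) g) \<le> (opnorm X T * ell2_norm X g) * ell2_norm X h" if h: "h \<in> ell2 X" for h
    proof -
      have "cmod (ell2_inner X (T h) g) \<le> ell2_norm X (T h) * ell2_norm X g"
        using h g TD by (intro ell2_cauchy_schwarz)
      also have "\<dots> \<le> (opnorm X T * ell2_norm X h) * ell2_norm X g"
        by (intro mult_right_mono opnorm_bound T h) auto
      finally show ?thesis by (simp add: mult_ac)
    qed
    show "((\<lambda>y. f y * ell2_inner X (T (ell2_delta y)) g) has_sum ell2_inner X (T f) g) X"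
      using ell2_functional_has_sum(1)[of X "\<lambda>h. ell2_inner X (T h) g", OF _ _ bd f] TD g
      by (simp add: ell2_inner_add_left ell2_inner_scale_left)
    show "finite F \<Longrightarrow> F \<subseteq> X \<Longrightarrow> ell2_inner X (T (\<lambda>x. if x \<in> F then f x else 0)) g
        = (\<Sum>y\<in>F. f y * ell2_inner X (T (ell2_delta y)) g)"
      using ell2_functional_has_sum(2)[of X "\<lambda>h. ell2_inner X (T h) g", OF _ _ bd f] TD g
      by (simp add: ell2_inner_add_left ell2_inner_scale_left)
  qed
  have L2: "L2_set (\<lambda>x. cmod (S g x)) F \<le> opnorm X T * ell2_norm X g"
    if g: "g \<in> ell2 X" and F: "finite F" "F \<subseteq> X" for g F
  proof -
    \<comment> \<open>Testing \<open>T\<close> on the truncation of \<open>S g\<close> to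
      \<open>F\<close> gives \<open>s \<le> opnorm X T * sqrt s * ell2_norm X g\<close>, and one
      factor \<open>sqrt s\<close> cancels.\<close>
    define s where "s = (\<Sum>y\<in>F. (cmod (S g y))\<^sup>2)"
    have s0: "0 \<le> s" by (simp add: s_def sum_nonneg)
    let ?f = "\<lambda>x. if x \<in> F then S g x else 0"
    have f: "?f \<in> ell2 X" "(ell2_norm X ?f)\<^sup>2 = s"
      using ell2_finite_support[of F ?f X] F by (auto simp: s_def)
    have nf: "ell2_norm X ?f = sqrt s" using f(2) by (metis ell2_norm_nonneg real_sqrt_unique)
    have "ell2_inner X (T ?f) g = (\<Sum>y\<in>F. ?f y * ell2_inner X (T (ell2_delta y)) g)"
      using func(2)[OF f(1) g F] by (simp cong: if_cong)
    also have "\<dots> = (\<Sum>y\<in>F. S g y * cnj (S g y))"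
      using F g by (intro sum.cong) (auto simp: Sg cnj_ell2_inner)
    also have "\<dots> = complex_of_real s" by (simp only: s_def complex_norm_square[symmetric] of_real_sum)
    finally have "s = cmod (ell2_inner X (T ?f) g)" using s0 by simp
    also have "\<dots> \<le> ell2_norm X (T ?f) * ell2_norm X g" using f g TD by (intro ell2_cauchy_schwarz)
    also have "\<dots> \<le> (opnorm X T * sqrt s) * ell2_norm X g"
      unfolding nf[symmetric] by (intro mult_right_mono opnorm_bound T f) auto
    finally have *: "sqrt s * sqrt s \<le> sqrt s * (opnorm X T * ell2_norm X g)"
      using s0 by (simp add: mult_ac)
    have "sqrt s \<le> opnorm X T * ell2_norm X g"
    proof (cases "s = 0")
      case False
      then show ?thesis using * s0 by (intro mult_left_le_imp_le[OF *]) simp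
    qed (use opnorm_nonneg[OF T] in simp)
    then show ?thesis by (simp add: L2_set_def s_def)
  qed
  have S1: "S g \<in> ell2 X" "ell2_norm X (S g) \<le> opnorm X T * ell2_norm X g" if "g \<in> ell2 X" for g
    using L2[OF that] Soff by (auto intro!: ell2_L2I(1)[where c = "opnorm X T * ell2_norm X g"] ell2_L2I(2))
  have "S \<in> bounded_ops X"
    using S1(1) TD by (intro bounded_opsI[OF _ _ _ S1(2)])
      (auto intro!: ext simp: S_def ell2_add ell2_scale ell2_inner_add_left ell2_inner_scale_left)
  moreover have "ell2_inner X (T f) g = ell2_inner X f (S g)" if "f \<in> ell2 X" "g \<in> ell2 X" for f g
  proof -
    have "ell2_inner X f (S g) = infsum (\<lambda>y. f y * ell2_inner X (T (ell2_delta y)) g) X"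
      unfolding ell2_inner_def[of X f] using that by (intro infsum_cong) (simp add: Sg cnj_ell2_inner)
    then show ?thesis using infsumI[OF func(1)[OF that]] by simp
  qed
  ultimately show ?thesis by blast
qed

abbreviation adjoint :: "'g set \<Rightarrow> 'g operator \<Rightarrow> 'g operator" where
  "adjoint X \<equiv> adj (bounded_operators X)"

lemma adjoint_eqI:
  assumes "S \<in> bounded_ops X"
    "\<And>f g. f \<in> ell2 X \<Longrightarrow> g \<in> ell2 X \<Longrightarrow> ell2_inner X (T f) g = ell2_inner X f (S g)"
  shows "adjoint X T = S"
proof -
  have "(THE S. S \<in> bounded_ops X \<and>
      (\<forall>f\<in>ell2 X. \<forall>g\<in>ell2 X. ell2_inner X (T f) g = ell2_inner X f (S g))) = S"
  proof (rule the_equality)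
    fix S' assume S': "S' \<in> bounded_ops X \<and>
      (\<forall>f\<in>ell2 X. \<forall>g\<in>ell2 X. ell2_inner X (T f) g = ell2_inner X f (S' g))"
    show "S' = S"
    proof
      fix g
      show "S' g = S g"
      proof (cases "g \<in> ell2 X")
        case True
        then show ?thesis
          using S' assms by (intro ell2_inner_right_unique[of _ X]) (auto simp: bounded_opsD)
      qed (use S' assms(1) bounded_opsD(4)[of S' X g] bounded_opsD(4)[of S X g] in simp)
    qed
  qed (use assms in auto)
  then show ?thesis by (simp add: bounded_operators_def)
qed

lemma adjoint_props:
  assumes "T \<in> bounded_ops X"
  shows "adjoint X T \<in> bounded_ops X"
    "\<And>f g. f \<in> ell2 X \<Longrightarrow> g \<in> ell2 X \<Longrightarrow> ell2_inner X (T f) g = ell2_inner X f (adjoint X T g)"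
    "\<And>f g. f \<in> ell2 X \<Longrightarrow> g \<in> ell2 X \<Longrightarrow> ell2_inner X (adjoint X T f) g = ell2_inner X f (T g)"
proof -
  obtain S where S: "S \<in> bounded_ops X"
    "\<And>f g. f \<in> ell2 X \<Longrightarrow> g \<in> ell2 X \<Longrightarrow> ell2_inner X (T f) g = ell2_inner X f (S g)"
    using adjoint_exists[OF assms] by blast
  then have eq: "adjoint X T = S" by (intro adjoint_eqI)
  show "adjoint X T \<in> bounded_ops X"
    "\<And>f g. f \<in> ell2 X \<Longrightarrow> g \<in> ell2 X \<Longrightarrow> ell2_inner X (T f) g = ell2_inner X f (adjoint X T g)"
    using S eq by auto
  show "\<And>f g. f \<in> ell2 X \<Longrightarrow> g \<in> ell2 X \<Longrightarrow> ell2_inner X (adjoint X T f) g = ell2_inner X f (T g)"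
    using S(2) eq by (metis cnj_ell2_inner)
qed

text \<open>Since \<open>ell2_inner X (T f) (T f)\<close> equals
  \<open>ell2_inner X (adjoint X T (T f)) f\<close>, the Cauchy-Schwarz inequality bounds the norm
  of \<open>T\<close> by the square root of the norm of the product.\<close>

lemma opnorm_sq_le:
  assumes T: "T \<in> bounded_ops X"
  shows "(opnorm X T)\<^sup>2 \<le> opnorm X (\<lambda>f. adjoint X T (T f))"
proof -
  let ?R = "\<lambda>f. adjoint X T (T f)"
  have R: "?R \<in> bounded_ops X" using bounded_ops_mult(1)[OF adjoint_props(1)[OF T] T] .
  have "ell2_norm X (T f) \<le> sqrt (opnorm X ?R) * ell2_norm X f" if f: "f \<in> ell2 X" for f
  proof -
    have Tf: "T f \<in> ell2 X" using bounded_opsD(1)[OF T f] .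
    have "complex_of_real ((ell2_norm X (T f))\<^sup>2) = ell2_inner X (?R f) f"
      using ell2_inner_self[OF Tf] adjoint_props(3)[OF T Tf f] by simp
    then have "(ell2_norm X (T f))\<^sup>2 = cmod (ell2_inner X (?R f) f)"
      by (metis abs_of_nonneg norm_of_real zero_le_power2)
    also have "\<dots> \<le> ell2_norm X (?R f) * ell2_norm X f"
      using bounded_opsD(1)[OF R f] f by (intro ell2_cauchy_schwarz)
    also have "\<dots> \<le> (opnorm X ?R * ell2_norm X f) * ell2_norm X f"
      by (intro mult_right_mono opnorm_bound R f) auto
    finally have "(ell2_norm X (T f))\<^sup>2 \<le> (sqrt (opnorm X ?R) * ell2_norm X f)\<^sup>2"
      using opnorm_nonneg[OF R] by (simp add: power_mult_distrib power2_eq_square mult_ac)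
    then show ?thesis by (rule power2_le_imp_le) (use opnorm_nonneg[OF R] in simp)
  qed
  then have "opnorm X T \<le> sqrt (opnorm X ?R)"
    using opnorm_nonneg[OF R] by (intro opnorm_le) auto
  then have "(opnorm X T)\<^sup>2 \<le> (sqrt (opnorm X ?R))\<^sup>2"
    using opnorm_nonneg[OF T] by (intro power_mono)
  then show ?thesis using opnorm_nonneg[OF R] by simp
qed

lemma opnorm_adjoint_le:
  assumes T: "T \<in> bounded_ops X"
  shows "opnorm X T \<le> opnorm X (adjoint X T)"
proof -
  have "(opnorm X T)\<^sup>2 \<le> opnorm X (adjoint X T) * opnorm X T"
    using opnorm_sq_le[OF T] bounded_ops_mult(2)[OF adjoint_props(1)[OF T] T] by linarith
  then show ?thesis
    using opnorm_nonneg[OF T] opnorm_nonneg[OF adjoint_props(1)[OF T]]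
    by (cases "opnorm X T = 0") (auto simp: power2_eq_square)
qed

lemma adjoint_adjoint: "T \<in> bounded_ops X \<Longrightarrow> adjoint X (adjoint X T) = T"
  by (intro adjoint_eqI adjoint_props(3))

lemma opnorm_cstar_identity:
  assumes T: "T \<in> bounded_ops X"
  shows "opnorm X (\<lambda>f. adjoint X T (T f)) = (opnorm X T)\<^sup>2"
proof (rule antisym)
  note A = adjoint_props(1)[OF T]
  have "opnorm X (adjoint X T) \<le> opnorm X T"
    using opnorm_adjoint_le[OF A] adjoint_adjoint[OF T] by simp
  then have "opnorm X (adjoint X T) * opnorm X T \<le> opnorm X T * opnorm X T"
    using opnorm_nonneg[OF T] by (intro mult_right_mono)
  then show "opnorm X (\<lambda>f. adjoint X T (T f)) \<le> (opnorm X T)\<^sup>2"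
    using bounded_ops_mult(2)[OF A T] by (simp add: power2_eq_square)
qed (rule opnorm_sq_le[OF T])


section \<open>Completeness in the operator norm\<close>

lemma bounded_ops_diff:
  assumes "S \<in> bounded_ops X" "T \<in> bounded_ops X"
  shows "(\<lambda>f x. S f x - T f x) \<in> bounded_ops X"
  using bounded_ops_add(1)[OF assms(1) bounded_ops_scale(1)[OF assms(2), of "-1"]] by simp

text \<open>The limit is taken coordinatewise. Closeness in norm survives because on finitely many
  coordinates the second index may tend to infinity, and the resulting bound does not depend on the
  coordinates chosen.\<close>

lemma bounded_ops_cauchy_limit:
  fixes \<sigma> :: "nat \<Rightarrow> 'g operator"
  assumes \<sigma>: "\<And>n. \<sigma> n \<in> bounded_ops X"
    and cauchy: "\<And>e. e > 0 \<Longrightarrow> \<exists>N. \<forall>m\<ge>N. \<forall>n\<ge>N. opnorm X (\<lambda>f x. \<sigma> m f x - \<sigma> n f x) < e"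
  shows "\<exists>T\<in>bounded_ops X. \<forall>e>0. \<exists>N. \<forall>n\<ge>N. opnorm X (\<lambda>f x. \<sigma> n f x - T f x) \<le> e"
proof -
  note D = bounded_opsD[OF \<sigma>]
  have pt: "cmod (\<sigma> m f x - \<sigma> n f x) \<le> opnorm X (\<lambda>f x. \<sigma> m f x - \<sigma> n f x) * ell2_norm X f"
    if f: "f \<in> ell2 X" for m n f x
    using ell2_component[OF bounded_opsD(1)[OF bounded_ops_diff[OF \<sigma>[of m] \<sigma>[of n]] f], of x]
      opnorm_bound[OF bounded_ops_diff[OF \<sigma>[of m] \<sigma>[of n]] f] by linarith
  have conv: "convergent (\<lambda>n. \<sigma> n f x)" for f x
  proof (cases "f \<in> ell2 X")
    case True
    have "Cauchy (\<lambda>n. \<sigma> n f x)"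
    proof (rule metric_CauchyI)
      fix e :: real assume "e > 0"
      then have "e / (ell2_norm X f + 1) > 0" by (intro divide_pos_pos add_nonneg_pos) auto
      then obtain N where N: "\<forall>m\<ge>N. \<forall>n\<ge>N. opnorm X (\<lambda>f x. \<sigma> m f x - \<sigma> n f x) < e / (ell2_norm X f + 1)"
        using cauchy by blast
      have "dist (\<sigma> m f x) (\<sigma> n f x) < e" if "m \<ge> N" "n \<ge> N" for m n
      proof -
        have "dist (\<sigma> m f x) (\<sigma> n f x) \<le> opnorm X (\<lambda>f x. \<sigma> m f x - \<sigma> n f x) * ell2_norm X f"
          using pt[OF True] by (simp add: dist_norm)
        also have "\<dots> \<le> opnorm X (\<lambda>f x. \<sigma> m f x - \<sigma> n f x) * (ell2_norm X f + 1)"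
          using opnorm_nonneg[OF bounded_ops_diff[OF \<sigma>[of m] \<sigma>[of n]]] by (intro mult_left_mono) auto
        also have "\<dots> < e"
        proof -
          have "0 < ell2_norm X f + 1" using ell2_norm_nonneg[of X f] by linarith
          then show ?thesis using N that by (simp add: pos_less_divide_eq)
        qed
        finally show ?thesis .
      qed
      then show "\<exists>M. \<forall>m\<ge>M. \<forall>n\<ge>M. dist (\<sigma> m f x) (\<sigma> n f x) < e" by blast
    qed
    then show ?thesis by (simp add: Cauchy_convergent_iff)
  qed (simp add: D(4) convergent_const)
  define T where "T = (\<lambda>f x. lim (\<lambda>n. \<sigma> n f x))"
  have lim: "(\<lambda>n. \<sigma> n f x) \<longlonglongrightarrow> T f x" for f x
    using conv by (simp add: T_def convergent_LIMSEQ_iff)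
  have Toff: "T f = (\<lambda>x. 0)" if "f \<notin> ell2 X" for f
    using that by (simp add: T_def D(4))
  have Tsupp: "T f x = 0" if "f \<in> ell2 X" "x \<notin> X" for f x
    using that ell2_off[OF D(1)] by (simp add: T_def)
  have Tadd: "T (\<lambda>x. f x + g x) = (\<lambda>x. T f x + T g x)" if "f \<in> ell2 X" "g \<in> ell2 X" for f g
  proof
    fix x
    have "(\<lambda>n. \<sigma> n (\<lambda>x. f x + g x) x) \<longlonglongrightarrow> T f x + T g x"
      using that by (simp add: D(2) tendsto_add lim)
    then show "T (\<lambda>x. f x + g x) x = T f x + T g x" using lim LIMSEQ_unique by blast
  qed
  have Tscale: "T (\<lambda>x. c * f x) = (\<lambda>x. c * T f x)" if "f \<in> ell2 X" for f c
  proof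
    fix x
    have "(\<lambda>n. \<sigma> n (\<lambda>x. c * f x) x) \<longlonglongrightarrow> c * T f x"
      using that by (simp add: D(3) tendsto_mult_left lim)
    then show "T (\<lambda>x. c * f x) x = c * T f x" using lim LIMSEQ_unique by blast
  qed
  have near: "(\<lambda>x. \<sigma> n f x - T f x) \<in> ell2 X" "ell2_norm X (\<lambda>x. \<sigma> n f x - T f x) \<le> e * ell2_norm X f"
    if f: "f \<in> ell2 X" and N: "\<forall>m\<ge>N. opnorm X (\<lambda>f x. \<sigma> n f x - \<sigma> m f x) < e" for n N e f
  proof -
    have *: "L2_set (\<lambda>x. cmod (\<sigma> n f x - T f x)) F \<le> e * ell2_norm X f" if F: "finite F" "F \<subseteq> X" for F
    proof -
      have "(\<lambda>m. L2_set (\<lambda>x. cmod (\<sigma> n f x - \<sigma> m f x)) F) \<longlonglongrightarrow> L2_set (\<lambda>x. cmod (\<sigma> n f x - T f x)) F"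
        unfolding L2_set_def by (intro tendsto_intros lim)
      moreover have "L2_set (\<lambda>x. cmod (\<sigma> n f x - \<sigma> m f x)) F \<le> e * ell2_norm X f" if "m \<ge> N" for m
      proof -
        have "L2_set (\<lambda>x. cmod (\<sigma> n f x - \<sigma> m f x)) F \<le> ell2_norm X (\<lambda>x. \<sigma> n f x - \<sigma> m f x)"
          using ell2_L2_set[OF ell2_diff[OF D(1)[OF f] D(1)[OF f]] F] .
        also have "\<dots> \<le> opnorm X (\<lambda>f x. \<sigma> n f x - \<sigma> m f x) * ell2_norm X f"
          using opnorm_bound[OF bounded_ops_diff[OF \<sigma> \<sigma>] f] .
        also have "\<dots> \<le> e * ell2_norm X f"
          using N that by (intro mult_right_mono) auto
        finally show ?thesis .
      qed
      ultimately show ?thesis using LIMSEQ_le_const2 by blast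
    qed
    show "(\<lambda>x. \<sigma> n f x - T f x) \<in> ell2 X" "ell2_norm X (\<lambda>x. \<sigma> n f x - T f x) \<le> e * ell2_norm X f"
      using ell2_L2I[OF _ *] ell2_off[OF D(1)[OF f]] Tsupp[OF f] by auto
  qed
  have diff: "(\<lambda>f x. \<sigma> n f x - T f x) \<in> bounded_ops X \<and> opnorm X (\<lambda>f x. \<sigma> n f x - T f x) \<le> e"
    if N: "\<forall>m\<ge>N. opnorm X (\<lambda>f x. \<sigma> n f x - \<sigma> m f x) < e" and "e > 0" for n N e
    using near[OF _ N] \<open>e > 0\<close>
    by (intro conjI bounded_opsI[OF _ _ _ near(2)[OF _ N]] opnorm_le)
      (auto simp: D Toff Tadd Tscale algebra_simps)
  show ?thesis
  proof (rule bexI)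
    show "\<forall>e>0. \<exists>N. \<forall>n\<ge>N. opnorm X (\<lambda>f x. \<sigma> n f x - T f x) \<le> e"
    proof (intro allI impI)
      fix e :: real assume "e > 0"
      then obtain N where N: "\<forall>m\<ge>N. \<forall>n\<ge>N. opnorm X (\<lambda>f x. \<sigma> m f x - \<sigma> n f x) < e" using cauchy by blast
      have "opnorm X (\<lambda>f x. \<sigma> n f x - T f x) \<le> e" if "n \<ge> N" for n
        using diff[of N n e] N that \<open>e > 0\<close> by blast
      then show "\<exists>N. \<forall>n\<ge>N. opnorm X (\<lambda>f x. \<sigma> n f x - T f x) \<le> e" by blast
    qed
    obtain N where "\<forall>m\<ge>N. \<forall>n\<ge>N. opnorm X (\<lambda>f x. \<sigma> m f x - \<sigma> n f x) < 1" using cauchy[of 1] by auto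
    then have "(\<lambda>f x. \<sigma> N f x - T f x) \<in> bounded_ops X" using diff[of N N 1] by simp
    \<comment> \<open>Boundedness of \<open>T\<close> is read off from
      \<open>\<sigma> N - (\<sigma> N - T)\<close>.\<close>
    from bounded_ops_diff[OF \<sigma>[of N] this] show "T \<in> bounded_ops X" by simp
  qed
qed

lemma Metric_space_bounded_operators:
  "Metric_space (bounded_ops X) (cstar_dist (bounded_operators X))"
proof -
  have dist: "cstar_dist (bounded_operators X) S T = opnorm X (\<lambda>f x. S f x - T f x)"
    if "S \<in> bounded_ops X" "T \<in> bounded_ops X" for S T
    using that by (simp add: cstar_dist_def minus_bounded_operators)
  have sym: "opnorm X (\<lambda>f x. S f x - T f x) = opnorm X (\<lambda>f x. T f x - S f x)"
    if "S \<in> bounded_ops X" "T \<in> bounded_ops X" for S T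
    using bounded_ops_scale(2)[OF bounded_ops_diff[OF that], of "-1"] by simp
  show ?thesis
  proof
    show "0 \<le> cstar_dist (bounded_operators X) S T" for S T
      using opnorm_nonneg[OF bounded_ops_diff, of S X T] by (simp add: cstar_dist_def minus_bounded_operators)
    show "cstar_dist (bounded_operators X) S T = cstar_dist (bounded_operators X) T S" for S T
      using sym[of S T] by (simp add: cstar_dist_def minus_bounded_operators)
    show "cstar_dist (bounded_operators X) S T = 0 \<longleftrightarrow> S = T"
      if ST: "S \<in> bounded_ops X" "T \<in> bounded_ops X" for S T
    proof
      assume 0: "cstar_dist (bounded_operators X) S T = 0"
      show "S = T"
      proof (intro ext)
        fix f x
        show "S f x = T f x"
        proof (cases "f \<in> ell2 X")
          case True
          have "ell2_norm X (\<lambda>x. S f x - T f x) \<le> 0"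
            using opnorm_bound[OF bounded_ops_diff[OF ST] True] 0 dist[OF ST] by simp
          then have "ell2_norm X (\<lambda>x. S f x - T f x) = 0"
            using ell2_norm_nonneg[of X "\<lambda>x. S f x - T f x"] by linarith
          then have "(\<lambda>x. S f x - T f x) = (\<lambda>x. 0)"
            using bounded_opsD(1)[OF bounded_ops_diff[OF ST] True] ell2_norm_zeroD by blast
          then show ?thesis by (metis eq_iff_diff_eq_0)
        qed (use ST in \<open>simp add: bounded_opsD(4)\<close>)
      qed
    next
      assume "S = T"
      then show "cstar_dist (bounded_operators X) S T = 0"
        using bounded_ops_scale(2)[OF bounded_ops_zero, of X 0] dist[OF ST] by simp
    qed
    show "cstar_dist (bounded_operators X) R T \<le> cstar_dist (bounded_operators X) R S + cstar_dist (bounded_operators X) S T"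
      if "R \<in> bounded_ops X" "S \<in> bounded_ops X" "T \<in> bounded_ops X" for R S T
      using bounded_ops_add(2)[OF bounded_ops_diff[OF that(1,2)] bounded_ops_diff[OF that(2,3)]] that
      by (simp add: dist)
  qed
qed

theorem unital_cstar_algebra_bounded_operators: "unital_cstar_algebra (bounded_operators X)"
proof -
  interpret ring "bounded_operators X" by (rule ring_bounded_operators)
  interpret MS: Metric_space "bounded_ops X" "cstar_dist (bounded_operators X)"
    by (rule Metric_space_bounded_operators)
  have dist: "cstar_dist (bounded_operators X) S T = opnorm X (\<lambda>f x. S f x - T f x)"
    if "S \<in> bounded_ops X" "T \<in> bounded_ops X" for S T
    using that by (simp add: cstar_dist_def minus_bounded_operators)
  have "MS.mcomplete"
    unfolding MS.mcomplete_def
  proof safe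
    fix \<sigma> assume \<sigma>: "MS.MCauchy \<sigma>"
    then have \<sigma>c: "\<sigma> n \<in> bounded_ops X" for n by (auto simp: MS.MCauchy_def)
    then have "\<exists>N. \<forall>m\<ge>N. \<forall>n\<ge>N. opnorm X (\<lambda>f x. \<sigma> m f x - \<sigma> n f x) < e" if "e > 0" for e
      using \<sigma> that unfolding MS.MCauchy_def by (simp add: dist)
    then obtain T where T: "T \<in> bounded_ops X"
      "\<And>e. e > 0 \<Longrightarrow> \<exists>N. \<forall>n\<ge>N. opnorm X (\<lambda>f x. \<sigma> n f x - T f x) \<le> e"
      using bounded_ops_cauchy_limit[of \<sigma> X] \<sigma>c by blast
    have "\<exists>N. \<forall>n\<ge>N. opnorm X (\<lambda>f x. \<sigma> n f x - T f x) < e" if "e > 0" for e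
    proof -
      obtain N where "\<forall>n\<ge>N. opnorm X (\<lambda>f x. \<sigma> n f x - T f x) \<le> e / 2" using T(2)[of "e / 2"] \<open>e > 0\<close> by auto
      then show ?thesis using \<open>e > 0\<close> by (intro exI[of _ N]) force
    qed
    then have "limitin MS.mtopology \<sigma> T sequentially"
      using T(1) \<sigma>c by (auto simp: MS.limitin_metric eventually_sequentially dist)
    then show "\<exists>T. limitin MS.mtopology \<sigma> T sequentially" by blast
  qed
  note complete = this
  have nrm_0: "opnorm X T = 0 \<longleftrightarrow> T = (\<lambda>f x. 0)" if "T \<in> bounded_ops X" for T
    using MS.zero[OF that bounded_ops_zero] dist[OF that bounded_ops_zero] by simp
  show ?thesis
  proof (intro unital_cstar_algebra.intro ring_bounded_operators unital_cstar_algebra_axioms.intro,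
      unfold bounded_operators_simps)
    fix S T :: "'a operator" and c d :: complex
    assume S: "S \<in> bounded_ops X"
    show "(\<lambda>f x. c * S f x) \<in> bounded_ops X" by (rule bounded_ops_scale[OF S])
    show "(\<lambda>f x. (c + d) * S f x) = (\<lambda>f x. c * S f x + d * S f x)" by (simp add: distrib_right)
    show "(\<lambda>f x. c * (d * S f x)) = (\<lambda>f x. c * d * S f x)" "(\<lambda>f x. 1 * S f x) = S"
      by (simp_all add: mult.assoc)
    show "adjoint X S \<in> bounded_ops X" by (rule adjoint_props[OF S])
    show "adjoint X (adjoint X S) = S" by (rule adjoint_adjoint[OF S])
    show "adjoint X (\<lambda>f x. c * S f x) = (\<lambda>f x. cnj c * adjoint X S f x)"
      using S by (intro adjoint_eqI bounded_ops_scale(1) adjoint_props(1))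
        (simp_all add: ell2_inner_scale_left ell2_inner_scale_right adjoint_props(2)[OF S])
    show "0 \<le> opnorm X S" by (rule opnorm_nonneg[OF S])
    show "(opnorm X S = 0) = (S = (\<lambda>f x. 0))" by (rule nrm_0[OF S])
    show "opnorm X (\<lambda>f x. c * S f x) = cmod c * opnorm X S" by (rule bounded_ops_scale[OF S])
    show "opnorm X (\<lambda>f. adjoint X S (S f)) = (opnorm X S)\<^sup>2" by (rule opnorm_cstar_identity[OF S])
    assume T: "T \<in> bounded_ops X"
    note rng = bounded_ops_range[OF S] bounded_ops_range[OF T]
      bounded_ops_range[OF adjoint_props(1)[OF S]] bounded_ops_range[OF adjoint_props(1)[OF T]]
    show "(\<lambda>f x. c * (S f x + T f x)) = (\<lambda>f x. c * S f x + c * T f x)" by (simp add: distrib_left)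
    show "(\<lambda>f x. c * S (T f) x) = (\<lambda>f x. c * S (T f) x)" by simp
    show "(\<lambda>f. S (\<lambda>x. c * T f x)) = (\<lambda>f x. c * S (T f) x)"
      using bounded_opsD(3)[OF S bounded_ops_range[OF T]] by (intro ext) simp
    show "adjoint X (\<lambda>f x. S f x + T f x) = (\<lambda>f x. adjoint X S f x + adjoint X T f x)"
    proof (rule adjoint_eqI)
      show "(\<lambda>f x. adjoint X S f x + adjoint X T f x) \<in> bounded_ops X"
        by (rule bounded_ops_add(1)[OF adjoint_props(1)[OF S] adjoint_props(1)[OF T]])
      fix f g assume f: "f \<in> ell2 X" and g: "g \<in> ell2 X"
      show "ell2_inner X (\<lambda>x. S f x + T f x) g = ell2_inner X f (\<lambda>x. adjoint X S g x + adjoint X T g x)"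
        unfolding ell2_inner_add_left[OF rng(1,2) g] ell2_inner_add_right[OF rng(3,4) f]
          adjoint_props(2)[OF S f g] adjoint_props(2)[OF T f g] ..
    qed
    show "adjoint X (\<lambda>f. S (T f)) = (\<lambda>f. adjoint X T (adjoint X S f))"
    proof (rule adjoint_eqI)
      show "(\<lambda>f. adjoint X T (adjoint X S f)) \<in> bounded_ops X"
        by (rule bounded_ops_mult(1)[OF adjoint_props(1)[OF T] adjoint_props(1)[OF S]])
      fix f g assume f: "f \<in> ell2 X" and g: "g \<in> ell2 X"
      show "ell2_inner X (S (T f)) g = ell2_inner X f (adjoint X T (adjoint X S g))"
        unfolding adjoint_props(2)[OF S rng(2) g] adjoint_props(2)[OF T f rng(3)] ..
    qed
    show "opnorm X (\<lambda>f x. S f x + T f x) \<le> opnorm X S + opnorm X T" by (rule bounded_ops_add[OF S T])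
    show "opnorm X (\<lambda>f. S (T f)) \<le> opnorm X S * opnorm X T" by (rule bounded_ops_mult[OF S T])
  qed (rule complete)
qed


section \<open>Words and constructible ideals\<close>

text \<open>Words grow by one factor \<open>inv p \<otimes> q\<close> at a time, in step with the
  recursions for \<open>word_dot\<close> and \<open>word_eval\<close>.\<close>

lemma words_induct [consumes 1, case_names Nil Cons]:
  assumes "\<alpha> \<in> words P" "Q []"
    "\<And>p q \<alpha>. p \<in> P \<Longrightarrow> q \<in> P \<Longrightarrow> \<alpha> \<in> words P \<Longrightarrow> Q \<alpha> \<Longrightarrow> Q (p # q # \<alpha>)"
  shows "Q \<alpha>"
  using assms(1)
proof (induction "length \<alpha>" arbitrary: \<alpha> rule: less_induct)
  case less
  show ?case
  proof (cases \<alpha>)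
    case (Cons p \<beta>)
    then obtain q \<gamma> where "\<alpha> = p # q # \<gamma>"
      using less.prems by (cases \<beta>) (auto simp: words_def)
    then show ?thesis using less assms(3) by (auto simp: words_def)
  qed (simp add: assms(2))
qed

lemma words_simps [simp]:
  "[] \<in> words P" "p # q # \<alpha> \<in> words P \<longleftrightarrow> p \<in> P \<and> q \<in> P \<and> \<alpha> \<in> words P"
  by (auto simp: words_def)

lemma words_append [simp]: "\<alpha> \<in> words P \<Longrightarrow> \<beta> \<in> words P \<Longrightarrow> \<alpha> @ \<beta> \<in> words P"
  by (auto simp: words_def)

lemma words_rev [simp]: "\<alpha> \<in> words P \<Longrightarrow> rev \<alpha> \<in> words P"
  by (auto simp: words_def)

lemma words_drop: "\<alpha> \<in> words P \<Longrightarrow> drop (2 * i) \<alpha> \<in> words P"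
  by (auto simp: words_def dest: in_set_dropD)

locale submonoid_in_group = group G + submonoid P G
  for G :: "('g, 'm) monoid_scheme" (structure) and P :: "'g set"
begin

abbreviation dot :: "'g list \<Rightarrow> 'g" where "dot \<equiv> word_dot G"
abbreviation K :: "'g list \<Rightarrow> 'g set" where "K \<equiv> word_K G P"
abbreviation J :: "'g set set" where "J \<equiv> constructible_ideals G P"
abbreviation neutral :: "'g list set" where "neutral \<equiv> neutral_words G P"

lemma word_dot_closed [simp]: "\<alpha> \<in> words P \<Longrightarrow> dot \<alpha> \<in> carrier G"
  by (induction rule: words_induct) auto

lemma word_dot_append:
  "\<alpha> \<in> words P \<Longrightarrow> \<beta> \<in> words P \<Longrightarrow> dot (\<alpha> @ \<beta>) = dot \<alpha> \<otimes> dot \<beta>"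
  by (induction rule: words_induct) (auto simp: m_assoc)

lemma word_dot_rev: "\<alpha> \<in> words P \<Longrightarrow> dot (rev \<alpha>) = inv (dot \<alpha>)"
  by (induction rule: words_induct) (auto simp: word_dot_append inv_mult_group m_assoc)

lemma mem_l_coset_iff: "g \<in> carrier G \<Longrightarrow> x \<in> g <# P \<longleftrightarrow> x \<in> carrier G \<and> inv g \<otimes> x \<in> P"
  unfolding l_coset_def using subset by (auto simp: m_assoc[symmetric] intro!: bexI[of _ "inv g \<otimes> x"])

text \<open>A word acts on points from the right, one pair \<open>inv p \<otimes> q\<close> after
  the other. In this reading \<open>K \<alpha>\<close> consists of the points that never leave
  \<open>P\<close> on the way: it is the domain of the partial translation by
  \<open>dot \<alpha>\<close> which the word describes.\<close>

lemma word_K_iff: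
  assumes "\<alpha> \<in> words P"
  shows "x \<in> K \<alpha> \<longleftrightarrow> x \<in> carrier G \<and> (\<forall>i\<le>length \<alpha> div 2. dot (drop (2 * i) \<alpha>) \<otimes> x \<in> P)"
  using assms unfolding word_K_def
  by (auto simp: mem_l_coset_iff word_dot_rev words_drop)

lemma word_K_Nil [simp]: "K [] = P"
  using word_K_iff[of "[]"] subset by auto

lemma word_K_Cons:
  assumes "p \<in> P" "q \<in> P" "\<alpha> \<in> words P"
  shows "K (p # q # \<alpha>) = {x \<in> K \<alpha>. inv p \<otimes> q \<otimes> dot \<alpha> \<otimes> x \<in> P}"
proof -
  have "(\<forall>i\<le>Suc n. Q i) \<longleftrightarrow> Q 0 \<and> (\<forall>i\<le>n. Q (Suc i))" for n and Q :: "nat \<Rightarrow> bool"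
    by (metis Suc_le_mono le0 not0_implies_Suc)
  then show ?thesis using assms by (auto simp: word_K_iff)
qed

lemma word_K_subset: "\<alpha> \<in> words P \<Longrightarrow> K \<alpha> \<subseteq> P"
  by (induction rule: words_induct) (auto simp: word_K_Cons)

text \<open>Domain of a composite of partial translations, with \<open>\<beta>\<close> applied
  first.\<close>

lemma word_K_append:
  "\<alpha> \<in> words P \<Longrightarrow> \<beta> \<in> words P \<Longrightarrow> K (\<alpha> @ \<beta>) = {x \<in> K \<beta>. dot \<beta> \<otimes> x \<in> K \<alpha>}"
proof (induction rule: words_induct)
  case Nil
  have "dot \<beta> \<otimes> x \<in> P" if "x \<in> K \<beta>" for x
    using word_K_iff[OF Nil, of x] that by (auto dest: spec[of _ 0])
  then show ?case by auto
next
  case (Cons p q \<alpha>)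
  then have sub: "x \<in> carrier G" if "x \<in> K \<beta>" for x
    using that word_K_subset[of \<beta>] subset by auto
  have "inv p \<otimes> q \<otimes> (dot \<alpha> \<otimes> dot \<beta>) \<otimes> x = inv p \<otimes> q \<otimes> dot \<alpha> \<otimes> (dot \<beta> \<otimes> x)" if "x \<in> K \<beta>" for x
    using Cons sub[OF that] by (simp add: m_assoc)
  then show ?case using Cons by (auto simp: word_K_Cons word_dot_append)
qed

text \<open>Reversing a word inverts its partial translation, so domain and range change
  places.\<close>

lemma word_K_rev_iff:
  "\<alpha> \<in> words P \<Longrightarrow> x \<in> carrier G \<Longrightarrow> dot \<alpha> \<otimes> x \<in> K (rev \<alpha>) \<longleftrightarrow> x \<in> K \<alpha>"
proof (induction rule: words_induct)
  case (Cons p q \<alpha>)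
  let ?y = "inv p \<otimes> q \<otimes> dot \<alpha> \<otimes> x"
  have y: "inv q \<otimes> p \<otimes> ?y = dot \<alpha> \<otimes> x"
    using Cons by (simp add: m_assoc[symmetric]) (simp add: m_assoc)
  have "?y \<in> K (rev \<alpha> @ [q, p]) \<longleftrightarrow> ?y \<in> P \<and> inv q \<otimes> p \<otimes> ?y \<in> P \<and> inv q \<otimes> p \<otimes> ?y \<in> K (rev \<alpha>)"
    using Cons by (simp add: word_K_append word_K_Cons conj_assoc)
  also have "\<dots> \<longleftrightarrow> ?y \<in> P \<and> x \<in> K \<alpha>"
    unfolding y using Cons word_K_subset[of "rev \<alpha>"] by auto
  finally show ?case using Cons by (auto simp: word_K_Cons)
qed auto

lemma word_K_dot_mem: "\<alpha> \<in> words P \<Longrightarrow> x \<in> K \<alpha> \<Longrightarrow> dot \<alpha> \<otimes> x \<in> P"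
  using word_K_rev_iff[of \<alpha> x] word_K_subset[of \<alpha>] word_K_subset[of "rev \<alpha>"] subset by auto

lemma word_K_right_ideal: "\<alpha> \<in> words P \<Longrightarrow> x \<in> K \<alpha> \<Longrightarrow> y \<in> P \<Longrightarrow> x \<otimes> y \<in> K \<alpha>"
proof (induction rule: words_induct)
  case (Cons p q \<alpha>)
  then have x: "x \<in> carrier G" using word_K_subset[of \<alpha>] subset by (auto simp: word_K_Cons)
  have "inv p \<otimes> q \<otimes> dot \<alpha> \<otimes> (x \<otimes> y) = (inv p \<otimes> q \<otimes> dot \<alpha> \<otimes> x) \<otimes> y"
    using Cons x by (simp add: m_assoc)
  then show ?case using Cons by (auto simp: word_K_Cons)
qed auto

lemma neutral_wordsI: "\<alpha> \<in> words P \<Longrightarrow> dot \<alpha> = \<one> \<Longrightarrow> \<alpha> \<in> neutral"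
  by (simp add: neutral_words_def)

lemma neutral_wordsD: "\<alpha> \<in> neutral \<Longrightarrow> \<alpha> \<in> words P" "\<alpha> \<in> neutral \<Longrightarrow> dot \<alpha> = \<one>"
  by (auto simp: neutral_words_def)

text \<open>Going forth with \<open>\<alpha>\<close> and back with \<open>rev \<alpha>\<close> is
  the identity on \<open>K \<alpha>\<close>. Hence neutral words already yield all constructible
  ideals, and projections in the algebra can be indexed by ideals.\<close>

lemma neutral_rev_append:
  assumes "\<alpha> \<in> words P" shows "rev \<alpha> @ \<alpha> \<in> neutral" "K (rev \<alpha> @ \<alpha>) = K \<alpha>"
proof -
  show "rev \<alpha> @ \<alpha> \<in> neutral"
    using assms by (intro neutral_wordsI) (auto simp: word_dot_append word_dot_rev)
  have "x \<in> carrier G" if "x \<in> K \<alpha>" for x using that word_K_subset[OF assms] subset by auto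
  then show "K (rev \<alpha> @ \<alpha>) = K \<alpha>"
    using assms by (auto simp: word_K_append word_K_rev_iff)
qed

lemma constructible_neutral: "S \<in> J \<Longrightarrow> \<exists>\<alpha>\<in>neutral. S = K \<alpha>"
  unfolding constructible_ideals_def using neutral_rev_append by (metis imageE)

lemma constructibleI: "\<alpha> \<in> words P \<Longrightarrow> K \<alpha> \<in> J"
  by (simp add: constructible_ideals_def)

lemma constructible_subset: "S \<in> J \<Longrightarrow> S \<subseteq> P"
  using word_K_subset by (auto simp: constructible_ideals_def)

lemma constructible_right_ideal: "S \<in> J \<Longrightarrow> x \<in> S \<Longrightarrow> y \<in> P \<Longrightarrow> x \<otimes> y \<in> S"
  using word_K_right_ideal by (auto simp: constructible_ideals_def)

lemma constructible_l_coset: "S \<in> J \<Longrightarrow> x \<in> S \<Longrightarrow> x <# P \<subseteq> S"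
  unfolding l_coset_def using constructible_right_ideal by blast

lemma constructible_whole [simp]: "P \<in> J"
  using constructibleI[of "[]"] by simp

lemma constructible_preimage:
  assumes "S \<in> J" "\<alpha> \<in> words P" shows "{x \<in> K \<alpha>. dot \<alpha> \<otimes> x \<in> S} \<in> J"
proof -
  obtain \<beta> where "\<beta> \<in> words P" "S = K \<beta>" using assms by (auto simp: constructible_ideals_def)
  then show ?thesis using constructibleI[of "\<beta> @ \<alpha>"] assms by (simp add: word_K_append)
qed

lemma word_K_append_neutral:
  assumes "\<alpha> \<in> words P" "\<beta> \<in> neutral" shows "K (\<alpha> @ \<beta>) = K \<alpha> \<inter> K \<beta>"
proof -
  have "x \<in> carrier G" if "x \<in> K \<beta>" for x
    using that word_K_subset[OF neutral_wordsD(1)[OF assms(2)]] subset by auto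
  then show ?thesis using assms by (auto simp: word_K_append neutral_wordsD)
qed

lemma neutral_append: "\<alpha> \<in> neutral \<Longrightarrow> \<beta> \<in> neutral \<Longrightarrow> \<alpha> @ \<beta> \<in> neutral"
  by (intro neutral_wordsI) (auto simp: neutral_wordsD word_dot_append)

lemma neutral_rev: "\<alpha> \<in> neutral \<Longrightarrow> rev \<alpha> \<in> neutral"
  by (intro neutral_wordsI) (auto simp: neutral_wordsD word_dot_rev)

lemma word_K_rev_neutral:
  assumes "\<alpha> \<in> neutral" shows "K (rev \<alpha>) = K \<alpha>"
proof -
  have "x \<in> K (rev \<alpha>) \<longleftrightarrow> x \<in> K \<alpha>" if "x \<in> carrier G" for x
    using word_K_rev_iff[of \<alpha> x] that assms by (simp add: neutral_wordsD)
  moreover have "K \<alpha> \<subseteq> carrier G" "K (rev \<alpha>) \<subseteq> carrier G"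
    using assms word_K_subset[of \<alpha>] word_K_subset[of "rev \<alpha>"] subset by (auto simp: neutral_wordsD)
  ultimately show ?thesis by blast
qed

lemma constructible_Int:
  assumes "R \<in> J" "S \<in> J" shows "R \<inter> S \<in> J"
proof -
  obtain \<alpha> \<beta> where "\<alpha> \<in> neutral" "R = K \<alpha>" "\<beta> \<in> neutral" "S = K \<beta>"
    using assms constructible_neutral by blast
  then show ?thesis using constructibleI[of "\<alpha> @ \<beta>"] by (simp add: word_K_append_neutral neutral_wordsD)
qed

text \<open>The intersection with \<open>P\<close> gives the empty family the right value.\<close>

lemma constructible_INT: "finite F \<Longrightarrow> F \<subseteq> J \<Longrightarrow> P \<inter> \<Inter>F \<in> J"
proof (induction rule: finite_induct)
  case (insert S F)
  then have "S \<inter> (P \<inter> \<Inter>F) \<in> J" using constructible_Int[of S "P \<inter> \<Inter>F"] by simp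
  moreover have "S \<inter> (P \<inter> \<Inter>F) = P \<inter> \<Inter>(insert S F)" by auto
  ultimately show ?case by (simp only:)
qed simp

lemma l_coset_subset: "x \<in> P \<Longrightarrow> x <# P \<subseteq> P"
  by (auto simp: l_coset_def)

lemma l_coset_constructible: "x \<in> P \<Longrightarrow> x <# P \<in> J"
proof -
  assume x: "x \<in> P"
  \<comment> \<open>The word \<open>[x, \<one>]\<close> describes translation by
    \<open>inv x\<close>, which is defined exactly on \<open>x <# P\<close>.\<close>
  then have "K [x, \<one>] = x <# P"
    using l_coset_subset[OF x] subset by (auto simp: word_K_Cons mem_l_coset_iff)
  then show ?thesis using constructibleI[of "[x, \<one>]"] x by simp
qed

lemma l_coset_self: "x \<in> carrier G \<Longrightarrow> x \<in> x <# P"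
  by (auto simp: mem_l_coset_iff)

lemma l_coset_mono: "x \<in> carrier G \<Longrightarrow> y \<in> x <# P \<Longrightarrow> y <# P \<subseteq> x <# P"
proof
  fix z assume "x \<in> carrier G" "y \<in> x <# P" "z \<in> y <# P"
  then obtain p q where "p \<in> P" "q \<in> P" "z = x \<otimes> (q \<otimes> p)"
    by (auto simp: l_coset_def m_assoc)
  then show "z \<in> x <# P" unfolding l_coset_def using m_closed[of q p] by blast
qed

lemma l_coset_eq_iff:
  "x \<in> carrier G \<Longrightarrow> y \<in> carrier G \<Longrightarrow> x <# P = y <# P \<longleftrightarrow> x \<in> y <# P \<and> y \<in> x <# P"
  using l_coset_self l_coset_mono by blast

lemma word_K_unit_left: "p \<in> P \<Longrightarrow> K [\<one>, p] = P" "p \<in> P \<Longrightarrow> dot [\<one>, p] = p"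
  using subset by (auto simp: word_K_Cons)

lemma constructible_translate: "S \<in> J \<Longrightarrow> x \<in> P \<Longrightarrow> {y \<in> P. x \<otimes> y \<in> S} \<in> J"
  using constructible_preimage[of S "[\<one>, x]"] by (simp add: word_K_unit_left del: word_dot.simps)

lemma constructible_eq_whole: "S \<in> J \<Longrightarrow> \<one> \<in> S \<Longrightarrow> S = P"
  using constructible_right_ideal[of S \<one>] constructible_subset[of S] subset by fastforce

section \<open>Condition (3) and the points moved by a group element\<close>

definition units_move_principal_ideals :: bool where
  "units_move_principal_ideals \<longleftrightarrow>
    (\<forall>u\<in>unit_group G P - {\<one>}. \<forall>C. finite C \<and> C \<subseteq> J - {P} \<longrightarrow>
       (\<exists>s\<in>P - \<Union>C. (u \<otimes> s) <# P \<noteq> s <# P))"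

text \<open>These are the traces on \<open>P\<close> of basic open sets of the spectrum. The removed
  ideals form a list to match the ordered products of projections used later.\<close>

definition basic :: "'g set \<Rightarrow> bool" where
  "basic V \<longleftrightarrow> (\<exists>S\<in>J. \<exists>Rs. set Rs \<subseteq> J \<and> V = S - \<Union>(set Rs))"

text \<open>A group element fixing all principal ideals of points of \<open>V\<close> is conjugate, by a point of
  \<open>V\<close>, to a unit fixing all principal ideals off finitely many proper constructible ideals.\<close>

lemma basic_moved_point:
  assumes cond: units_move_principal_ideals
    and V: "basic V" "V \<noteq> {}" and g: "g \<in> carrier G" "g \<noteq> \<one>"
  shows "\<exists>y\<in>V. g \<otimes> y \<notin> P \<or> (g \<otimes> y) <# P \<noteq> y <# P"
proof (rule ccontr)
  assume "\<not> ?thesis"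
  then have fixd: "g \<otimes> y \<in> P" "(g \<otimes> y) <# P = y <# P" if "y \<in> V" for y using that by auto
  obtain S Rs where S: "S \<in> J" "set Rs \<subseteq> J" "V = S - \<Union>(set Rs)"
    using V by (auto simp: basic_def)
  obtain x where x: "x \<in> V" using V by blast
  have xP: "x \<in> P" using x S constructible_subset by auto
  then have xc [simp]: "x \<in> carrier G" by simp
  define u where "u = inv x \<otimes> (g \<otimes> x)"
  have uc [simp]: "u \<in> carrier G" using g by (simp add: u_def)
  have gx: "g \<otimes> x = x \<otimes> u" using g by (simp add: u_def m_assoc[symmetric])
  have "g \<otimes> x \<in> x <# P" using fixd(2)[OF x] g l_coset_self[of "g \<otimes> x"] by simp
  then have "u \<in> P" by (simp add: mem_l_coset_iff u_def)
  moreover have "x \<in> (g \<otimes> x) <# P" using fixd(2)[OF x] l_coset_self[of x] by simp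
  then have "inv (g \<otimes> x) \<otimes> x \<in> P" using g by (simp add: mem_l_coset_iff)
  then have "inv u \<in> P" unfolding gx by (simp add: inv_mult_group m_assoc)
  moreover have "u \<noteq> \<one>"
  proof
    assume "u = \<one>"
    then have "g \<otimes> x \<otimes> inv x = x \<otimes> inv x" using gx by simp
    then show False using g by (simp add: m_assoc)
  qed
  ultimately have u: "u \<in> unit_group G P - {\<one>}" by (simp add: unit_group_def)
  \<comment> \<open>Pulled back along \<open>x\<close>, the removed ideals become proper, because
    \<open>x\<close> lies in none of them; a point \<open>s\<close> outside the pulled-back ideals
    makes \<open>x \<otimes> s\<close> a point of \<open>V\<close>.\<close>
  define C where "C = (\<lambda>R. {y \<in> P. x \<otimes> y \<in> R}) ` set Rs"
  have "\<one> \<notin> {y \<in> P. x \<otimes> y \<in> R}" if "R \<in> set Rs" for R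
    using x S that by auto
  then have ne: "{y \<in> P. x \<otimes> y \<in> R} \<noteq> P" if "R \<in> set Rs" for R using that one_closed by metis
  have "C \<subseteq> J - {P}"
  proof
    fix c assume "c \<in> C"
    then obtain R where R: "R \<in> set Rs" "c = {y \<in> P. x \<otimes> y \<in> R}" by (auto simp: C_def)
    then have "R \<in> J" using S by blast
    then show "c \<in> J - {P}" using constructible_translate[OF _ xP] ne[OF R(1)] R(2) by simp
  qed
  moreover have "finite C" by (simp add: C_def)
  ultimately obtain s where s: "s \<in> P" "s \<notin> \<Union>C" "(u \<otimes> s) <# P \<noteq> s <# P"
    using cond u unfolding units_move_principal_ideals_def by blast
  have sc [simp]: "s \<in> carrier G" using s by simp
  have "x \<otimes> s \<in> V"
    using s x S constructible_right_ideal[of S x s] xP by (auto simp: C_def)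
  then have eq: "(g \<otimes> (x \<otimes> s)) <# P = (x \<otimes> s) <# P" using fixd by blast
  have gxs: "g \<otimes> (x \<otimes> s) = x \<otimes> (u \<otimes> s)" using g by (simp add: m_assoc[symmetric] gx)
  have "inv (x \<otimes> a) \<otimes> (x \<otimes> b) = inv a \<otimes> b" if "a \<in> carrier G" "b \<in> carrier G" for a b
    using that by (simp add: inv_mult_group m_assoc) (simp flip: m_assoc)
  then have "x \<otimes> b \<in> (x \<otimes> a) <# P \<longleftrightarrow> b \<in> a <# P" if "a \<in> carrier G" "b \<in> carrier G" for a b
    using that by (simp add: mem_l_coset_iff)
  then have "(u \<otimes> s) <# P = s <# P"
    using eq unfolding gxs by (simp add: l_coset_eq_iff)
  then show False using s by blast
qed

section \<open>The spectrum and its partial action\<close>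

abbreviation \<Omega> :: "('g set \<Rightarrow> nat) set" where "\<Omega> \<equiv> spectrum G P"

definition point_char :: "'g \<Rightarrow> 'g set \<Rightarrow> nat" where
  "point_char x = (\<lambda>S\<in>J. if x \<in> S then 1 else 0)"

lemma point_char_simp: "S \<in> J \<Longrightarrow> point_char x S = (if x \<in> S then 1 else 0)"
  by (simp add: point_char_def)

lemma point_char_spectrum: "x \<in> P \<Longrightarrow> point_char x \<in> \<Omega>"
  unfolding spectrum_def
proof (intro CollectI conjI ballI allI impI)
  assume x: "x \<in> P"
  show "point_char x \<in> J \<rightarrow>\<^sub>E {0, 1}" by (auto simp: point_char_def)
  show "\<exists>S\<in>J. point_char x S \<noteq> 0" using x by (intro bexI[of _ P]) (auto simp: point_char_simp)
  show "point_char x (R \<inter> S) = point_char x R * point_char x S" if "R \<in> J" "S \<in> J" for R S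
    using that by (simp add: point_char_simp constructible_Int)
  show "point_char x {} = 0" if "{} \<in> J" using that by (simp add: point_char_simp)
  fix S F assume "S \<in> J" "finite F \<and> F \<subseteq> J \<and> S = \<Union>F \<and> point_char x S = 1"
  then obtain R where "R \<in> F" "x \<in> R" "R \<in> J" using subsetD[of F J] by (auto simp: point_char_simp split: if_splits)
  then show "\<exists>R\<in>F. point_char x R = 1" by (intro bexI[of _ R]) (simp_all add: point_char_simp)
qed

lemma spectrumD:
  assumes "\<phi> \<in> \<Omega>"
  shows "\<phi> \<in> J \<rightarrow>\<^sub>E {0, 1}" "\<And>R S. R \<in> J \<Longrightarrow> S \<in> J \<Longrightarrow> \<phi> (R \<inter> S) = \<phi> R * \<phi> S"
    "{} \<in> J \<Longrightarrow> \<phi> {} = 0"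
    "\<And>S F. S \<in> J \<Longrightarrow> finite F \<Longrightarrow> F \<subseteq> J \<Longrightarrow> S = \<Union>F \<Longrightarrow> \<phi> S = 1 \<Longrightarrow> \<exists>R\<in>F. \<phi> R = 1"
    "\<phi> P = 1" "\<And>S. S \<in> J \<Longrightarrow> \<phi> S = 0 \<or> \<phi> S = 1"
proof -
  show 1: "\<phi> \<in> J \<rightarrow>\<^sub>E {0, 1}" "\<And>R S. R \<in> J \<Longrightarrow> S \<in> J \<Longrightarrow> \<phi> (R \<inter> S) = \<phi> R * \<phi> S"
    "{} \<in> J \<Longrightarrow> \<phi> {} = 0"
    "\<And>S F. S \<in> J \<Longrightarrow> finite F \<Longrightarrow> F \<subseteq> J \<Longrightarrow> S = \<Union>F \<Longrightarrow> \<phi> S = 1 \<Longrightarrow> \<exists>R\<in>F. \<phi> R = 1"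
    using assms by (auto simp: spectrum_def)
  show "\<phi> S = 0 \<or> \<phi> S = 1" if "S \<in> J" for S using 1(1) that by (auto simp: PiE_def Pi_def)
  obtain S where S: "S \<in> J" "\<phi> S \<noteq> 0" using assms by (auto simp: spectrum_def)
  then have "\<phi> S = \<phi> S * \<phi> P"
    using 1(2)[of S P] constructible_subset[of S] by (simp add: inf_absorb1)
  then show "\<phi> P = 1" using S by simp
qed

text \<open>Cutting the cover down to \<open>S\<close> produces the exact union that the definition
  of the spectrum asks for.\<close>

lemma spectrum_cover:
  assumes \<phi>: "\<phi> \<in> \<Omega>" and "S \<in> J" "finite F" "F \<subseteq> J" "S \<subseteq> \<Union>F" "\<phi> S = 1"
  shows "\<exists>R\<in>F. \<phi> R = 1"
proof -
  have "\<exists>R'\<in>(\<lambda>R. S \<inter> R) ` F. \<phi> R' = 1"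
    using assms constructible_Int by (intro spectrumD(4)[OF \<phi>, of S]) auto
  then obtain R where "R \<in> F" "\<phi> S * \<phi> R = 1"
    using assms by (auto simp: spectrumD(2)[OF \<phi>] subset_iff)
  then show ?thesis using assms by auto
qed

lemma spectrum_INT:
  assumes "\<phi> \<in> \<Omega>" shows "finite F \<Longrightarrow> F \<subseteq> J \<Longrightarrow> (\<And>S. S \<in> F \<Longrightarrow> \<phi> S = 1) \<Longrightarrow> \<phi> (P \<inter> \<Inter>F) = 1"
proof (induction rule: finite_induct)
  case (insert S F)
  then have "\<phi> (S \<inter> (P \<inter> \<Inter>F)) = 1"
    using constructible_INT[of F] by (subst spectrumD(2)[OF assms]) auto
  moreover have "S \<inter> (P \<inter> \<Inter>F) = P \<inter> \<Inter>(insert S F)" by auto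
  ultimately show ?case by (simp only:)
qed (simp add: spectrumD(5)[OF assms])

text \<open>Any single word \<open>\<alpha>\<close> of the given value with
  \<open>\<phi> (K \<alpha>) = 1\<close> computes the action: the image is \<open>\<phi>\<close>
  composed with taking preimages under the partial translation. This composite meets the description
  in \<open>action_map\<close>, and no other point does.\<close>

lemma action_map_apply:
  assumes \<phi>: "\<phi> \<in> \<Omega>" and \<alpha>: "\<alpha> \<in> words P" "\<phi> (K \<alpha>) = 1" and S: "S \<in> J"
  shows "action_map G P (dot \<alpha>) \<phi> S = \<phi> {x \<in> K \<alpha>. dot \<alpha> \<otimes> x \<in> S}"
    and "action_map G P (dot \<alpha>) \<phi> \<in> \<Omega>"
proof -
  define pre where "pre S = {x \<in> K \<alpha>. dot \<alpha> \<otimes> x \<in> S}" for S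
  define \<psi> where "\<psi> = (\<lambda>S\<in>J. \<phi> (pre S))"
  note D = spectrumD[OF \<phi>]
  have preJ: "pre S \<in> J" if "S \<in> J" for S
    using constructible_preimage[OF that \<alpha>(1)] by (simp add: pre_def)
  have \<psi>: "\<psi> S = \<phi> (pre S)" if "S \<in> J" for S using that by (simp add: \<psi>_def)
  have preP: "pre P = K \<alpha>" using word_K_dot_mem[OF \<alpha>(1)] by (auto simp: pre_def)
  have Kc: "x \<in> carrier G" if "\<gamma> \<in> words P" "x \<in> K \<gamma>" for x \<gamma>
    using that word_K_subset[of \<gamma>] subset by auto
  have \<psi>\<Omega>: "\<psi> \<in> \<Omega>"
    unfolding spectrum_def
  proof (intro CollectI conjI ballI allI impI)
    show "\<psi> \<in> J \<rightarrow>\<^sub>E {0, 1}" using D(6) preJ by (auto simp: \<psi>_def)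
    show "\<exists>S\<in>J. \<psi> S \<noteq> 0" using \<alpha>(2) preP \<psi>[of P] by (intro bexI[of _ P]) auto
    show "\<psi> (R \<inter> S) = \<psi> R * \<psi> S" if "R \<in> J" "S \<in> J" for R S
    proof -
      have "pre (R \<inter> S) = pre R \<inter> pre S" by (auto simp: pre_def)
      then show ?thesis using that by (simp add: \<psi> constructible_Int D(2) preJ)
    qed
    show "\<psi> {} = 0" if "{} \<in> J" using D(3)[OF that] \<psi>[OF that] by (simp add: pre_def)
    fix S F assume S: "S \<in> J" and F: "finite F \<and> F \<subseteq> J \<and> S = \<Union>F \<and> \<psi> S = 1"
    have "\<exists>R\<in>pre ` F. \<phi> R = 1"
    proof (rule D(4))
      show "pre S = \<Union>(pre ` F)" using F by (auto simp: pre_def)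
      show "\<phi> (pre S) = 1" using F \<psi>[OF S] by metis
    qed (use F preJ S in auto)
    then show "\<exists>R\<in>F. \<psi> R = 1" using F by (auto simp: \<psi> subset_iff)
  qed
  have eqn: "\<psi> (K \<beta>) = \<phi> (K (rev \<beta>))" if \<beta>: "\<beta> \<in> words P" "dot \<beta> = inv (dot \<alpha>)" for \<beta>
  proof -
    have "dot \<alpha> \<otimes> x \<in> K \<beta> \<longleftrightarrow> x \<in> K (rev \<beta>)" if "x \<in> carrier G" for x
      using word_K_rev_iff[of "rev \<beta>" x] \<beta> \<alpha> that by (simp add: word_dot_rev)
    then have "pre (K \<beta>) = K \<alpha> \<inter> K (rev \<beta>)"
      using Kc[OF \<alpha>(1)] by (auto simp: pre_def)
    then show ?thesis using \<beta> \<alpha> by (simp add: \<psi> D(2) constructibleI)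
  qed
  have dom: "\<psi> \<in> action_dom G P (inv (dot \<alpha>))"
    unfolding action_dom_def
  proof (intro CollectI conjI bexI[of _ "rev \<alpha>"])
    show "\<psi> (K (rev \<alpha>)) = 1" using eqn[of "rev \<alpha>"] \<alpha> by (simp add: word_dot_rev)
  qed (use \<alpha> \<psi>\<Omega> in \<open>auto simp: word_dot_rev\<close>)
  have "action_map G P (dot \<alpha>) \<phi> = \<psi>"
    unfolding action_map_def
  proof (rule the_equality)
    show "\<psi> \<in> action_dom G P (inv dot \<alpha>) \<and>
      (\<forall>\<beta>\<in>words P. dot \<beta> = inv dot \<alpha> \<longrightarrow> \<psi> (K \<beta>) = \<phi> (K (rev \<beta>)))"
      using dom eqn by blast
    fix \<psi>' assume \<psi>': "\<psi>' \<in> action_dom G P (inv dot \<alpha>) \<and>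
      (\<forall>\<beta>\<in>words P. dot \<beta> = inv dot \<alpha> \<longrightarrow> \<psi>' (K \<beta>) = \<phi> (K (rev \<beta>)))"
    then have \<psi>'\<Omega>: "\<psi>' \<in> \<Omega>" by (simp add: action_dom_def)
    have one: "\<theta> (K (rev \<alpha>)) = 1"
      if "\<forall>\<beta>\<in>words P. dot \<beta> = inv dot \<alpha> \<longrightarrow> \<theta> (K \<beta>) = \<phi> (K (rev \<beta>))" for \<theta> :: "'g set \<Rightarrow> nat"
      using that \<alpha> by (auto simp: word_dot_rev)
    \<comment> \<open>A character with value 1 at \<open>K (rev \<alpha>)\<close> takes the same
      value at \<open>S\<close> and at \<open>S \<inter> K (rev \<alpha>)\<close>, and the latter
      ideal belongs to a word of value \<open>inv (dot \<alpha>)\<close>, where the value is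
      prescribed.\<close>
    have det: "\<theta> S = \<phi> (K (rev (rev \<alpha> @ \<gamma>)))"
      if "\<theta> \<in> \<Omega>" "\<forall>\<beta>\<in>words P. dot \<beta> = inv dot \<alpha> \<longrightarrow> \<theta> (K \<beta>) = \<phi> (K (rev \<beta>))"
        "\<gamma> \<in> neutral" "S = K \<gamma>" for \<theta> S \<gamma>
    proof -
      have w: "rev \<alpha> @ \<gamma> \<in> words P" "dot (rev \<alpha> @ \<gamma>) = inv dot \<alpha>"
        using that \<alpha> by (auto simp: neutral_wordsD word_dot_append word_dot_rev)
      have "\<theta> (K (rev \<alpha> @ \<gamma>)) = \<theta> (K (rev \<alpha>)) * \<theta> S"
        using that \<alpha> by (simp add: word_K_append_neutral spectrumD(2) constructibleI neutral_wordsD)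
      then show ?thesis using one[OF that(2)] that(2) w by auto
    qed
    show "\<psi>' = \<psi>"
    proof (rule PiE_ext[of _ J "\<lambda>_. {0,1}"])
      show "\<psi>' \<in> J \<rightarrow>\<^sub>E {0, 1}" "\<psi> \<in> J \<rightarrow>\<^sub>E {0, 1}"
        using spectrumD(1) \<psi>\<Omega> \<psi>'\<Omega> by auto
      fix S assume "S \<in> J"
      then obtain \<gamma> where "\<gamma> \<in> neutral" "S = K \<gamma>" using constructible_neutral by blast
      then show "\<psi>' S = \<psi> S" using det[of \<psi>'] det[of \<psi>] \<psi>' \<psi>'\<Omega> \<psi>\<Omega> eqn by auto
    qed
  qed
  then show "action_map G P (dot \<alpha>) \<phi> S = \<phi> {x \<in> K \<alpha>. dot \<alpha> \<otimes> x \<in> S}"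
    "action_map G P (dot \<alpha>) \<phi> \<in> \<Omega>"
    using \<psi>[OF S] \<psi>\<Omega> by (auto simp: pre_def)
qed

text \<open>Being fixed means that a constructible ideal contains \<open>x\<close> iff it contains
  \<open>g \<otimes> x\<close>; it is enough to test this on the principal ideals of these two
  points.\<close>

lemma point_char_fixed:
  assumes x: "x \<in> P" and dom: "point_char x \<in> action_dom G P g"
    and fixd: "action_map G P g (point_char x) = point_char x"
  shows "g \<otimes> x \<in> P" "(g \<otimes> x) <# P = x <# P"
proof -
  obtain \<alpha> where \<alpha>: "\<alpha> \<in> words P" "dot \<alpha> = g" "point_char x (K \<alpha>) = 1"
    using dom by (auto simp: action_dom_def)
  have g: "g \<in> carrier G" using \<alpha> by auto
  have xK: "x \<in> K \<alpha>" using \<alpha> constructibleI[OF \<alpha>(1)] by (simp add: point_char_simp split: if_splits)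
  then show gx: "g \<otimes> x \<in> P" using word_K_dot_mem \<alpha> by blast
  have iff: "x \<in> S \<longleftrightarrow> g \<otimes> x \<in> S" if S: "S \<in> J" for S
  proof -
    have "point_char x S = point_char x {y \<in> K \<alpha>. dot \<alpha> \<otimes> y \<in> S}"
      using action_map_apply(1)[OF point_char_spectrum[OF x] \<alpha>(1,3) S] fixd \<alpha>(2) by simp
    then show ?thesis
      using S constructible_preimage[OF S \<alpha>(1)] xK \<alpha>(2) by (simp add: point_char_simp split: if_splits)
  qed
  show "(g \<otimes> x) <# P = x <# P"
    using iff[OF l_coset_constructible[OF x]] iff[OF l_coset_constructible[OF gx]] x gx g
    by (simp add: l_coset_eq_iff l_coset_self)
qed

lemma topspace_spectrum [simp]: "topspace (spectrum_topology G P) = \<Omega>"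
proof -
  have "\<Omega> \<subseteq> J \<rightarrow>\<^sub>E {0, 1}" using spectrumD(1) by blast
  then show ?thesis unfolding spectrum_topology_def by (simp add: Int_absorb1)
qed

text \<open>If no point agreed with \<open>\<phi>\<close>, the ideals of value 0 would cover the
  intersection of those of value 1, which \<open>spectrum_cover\<close> forbids. So characters of
  points are dense, and those close to \<open>\<phi>\<close> come from a whole basic set.\<close>

lemma finite_agreement_basic:
  assumes \<phi>: "\<phi> \<in> \<Omega>" and A: "finite A" "A \<subseteq> J"
  shows "\<exists>V. basic V \<and> V \<noteq> {} \<and> (\<forall>x\<in>V. \<forall>S\<in>A. point_char x S = \<phi> S)"
proof -
  define S where "S = P \<inter> \<Inter>{R \<in> A. \<phi> R = 1}"
  obtain Rs where Rs: "set Rs = {R \<in> A. \<phi> R = 0}"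
    using finite_list[of "{R \<in> A. \<phi> R = 0}"] A by auto
  have S: "S \<in> J" "\<phi> S = 1"
    unfolding S_def by (rule constructible_INT spectrum_INT[OF \<phi>]; use A in auto)+
  have "S - \<Union>(set Rs) \<noteq> {}"
  proof
    assume "S - \<Union>(set Rs) = {}"
    then have "\<exists>R\<in>set Rs. \<phi> R = 1" using S A Rs by (intro spectrum_cover[OF \<phi>, of S]) auto
    then show False using Rs by auto
  qed
  moreover have "point_char x R = \<phi> R" if "x \<in> S - \<Union>(set Rs)" "R \<in> A" for x R
    using that A spectrumD(6)[OF \<phi>, of R] Rs by (auto simp: point_char_simp S_def subset_iff)
  moreover have "basic (S - \<Union>(set Rs))"
    using S A Rs by (auto simp: basic_def intro!: bexI[of _ S] exI[of _ Rs])
  ultimately show ?thesis by blast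
qed

text \<open>An open set of fixed characters contains one that is cut out by finitely many ideals,
  hence the characters of all points of some nonempty basic set; under (3) one of these points is
  moved.\<close>

lemma topologically_free_carrier:
  assumes units_move_principal_ideals
  shows "action_topologically_free G P (carrier G)"
  unfolding action_topologically_free_def topologically_free_def
proof (intro ballI, rule ccontr)
  fix g assume g: "g \<in> carrier G - {\<one>}"
  let ?F = "{x \<in> action_dom G P g. action_map G P g x = x}"
  assume "spectrum_topology G P interior_of ?F \<noteq> {}"
  then obtain U \<phi> where U: "openin (spectrum_topology G P) U" "U \<subseteq> ?F" "\<phi> \<in> U"
    by (auto simp: interior_of_def)
  have \<phi>: "\<phi> \<in> \<Omega>" using U openin_subset by fastforce
  obtain W where W: "openin (product_topology (\<lambda>_. discrete_topology {0, 1::nat}) J) W" "U = W \<inter> \<Omega>"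
    using U(1) by (auto simp: spectrum_topology_def openin_subtopology)
  then obtain B where B: "finite {i \<in> J. B i \<noteq> {0, 1::nat}}" "\<phi> \<in> PiE J B" "PiE J B \<subseteq> W"
    using U(3) unfolding openin_product_topology_alt by fastforce
  obtain V where V: "basic V" "V \<noteq> {}"
    "\<And>x S. x \<in> V \<Longrightarrow> S \<in> J \<Longrightarrow> B S \<noteq> {0, 1} \<Longrightarrow> point_char x S = \<phi> S"
    using finite_agreement_basic[OF \<phi> B(1)] by auto
  obtain y where y: "y \<in> V" "g \<otimes> y \<notin> P \<or> (g \<otimes> y) <# P \<noteq> y <# P"
    using basic_moved_point[OF assms V(1,2), of g] g by blast
  have yP: "y \<in> P" using y V(1) constructible_subset by (auto simp: basic_def)
  have "point_char y S \<in> B S" if "S \<in> J" for S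
    using that V(3)[OF y(1) that] B(2) spectrumD(6)[OF point_char_spectrum[OF yP] that]
    by (cases "B S = {0, 1}") (auto simp: PiE_iff)
  then have "point_char y \<in> PiE J B"
    using spectrumD(1)[OF point_char_spectrum[OF yP]] by (auto simp: PiE_iff)
  then have "point_char y \<in> ?F" using B(3) W(2) U(2) point_char_spectrum[OF yP] by auto
  then show False using point_char_fixed[OF yP, of g] y by auto
qed

text \<open>If (3) fails for \<open>u\<close> and \<open>C\<close>, the characters that vanish on
  \<open>C\<close> form an open set. It contains the character of \<open>\<one>\<close>, as the
  ideals in \<open>C\<close> are proper, and \<open>u\<close> fixes it pointwise.\<close>

lemma units_move_of_topologically_free:
  assumes free: "action_topologically_free G P (unit_group G P)"
  shows units_move_principal_ideals
  unfolding units_move_principal_ideals_def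
proof (intro ballI allI impI, rule ccontr)
  fix u C assume u: "u \<in> unit_group G P - {\<one>}" and C: "finite C \<and> C \<subseteq> J - {P}"
    and "\<not> (\<exists>s\<in>P - \<Union>C. (u \<otimes> s) <# P \<noteq> s <# P)"
  then have fixd: "(u \<otimes> s) <# P = s <# P" if "s \<in> P" "s \<notin> \<Union>C" for s using that by blast
  have uP: "u \<in> P" using u by (simp add: unit_group_def)
  define U where "U = PiE J (\<lambda>R. if R \<in> C then {0::nat} else {0, 1}) \<inter> \<Omega>"
  have "openin (product_topology (\<lambda>_. discrete_topology {0, 1::nat}) J) (PiE J (\<lambda>R. if R \<in> C then {0} else {0, 1}))"
  proof (rule openin_product_topology_alt[THEN iffD2], intro ballI exI conjI)
    show "finite {i \<in> J. (if i \<in> C then {0::nat} else {0, 1}) \<noteq> topspace (discrete_topology {0, 1})}"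
      by (rule finite_subset[of _ C]) (use C in auto)
  qed auto
  then have "openin (spectrum_topology G P) U"
    unfolding spectrum_topology_def U_def openin_subtopology by blast
  moreover have "U \<subseteq> {x \<in> action_dom G P u. action_map G P u x = x}"
  proof
    fix \<phi> assume "\<phi> \<in> U"
    then have \<phi>: "\<phi> \<in> \<Omega>" and zero: "\<And>R. R \<in> C \<Longrightarrow> \<phi> R = 0"
      using C by (auto simp: U_def PiE_iff subset_iff split: if_splits)
    note word = word_K_unit_left[OF uP]
    have w: "[\<one>, u] \<in> words P" "\<phi> (K [\<one>, u]) = 1" using uP word spectrumD(5)[OF \<phi>] by auto
    have dom: "\<phi> \<in> action_dom G P u"
      unfolding action_dom_def using \<phi> w word(2) by blast
    have img: "action_map G P u \<phi> \<in> \<Omega>" and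
      app: "\<And>S. S \<in> J \<Longrightarrow> action_map G P u \<phi> S = \<phi> {x \<in> P. u \<otimes> x \<in> S}"
      using action_map_apply(2)[OF \<phi> w constructible_whole] action_map_apply(1)[OF \<phi> w]
      unfolding word by blast+
    \<comment> \<open>A character that vanishes on \<open>C\<close> does not notice the points of
      \<open>\<Union>C\<close>.\<close>
    have cover: "\<phi> T = 1" if "S \<in> J" "T \<in> J" "S - \<Union>C \<subseteq> T" "\<phi> S = 1" for S T
    proof -
      have "\<exists>R\<in>insert T C. \<phi> R = 1"
        using that C by (intro spectrum_cover[OF \<phi>, of S]) auto
      then show ?thesis using zero by auto
    qed
    have "action_map G P u \<phi> = \<phi>"
    proof (rule PiE_ext[OF spectrumD(1)[OF img] spectrumD(1)[OF \<phi>]])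
      fix S assume S: "S \<in> J"
      let ?T = "{x \<in> P. u \<otimes> x \<in> S}"
      have T: "?T \<in> J" by (rule constructible_translate[OF S uP])
      have "S - \<Union>C \<subseteq> ?T"
      proof
        fix s assume s: "s \<in> S - \<Union>C"
        have sP: "s \<in> P" using s S constructible_subset by auto
        then have "u \<otimes> s \<in> s <# P" using fixd[of s] s uP l_coset_self[of "u \<otimes> s"] by auto
        then show "s \<in> ?T" using sP s constructible_l_coset[OF S, of s] by blast
      qed
      moreover have "?T - \<Union>C \<subseteq> S"
      proof
        fix s assume s: "s \<in> ?T - \<Union>C"
        then have "s \<in> (u \<otimes> s) <# P" using fixd[of s] l_coset_self[of s] by auto
        then show "s \<in> S" using s constructible_l_coset[OF S, of "u \<otimes> s"] by blast
      qed
      ultimately have "\<phi> S = 1 \<longleftrightarrow> \<phi> ?T = 1" using cover[OF S T] cover[OF T S] by blast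
      then show "action_map G P u \<phi> S = \<phi> S"
        using app[OF S] spectrumD(6)[OF \<phi> S] spectrumD(6)[OF \<phi> T] by auto
    qed
    then show "\<phi> \<in> {x \<in> action_dom G P u. action_map G P u x = x}" using dom by simp
  qed
  moreover have "point_char \<one> \<in> U"
  proof -
    have "\<one> \<notin> R" if "R \<in> C" for R using that C constructible_eq_whole by auto
    then show ?thesis
      using C point_char_spectrum[of \<one>] spectrumD(1)[OF point_char_spectrum[of \<one>]]
      by (auto simp: U_def PiE_iff point_char_simp subset_iff)
  qed
  ultimately have "spectrum_topology G P interior_of {x \<in> action_dom G P u. action_map G P u x = x} \<noteq> {}"
    unfolding interior_of_def by blast
  then show False
    using free u unfolding action_topologically_free_def topologically_free_def by blast
qed

lemma topologically_free_iff:
  "action_topologically_free G P (carrier G) \<longleftrightarrow> units_move_principal_ideals"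
  "action_topologically_free G P (unit_group G P) \<longleftrightarrow> units_move_principal_ideals"
proof -
  have "unit_group G P \<subseteq> carrier G" using subset by (auto simp: unit_group_def)
  then have "action_topologically_free G P (carrier G) \<Longrightarrow> action_topologically_free G P (unit_group G P)"
    unfolding action_topologically_free_def topologically_free_def by blast
  then show "action_topologically_free G P (carrier G) \<longleftrightarrow> units_move_principal_ideals"
    "action_topologically_free G P (unit_group G P) \<longleftrightarrow> units_move_principal_ideals"
    using topologically_free_carrier units_move_of_topologically_free by blast+
qed

end


section \<open>Operators of partial bijections\<close>

text \<open>Partial bijections are kept as relations, so that composing and inverting them needs no
  bookkeeping of domains.\<close>

definition pbij :: "'g set \<Rightarrow> ('g \<times> 'g) set \<Rightarrow> bool" where
  "pbij X r \<longleftrightarrow> r \<subseteq> X \<times> X \<and> single_valued r \<and> single_valued (r\<inverse>)"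

text \<open>The partial isometry that sends the basis vector at \<open>x\<close> to that at
  \<open>y\<close> for each pair \<open>(x, y)\<close> in \<open>r\<close>, and the remaining basis
  vectors to 0.\<close>

definition pbij_op :: "'g set \<Rightarrow> ('g \<times> 'g) set \<Rightarrow> 'g operator" where
  "pbij_op X r = (\<lambda>f. if f \<in> ell2 X
     then (\<lambda>y. if y \<in> Range r then f (THE x. (x, y) \<in> r) else 0) else (\<lambda>x. 0))"

lemma pbij_converse: "pbij X r \<Longrightarrow> pbij X (r\<inverse>)"
  by (auto simp: pbij_def)

lemma pbij_relcomp: "pbij X r \<Longrightarrow> pbij X s \<Longrightarrow> pbij X (r O s)"
  unfolding pbij_def by (auto simp: converse_relcomp intro: single_valued_relcomp)

lemma pbij_the: "pbij X r \<Longrightarrow> (x, y) \<in> r \<Longrightarrow> (THE x. (x, y) \<in> r) = x"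
  by (rule the_equality) (auto simp: pbij_def single_valued_def)

lemma pbij_op_apply: "pbij X r \<Longrightarrow> f \<in> ell2 X \<Longrightarrow> (x, y) \<in> r \<Longrightarrow> pbij_op X r f y = f x"
  by (auto simp: pbij_op_def pbij_the)

lemma pbij_op_off: "y \<notin> Range r \<Longrightarrow> pbij_op X r f y = 0"
  by (auto simp: pbij_op_def)

lemma pbij_op_ell2:
  assumes r: "pbij X r" and f: "f \<in> ell2 X"
  shows "pbij_op X r f \<in> ell2 X" "ell2_norm X (pbij_op X r f) \<le> ell2_norm X f"
proof -
  have *: "L2_set (\<lambda>y. cmod (pbij_op X r f y)) F \<le> ell2_norm X f" if F: "finite F" "F \<subseteq> X" for F
  proof -
    let ?S = "F \<inter> Range r" and ?g = "\<lambda>y. THE x. (x, y) \<in> r"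
    have g: "(?g y, y) \<in> r" if "y \<in> ?S" for y
      using that pbij_the[OF r] by force
    have inj: "inj_on ?g ?S"
      using g r by (intro inj_onI) (metis pbij_def single_valued_def)
    have sub: "?g ` ?S \<subseteq> X" using g r by (auto simp: pbij_def)
    have "(\<Sum>y\<in>F. (cmod (pbij_op X r f y))\<^sup>2) = (\<Sum>y\<in>?S. (cmod (f (?g y)))\<^sup>2)"
      using F f by (intro sum.mono_neutral_cong_right) (auto simp: pbij_op_def)
    also have "\<dots> = (\<Sum>x\<in>?g ` ?S. (cmod (f x))\<^sup>2)" by (simp add: sum.reindex[OF inj])
    finally have "L2_set (\<lambda>y. cmod (pbij_op X r f y)) F = L2_set (\<lambda>x. cmod (f x)) (?g ` ?S)"
      by (simp add: L2_set_def)
    also have "\<dots> \<le> ell2_norm X f" using F sub by (intro ell2_L2_set[OF f]) auto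
    finally show ?thesis .
  qed
  have "pbij_op X r f y = 0" if "y \<notin> X" for y
    using that r by (intro pbij_op_off) (auto simp: pbij_def)
  then show "pbij_op X r f \<in> ell2 X" "ell2_norm X (pbij_op X r f) \<le> ell2_norm X f"
    using ell2_L2I[of X "pbij_op X r f", OF _ *] by auto
qed

lemma pbij_op_bounded:
  assumes r: "pbij X r" shows "pbij_op X r \<in> bounded_ops X"
proof (rule bounded_opsI[where C = 1])
  show "pbij_op X r (\<lambda>x. f x + g x) = (\<lambda>x. pbij_op X r f x + pbij_op X r g x)"
    if "f \<in> ell2 X" "g \<in> ell2 X" for f g
    using that by (auto simp: pbij_op_def ell2_add)
  show "pbij_op X r (\<lambda>x. c * f x) = (\<lambda>x. c * pbij_op X r f x)" if "f \<in> ell2 X" for c f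
    using that by (auto simp: pbij_op_def ell2_scale)
  show "pbij_op X r f = (\<lambda>x. 0)" if "f \<notin> ell2 X" for f
    using that by (simp add: pbij_op_def)
qed (use pbij_op_ell2[OF r] in auto)

text \<open>A sum over the pairs of \<open>r\<close> treats both arguments alike, so that passing to
  the adjoint amounts to swapping the pairs.\<close>

lemma pbij_op_inner:
  assumes r: "pbij X r" and f: "f \<in> ell2 X" and g: "g \<in> ell2 X"
  shows "ell2_inner X (pbij_op X r f) g = (\<Sum>\<^sub>\<infinity>(x, y)\<in>r. f x * cnj (g y))"
proof -
  have "ell2_inner X (pbij_op X r f) g = (\<Sum>\<^sub>\<infinity>y\<in>Range r. pbij_op X r f y * cnj (g y))"
    unfolding ell2_inner_def
    using r by (intro infsum_cong_neutral) (auto simp: pbij_op_off pbij_def)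
  also have "Range r = snd ` r" by force
  also have "(\<Sum>\<^sub>\<infinity>y\<in>snd ` r. pbij_op X r f y * cnj (g y))
      = infsum ((\<lambda>y. pbij_op X r f y * cnj (g y)) \<circ> snd) r"
    using r by (intro infsum_reindex inj_onI) (auto simp: pbij_def single_valued_def)
  also have "\<dots> = (\<Sum>\<^sub>\<infinity>(x, y)\<in>r. f x * cnj (g y))"
    by (intro infsum_cong) (auto simp: pbij_op_apply[OF r f])
  finally show ?thesis .
qed

lemma adjoint_pbij_op:
  assumes r: "pbij X r" shows "adjoint X (pbij_op X r) = pbij_op X (r\<inverse>)"
proof (rule adjoint_eqI)
  fix f g assume f: "f \<in> ell2 X" and g: "g \<in> ell2 X"
  have "ell2_inner X f (pbij_op X (r\<inverse>) g) = cnj (\<Sum>\<^sub>\<infinity>(x, y)\<in>r\<inverse>. g x * cnj (f y))"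
    using pbij_op_inner[OF pbij_converse[OF r] g f] by (metis cnj_ell2_inner)
  also have "\<dots> = (\<Sum>\<^sub>\<infinity>(x, y)\<in>r\<inverse>. f y * cnj (g x))"
    unfolding infsum_cnj[symmetric] by (intro infsum_cong) (auto simp: mult.commute)
  also have "\<dots> = (\<Sum>\<^sub>\<infinity>(x, y)\<in>r. f x * cnj (g y))"
  proof -
    have swap: "r\<inverse> = prod.swap ` r" by force
    show ?thesis unfolding swap by (subst infsum_reindex) (auto intro!: infsum_cong)
  qed
  finally show "ell2_inner X (pbij_op X r f) g = ell2_inner X f (pbij_op X (r\<inverse>) g)"
    using pbij_op_inner[OF r f g] by simp
qed (rule pbij_op_bounded[OF pbij_converse[OF r]])

lemma pbij_op_comp:
  assumes r: "pbij X r" and s: "pbij X s"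
  shows "pbij_op X s (pbij_op X r f) = pbij_op X (r O s) f"
proof (cases "f \<in> ell2 X")
  case True
  note rf = pbij_op_ell2(1)[OF r True]
  show ?thesis
  proof
    fix z
    show "pbij_op X s (pbij_op X r f) z = pbij_op X (r O s) f z"
    proof (cases "z \<in> Range s")
      case zs: True
      then obtain y where y: "(y, z) \<in> s" by blast
      then have 1: "pbij_op X s (pbij_op X r f) z = pbij_op X r f y" by (rule pbij_op_apply[OF s rf])
      show ?thesis
      proof (cases "y \<in> Range r")
        case True
        then obtain x where x: "(x, y) \<in> r" by blast
        then have "(x, z) \<in> r O s" using y by blast
        then show ?thesis
          using 1 x pbij_op_apply[OF r \<open>f \<in> ell2 X\<close> x] pbij_op_apply[OF pbij_relcomp[OF r s] \<open>f \<in> ell2 X\<close>] by simp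
      next
        case False
        have "z \<notin> Range (r O s)"
          using False y s unfolding pbij_def single_valued_def by blast
        then show ?thesis using 1 False by (simp add: pbij_op_off)
      qed
    next
      case False
      then show ?thesis by (subst (1 2) pbij_op_off) auto
    qed
  qed
next
  case False
  then have "pbij_op X r f = (\<lambda>x. 0)" "pbij_op X (r O s) f = (\<lambda>x. 0)" by (simp_all add: pbij_op_def)
  then show ?thesis using bounded_opsD(5)[OF pbij_op_bounded[OF s]] by simp
qed

lemma pbij_op_delta:
  assumes r: "pbij X r" and x: "x \<in> X"
  shows "(x, y) \<in> r \<Longrightarrow> pbij_op X r (ell2_delta x) = ell2_delta y"
    and "x \<notin> Domain r \<Longrightarrow> pbij_op X r (ell2_delta x) = (\<lambda>z. 0)"
proof -
  have *: "pbij_op X r (ell2_delta x) z = (if (x, z) \<in> r then 1 else 0)" for z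
  proof (cases "z \<in> Range r")
    case True
    then obtain x' where x': "(x', z) \<in> r" by blast
    then have "(x, z) \<in> r \<longleftrightarrow> x' = x" using r by (auto simp: pbij_def single_valued_def)
    then show ?thesis using pbij_op_apply[OF r ell2_delta(1)[OF x] x'] by (simp add: ell2_delta_def)
  qed (auto simp: pbij_op_off)
  show "pbij_op X r (ell2_delta x) = ell2_delta y" if "(x, y) \<in> r"
  proof
    fix z
    show "pbij_op X r (ell2_delta x) z = ell2_delta y z"
      using that r unfolding *[of z] by (auto simp: ell2_delta_def pbij_def single_valued_def)
  qed
  show "pbij_op X r (ell2_delta x) = (\<lambda>z. 0)" if "x \<notin> Domain r"
    using that by (intro ext) (auto simp: *)
qed

lemma pbij_op_Id_on:
  assumes "Y \<subseteq> X"
  shows "pbij_op X (Id_on Y) f = (if f \<in> ell2 X then (\<lambda>x. if x \<in> Y then f x else 0) else (\<lambda>x. 0))"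
proof -
  have "(THE x. x = y \<and> x \<in> Y) = y" if "y \<in> Y" for y using that by blast
  then show ?thesis by (auto simp: pbij_op_def Id_on_iff)
qed

section \<open>Toeplitz representations\<close>

text \<open>The map \<open>\<rho>\<close> collapses points generating the same principal right ideal:
  the identity gives the left regular representation, a choice of generators the representation on
  square-summable functions on the set of principal right ideals.\<close>

locale collapsed_representation = submonoid_in_group G P
  for G :: "('g, 'm) monoid_scheme" (structure) and P :: "'g set" +
  fixes \<rho> :: "'g \<Rightarrow> 'g"
  assumes \<rho>_closed: "x \<in> P \<Longrightarrow> \<rho> x \<in> P"
    and \<rho>_translate: "\<lbrakk>g \<in> carrier G; x \<in> P; y \<in> P; g \<otimes> x \<in> P; g \<otimes> y \<in> P; \<rho> x = \<rho> y\<rbrakk> \<Longrightarrow>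
      \<rho> (g \<otimes> x) = \<rho> (g \<otimes> y)"
    and \<rho>_l_coset: "\<lbrakk>x \<in> P; y \<in> P; \<rho> x = \<rho> y\<rbrakk> \<Longrightarrow> x <# P = y <# P"
begin

definition points :: "'g set" where "points = \<rho> ` P"

definition word_rel :: "'g list \<Rightarrow> ('g \<times> 'g) set" where
  "word_rel \<alpha> = (\<lambda>x. (\<rho> x, \<rho> (dot \<alpha> \<otimes> x))) ` K \<alpha>"

definition rep :: "'g \<Rightarrow> 'g operator" where
  "rep p = pbij_op points ((\<lambda>x. (\<rho> x, \<rho> (p \<otimes> x))) ` P)"

text \<open>The assumption \<open>\<rho>_translate\<close> makes the relation single-valued when
  used for \<open>g\<close>, and injective when used for \<open>inv g\<close>.\<close>

lemma pbij_image:
  assumes g: "g \<in> carrier G" and Y: "Y \<subseteq> P" "\<And>x. x \<in> Y \<Longrightarrow> g \<otimes> x \<in> P"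
  shows "pbij points ((\<lambda>x. (\<rho> x, \<rho> (g \<otimes> x))) ` Y)"
proof -
  have *: "\<rho> (g \<otimes> x) = \<rho> (g \<otimes> y)" if "x \<in> Y" "y \<in> Y" "\<rho> x = \<rho> y" for x y
    using \<rho>_translate[OF g, of x y] Y that by auto
  have inj: "\<rho> x = \<rho> y" if "x \<in> Y" "y \<in> Y" "\<rho> (g \<otimes> x) = \<rho> (g \<otimes> y)" for x y
  proof -
    have xy: "x \<in> P" "y \<in> P" using Y that by auto
    have "inv g \<otimes> (g \<otimes> z) = z" if "z \<in> P" for z using g that by (simp flip: m_assoc)
    then show ?thesis using \<rho>_translate[of "inv g" "g \<otimes> x" "g \<otimes> y"] g xy Y that by auto
  qed
  show ?thesis
    unfolding pbij_def single_valued_def points_def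
    using Y by (auto dest: * inj)
qed

lemma word_rel_pbij: "\<alpha> \<in> words P \<Longrightarrow> pbij points (word_rel \<alpha>)"
  unfolding word_rel_def using word_K_subset word_K_dot_mem by (intro pbij_image) auto

lemma gen_pbij: "p \<in> P \<Longrightarrow> pbij points ((\<lambda>x. (\<rho> x, \<rho> (p \<otimes> x))) ` P)"
  by (intro pbij_image) auto

text \<open>Composed relations see points only up to \<open>\<rho>\<close>, so the composite might
  be defined at more points than the word. It is not: if \<open>p \<otimes> v\<close> and
  \<open>q \<otimes> (dot \<alpha> \<otimes> x)\<close> have the same value under
  \<open>\<rho>\<close>, they generate the same principal ideal, so the latter lies in
  \<open>p <# P\<close> and the longer word is defined at \<open>x\<close> itself.\<close>

lemma word_rel_Cons:
  assumes pq: "p \<in> P" "q \<in> P" and \<alpha>: "\<alpha> \<in> words P"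
  shows "word_rel \<alpha> O (\<lambda>x. (\<rho> x, \<rho> (q \<otimes> x))) ` P O ((\<lambda>x. (\<rho> x, \<rho> (p \<otimes> x))) ` P)\<inverse>
    = word_rel (p # q # \<alpha>)"
proof (intro equalityI subsetI)
  have c: "p \<in> carrier G" "q \<in> carrier G" "dot \<alpha> \<in> carrier G" using assms by auto
  have assoc: "inv p \<otimes> q \<otimes> dot \<alpha> \<otimes> x = inv p \<otimes> (q \<otimes> (dot \<alpha> \<otimes> x))" if "x \<in> P" for x
    using c that by (simp add: m_assoc)
  {
    fix z assume "z \<in> word_rel \<alpha> O (\<lambda>x. (\<rho> x, \<rho> (q \<otimes> x))) ` P O ((\<lambda>x. (\<rho> x, \<rho> (p \<otimes> x))) ` P)\<inverse>"
    then obtain x y v where x: "x \<in> K \<alpha>" and y: "y \<in> P" "\<rho> y = \<rho> (dot \<alpha> \<otimes> x)"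
      and v: "v \<in> P" "\<rho> (p \<otimes> v) = \<rho> (q \<otimes> y)" and z: "z = (\<rho> x, \<rho> v)"
      unfolding word_rel_def by auto
    have xP: "x \<in> P" "dot \<alpha> \<otimes> x \<in> P" using x \<alpha> word_K_subset word_K_dot_mem by auto
    let ?s = "q \<otimes> (dot \<alpha> \<otimes> x)"
    have s: "?s \<in> P" "p \<otimes> v \<in> P" using xP pq v by auto
    have "\<rho> (p \<otimes> v) = \<rho> ?s"
      using v(2) \<rho>_translate[of q y "dot \<alpha> \<otimes> x"] y xP pq by simp
    then have eq: "p \<otimes> v <# P = ?s <# P" using \<rho>_l_coset s by blast
    then have "?s \<in> p \<otimes> v <# P" using l_coset_self s by simp
    then obtain r where r: "r \<in> P" "?s = p \<otimes> v \<otimes> r" by (auto simp: l_coset_def)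
    have "inv p \<otimes> ?s = v \<otimes> r" unfolding r(2) using pq v r(1) by (simp add: m_assoc) (simp flip: m_assoc)
    then have mem: "inv p \<otimes> ?s \<in> P" using v r by simp
    have "inv p \<otimes> (p \<otimes> v) = v" using pq v by (simp flip: m_assoc)
    then have "\<rho> v = \<rho> (inv p \<otimes> ?s)"
      using \<rho>_translate[of "inv p" "p \<otimes> v" ?s] s mem v \<open>\<rho> (p \<otimes> v) = \<rho> ?s\<close> pq by simp
    moreover have "x \<in> K (p # q # \<alpha>)" using x assms assoc xP mem by (simp add: word_K_Cons)
    ultimately show "z \<in> word_rel (p # q # \<alpha>)"
      unfolding z word_rel_def using assoc xP by auto
  }
  {
    fix z assume "z \<in> word_rel (p # q # \<alpha>)"
    then obtain x where x: "x \<in> K \<alpha>" "inv p \<otimes> q \<otimes> dot \<alpha> \<otimes> x \<in> P" "z = (\<rho> x, \<rho> (inv p \<otimes> q \<otimes> dot \<alpha> \<otimes> x))"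
      using assms by (auto simp: word_rel_def word_K_Cons)
    have xP: "x \<in> P" "dot \<alpha> \<otimes> x \<in> P" using x \<alpha> word_K_subset word_K_dot_mem by auto
    let ?s = "q \<otimes> (dot \<alpha> \<otimes> x)"
    have "p \<otimes> (inv p \<otimes> ?s) = ?s" using pq xP by (simp flip: m_assoc)
    moreover have "inv p \<otimes> ?s \<in> P" using x assoc xP by simp
    ultimately have "(\<rho> (inv p \<otimes> ?s), \<rho> ?s) \<in> (\<lambda>x. (\<rho> x, \<rho> (p \<otimes> x))) ` P"
      by (metis (mono_tags, lifting) image_eqI)
    moreover have "(\<rho> (dot \<alpha> \<otimes> x), \<rho> ?s) \<in> (\<lambda>x. (\<rho> x, \<rho> (q \<otimes> x))) ` P" using xP by auto
    moreover have "(\<rho> x, \<rho> (dot \<alpha> \<otimes> x)) \<in> word_rel \<alpha>" using x by (auto simp: word_rel_def)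
    ultimately show "z \<in> word_rel \<alpha> O (\<lambda>x. (\<rho> x, \<rho> (q \<otimes> x))) ` P O ((\<lambda>x. (\<rho> x, \<rho> (p \<otimes> x))) ` P)\<inverse>"
      unfolding x(3) assoc[OF xP(1)] by blast
  }
qed

lemma word_rel_neutral: "\<alpha> \<in> words P \<Longrightarrow> dot \<alpha> = \<one> \<Longrightarrow> word_rel \<alpha> = Id_on (\<rho> ` K \<alpha>)"
proof -
  assume \<alpha>: "\<alpha> \<in> words P" "dot \<alpha> = \<one>"
  have "x \<in> carrier G" if "x \<in> K \<alpha>" for x using that word_K_subset[OF \<alpha>(1)] subset by auto
  then show ?thesis using \<alpha> by (auto simp: word_rel_def Id_on_def image_iff)
qed

lemma word_eval_rep:
  "\<alpha> \<in> words P \<Longrightarrow> word_eval (bounded_operators points) rep \<alpha> = pbij_op points (word_rel \<alpha>)"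
proof (induction rule: words_induct)
  case Nil
  then show ?case
    using word_rel_neutral[of "[]"] pbij_op_Id_on[of points points] ell2_off[of _ points]
    by (auto simp: points_def intro!: ext)
next
  case (Cons p q \<alpha>)
  note pb = word_rel_pbij[OF Cons(3)] gen_pbij[OF Cons(2)] gen_pbij[OF Cons(1)]
  have "word_eval (bounded_operators points) rep (p # q # \<alpha>)
      = (\<lambda>f. adjoint points (rep p) (rep q (pbij_op points (word_rel \<alpha>) f)))"
    using Cons by simp
  also have "\<dots> = pbij_op points (word_rel (p # q # \<alpha>))"
    unfolding rep_def adjoint_pbij_op[OF pb(3)] pbij_op_comp[OF pb(1,2)]
      pbij_op_comp[OF pbij_relcomp[OF pb(1,2)] pbij_converse[OF pb(3)]]
    using word_rel_Cons[OF Cons(1-3)] by (simp add: O_assoc)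
  finally show ?case .
qed

text \<open>A constructible ideal contains the principal ideals of its points, so it is a union of
  fibres of \<open>\<rho>\<close>; the collapse loses no information about it.\<close>

lemma rho_mem_iff: "S \<in> J \<Longrightarrow> x \<in> P \<Longrightarrow> \<rho> x \<in> \<rho> ` S \<longleftrightarrow> x \<in> S"
proof safe
  fix y assume S: "S \<in> J" and "x \<in> P" "y \<in> S" "\<rho> x = \<rho> y"
  then have "x <# P = y <# P" using \<rho>_l_coset constructible_subset by blast
  then show "x \<in> S" using constructible_l_coset[OF S \<open>y \<in> S\<close>] l_coset_self[of x] \<open>x \<in> P\<close> by auto
qed auto

lemma word_eval_neutral_rep:
  assumes \<alpha>: "\<alpha> \<in> neutral" and f: "f \<in> ell2 points" and x: "x \<in> P"
  shows "word_eval (bounded_operators points) rep \<alpha> f (\<rho> x) = (if x \<in> K \<alpha> then f (\<rho> x) else 0)"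
proof -
  have "\<rho> ` K \<alpha> \<subseteq> points" using word_K_subset neutral_wordsD(1)[OF \<alpha>] by (auto simp: points_def)
  then show ?thesis
    using \<alpha> f x rho_mem_iff[OF constructibleI x]
    by (simp add: word_eval_rep neutral_wordsD word_rel_neutral pbij_op_Id_on)
qed

lemma rep_word: "p \<in> P \<Longrightarrow> rep p = word_eval (bounded_operators points) rep [\<one>, p]"
  by (subst word_eval_rep) (simp_all add: rep_def word_rel_def word_K_unit_left del: word_dot.simps)

lemma word_eval_rep_bounded: "\<alpha> \<in> words P \<Longrightarrow> word_eval (bounded_operators points) rep \<alpha> \<in> bounded_ops points"
  by (simp add: word_eval_rep pbij_op_bounded word_rel_pbij)

lemma bounded_ops_points_eqI:
  assumes "S \<in> bounded_ops points" "T \<in> bounded_ops points"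
    "\<And>f x. f \<in> ell2 points \<Longrightarrow> x \<in> P \<Longrightarrow> S f (\<rho> x) = T f (\<rho> x)"
  shows "S = T"
proof (intro ext)
  fix f y
  show "S f y = T f y"
  proof (cases "f \<in> ell2 points")
    case True
    then show ?thesis
      using assms(3)[OF True] ell2_off[OF bounded_ops_range[OF assms(1)], of y f] ell2_off[OF bounded_ops_range[OF assms(2)], of y f]
      by (cases "y \<in> points") (auto simp: points_def)
  qed (use bounded_opsD(4)[OF assms(1)] bounded_opsD(4)[OF assms(2)] in auto)
qed

text \<open>Neutral words act as multiplication by the indicator of \<open>K \<alpha>\<close>, which
  turns the relations into identities of indicator functions that can be checked point by
  point.\<close>

lemma toeplitz_relations_rep: "toeplitz_relations G P (bounded_operators points) rep"
proof -
  let ?B = "bounded_operators points"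
  note bdd = word_eval_rep_bounded[OF neutral_wordsD(1)]
  define F where "F \<alpha> \<beta>s = foldr (\<lambda>\<beta> x. (word_eval ?B rep \<alpha> \<ominus>\<^bsub>?B\<^esub> word_eval ?B rep \<beta>) \<otimes>\<^bsub>?B\<^esub> x) \<beta>s \<one>\<^bsub>?B\<^esub>"
    for \<alpha> \<beta>s
  have F_Nil: "F \<alpha> [] = \<one>\<^bsub>?B\<^esub>" for \<alpha> by (simp add: F_def)
  have F_Cons: "F \<alpha> (\<beta> # \<beta>s) = (\<lambda>f x. word_eval ?B rep \<alpha> (F \<alpha> \<beta>s f) x - word_eval ?B rep \<beta> (F \<alpha> \<beta>s f) x)"
    if "\<alpha> \<in> neutral" "\<beta> \<in> neutral" for \<alpha> \<beta> \<beta>s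
    using minus_bounded_operators[OF bdd[OF that(1)] bdd[OF that(2)]]
    by (simp add: F_def del: bounded_operators_simps(3))
  have foldr: "F \<alpha> \<beta>s \<in> bounded_ops points \<and> (\<forall>f\<in>ell2 points. \<forall>x\<in>P. F \<alpha> \<beta>s f (\<rho> x)
        = (\<Prod>\<beta>\<leftarrow>\<beta>s. (if x \<in> K \<alpha> then 1 else 0) - (if x \<in> K \<beta> then 1 else 0)) * f (\<rho> x))"
    if \<alpha>: "\<alpha> \<in> neutral" and "\<beta>s \<in> lists neutral" for \<alpha> \<beta>s
    using that(2)
  proof (induction \<beta>s)
    case Nil
    then show ?case using bounded_ops_one[of points] by (auto simp: F_Nil)
  next
    case (Cons \<beta> \<beta>s)
    then have IH: "F \<alpha> \<beta>s \<in> bounded_ops points" "\<And>f x. f \<in> ell2 points \<Longrightarrow> x \<in> P \<Longrightarrow> F \<alpha> \<beta>s f (\<rho> x)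
        = (\<Prod>\<beta>\<leftarrow>\<beta>s. (if x \<in> K \<alpha> then 1 else 0) - (if x \<in> K \<beta> then 1 else 0)) * f (\<rho> x)"
      by auto
    have "F \<alpha> (\<beta> # \<beta>s) \<in> bounded_ops points"
      using bounded_ops_mult(1)[OF bounded_ops_diff[OF bdd[OF \<alpha>] bdd[OF Cons.hyps(1)]] IH(1)]
      unfolding F_Cons[OF \<alpha> Cons.hyps(1)] .
    moreover have "F \<alpha> (\<beta> # \<beta>s) f (\<rho> x)
        = (\<Prod>\<beta>\<leftarrow>\<beta> # \<beta>s. (if x \<in> K \<alpha> then 1 else 0) - (if x \<in> K \<beta> then 1 else 0)) * f (\<rho> x)"
      if "f \<in> ell2 points" "x \<in> P" for f x
      unfolding F_Cons[OF \<alpha> Cons.hyps(1)]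
        word_eval_neutral_rep[OF \<alpha> bounded_ops_range[OF IH(1)] that(2)]
        word_eval_neutral_rep[OF Cons.hyps(1) bounded_ops_range[OF IH(1)] that(2)] IH(2)[OF that]
      by (simp add: algebra_simps)
    ultimately show ?case by blast
  qed
  show ?thesis
    unfolding toeplitz_relations_def
  proof (intro conjI ballI impI)
    show "rep \<in> P \<rightarrow> carrier ?B" using pbij_op_bounded[OF gen_pbij] by (auto simp: rep_def)
    have "rep \<one> = word_eval ?B rep []"
      using rep_word[of \<one>] word_eval_rep[of "[\<one>, \<one>]"] word_eval_rep[of "[]"] word_K_unit_left[of \<one>]
      by (simp add: word_rel_def del: word_eval.simps word_dot.simps) simp
    then show "rep \<one> = \<one>\<^bsub>?B\<^esub>" by simp
    fix \<alpha> assume \<alpha>: "\<alpha> \<in> neutral"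
    show "word_eval ?B rep \<alpha> = \<zero>\<^bsub>?B\<^esub>" if "K \<alpha> = {}"
      using bdd[OF \<alpha>] bounded_ops_zero[of points] that word_eval_neutral_rep[OF \<alpha>]
      by (intro bounded_ops_points_eqI) auto
    show "word_eval ?B rep \<alpha> = word_eval ?B rep \<beta>" if "\<beta> \<in> neutral" "K \<alpha> = K \<beta>" for \<beta>
      using bdd[OF \<alpha>] bdd[OF that(1)] that word_eval_neutral_rep[OF \<alpha>] word_eval_neutral_rep[OF that(1)]
      by (intro bounded_ops_points_eqI) auto
    fix \<beta>s assume \<beta>s: "\<beta>s \<in> lists neutral"
      "distinct \<beta>s \<and> \<beta>s \<noteq> [] \<and> K \<alpha> = (\<Union>\<beta>\<in>set \<beta>s. K \<beta>)"
    have "(\<Prod>\<beta>\<leftarrow>\<beta>s. (if x \<in> K \<alpha> then 1 else 0) - (if x \<in> K \<beta> then 1 else (0::complex))) = 0" for x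
    proof -
      \<comment> \<open>One vanishing factor suffices. A point of \<open>K \<alpha>\<close> lies in
        some \<open>K \<beta>\<close>; a point outside lies in none, and then any member of the list
        serves, so the list has to be nonempty.\<close>
      obtain \<beta> where "\<beta> \<in> set \<beta>s" "x \<in> K \<alpha> \<longleftrightarrow> x \<in> K \<beta>"
      proof (cases "x \<in> K \<alpha>")
        case False
        then show ?thesis using that[of "hd \<beta>s"] \<beta>s by auto
      qed (use \<beta>s that in auto)
      then show ?thesis by (auto simp: prod_list_zero_iff image_iff intro!: bexI[of _ \<beta>])
    qed
    then have "F \<alpha> \<beta>s = \<zero>\<^bsub>?B\<^esub>"
      using foldr[OF \<alpha> \<beta>s(1)] bounded_ops_zero[of points]
      by (intro bounded_ops_points_eqI) simp_all
    then show "foldr (\<lambda>\<beta> x. (word_eval ?B rep \<alpha> \<ominus>\<^bsub>?B\<^esub> word_eval ?B rep \<beta>) \<otimes>\<^bsub>?B\<^esub> x) \<beta>s \<one>\<^bsub>?B\<^esub> = \<zero>\<^bsub>?B\<^esub>"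
      by (simp only: F_def)
  qed
qed

lemma word_eval_rep_delta:
  assumes \<alpha>: "\<alpha> \<in> words P" and x: "x \<in> P"
  shows "word_eval (bounded_operators points) rep \<alpha> (ell2_delta (\<rho> x))
    = (if x \<in> K \<alpha> then ell2_delta (\<rho> (dot \<alpha> \<otimes> x)) else (\<lambda>_. 0))"
proof -
  have \<rho>x: "\<rho> x \<in> points" using x by (simp add: points_def)
  show ?thesis
  proof (cases "x \<in> K \<alpha>")
    case True
    then have "(\<rho> x, \<rho> (dot \<alpha> \<otimes> x)) \<in> word_rel \<alpha>" by (auto simp: word_rel_def)
    then show ?thesis
      using True pbij_op_delta(1)[OF word_rel_pbij[OF \<alpha>] \<rho>x] by (simp add: word_eval_rep[OF \<alpha>])
  next
    case False
    then have "\<rho> x \<notin> \<rho> ` K \<alpha>" using rho_mem_iff[OF constructibleI[OF \<alpha>] x] by simp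
    then have "\<rho> x \<notin> Domain (word_rel \<alpha>)" by (auto simp: word_rel_def)
    then show ?thesis
      using False pbij_op_delta(2)[OF word_rel_pbij[OF \<alpha>] \<rho>x] by (simp add: word_eval_rep[OF \<alpha>])
  qed
qed

end

section \<open>The two collapses: none at all, and by principal ideals\<close>

context submonoid_in_group
begin

lemma collapsed_id: "collapsed_representation G P (\<lambda>x. x)"
  by unfold_locales auto

lemma left_regular_rep:
  assumes p: "p \<in> P"
  shows "collapsed_representation.rep G P (\<lambda>x. x) p = left_regular G P p"
proof -
  interpret L: collapsed_representation G P "\<lambda>x. x" by (rule collapsed_id)
  have pts: "L.points = P" by (simp add: L.points_def)
  show ?thesis
  proof (intro ext)
    fix f y
    show "L.rep p f y = left_regular G P p f y"
    proof (cases "f \<in> ell2 P \<and> y \<in> p <# P")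
      case True
      then obtain x where x: "x \<in> P" "y = p \<otimes> x" by (auto simp: l_coset_def)
      then have "inv p \<otimes> y = x" using p by (simp flip: m_assoc)
      moreover have "L.rep p f y = f x"
        unfolding L.rep_def using L.gen_pbij[OF p] True x by (intro pbij_op_apply) (auto simp: pts)
      ultimately show ?thesis using True by (simp add: left_regular_def)
    next
      case False
      then show ?thesis
        by (auto simp: L.rep_def pbij_op_def left_regular_def pts l_coset_def)
    qed
  qed
qed

text \<open>Chosen generators stand for the principal ideals, so that the operators act on functions
  on \<open>'g\<close>, as the test algebras in \<open>universal_toeplitz_algebra\<close>
  require.\<close>

definition ideal_rep :: "'g \<Rightarrow> 'g" where
  "ideal_rep x = (SOME y. y \<in> P \<and> y <# P = x <# P)"

lemma ideal_rep: "x \<in> P \<Longrightarrow> ideal_rep x \<in> P \<and> ideal_rep x <# P = x <# P"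
  unfolding ideal_rep_def by (rule someI[of _ x]) simp

lemma ideal_rep_eq_iff: "x \<in> P \<Longrightarrow> y \<in> P \<Longrightarrow> ideal_rep x = ideal_rep y \<longleftrightarrow> x <# P = y <# P"
proof
  show "x <# P = y <# P" if "x \<in> P" "y \<in> P" "ideal_rep x = ideal_rep y"
    using ideal_rep[OF that(1)] ideal_rep[OF that(2)] that(3) by metis
qed (simp only: ideal_rep_def)

lemma l_coset_translate:
  assumes "g \<in> carrier G" "x \<in> carrier G" "y \<in> carrier G" "x <# P = y <# P"
  shows "(g \<otimes> x) <# P = (g \<otimes> y) <# P"
proof -
  have *: "(g \<otimes> z) <# P = (\<lambda>v. g \<otimes> v) ` (z <# P)" if "z \<in> carrier G" for z
  proof -
    have "g \<otimes> z \<otimes> p = g \<otimes> (z \<otimes> p)" if "p \<in> P" for p using assms(1) \<open>z \<in> carrier G\<close> that by (simp add: m_assoc)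
    then show ?thesis unfolding l_coset_def by auto
  qed
  show ?thesis using assms by (simp add: *)
qed

lemma collapsed_ideals: "collapsed_representation G P ideal_rep"
proof unfold_locales
  show "ideal_rep (g \<otimes> x) = ideal_rep (g \<otimes> y)"
    if "g \<in> carrier G" "x \<in> P" "y \<in> P" "g \<otimes> x \<in> P" "g \<otimes> y \<in> P" "ideal_rep x = ideal_rep y" for g x y
    using that l_coset_translate[of g x y] by (simp add: ideal_rep_eq_iff)
qed (auto simp: ideal_rep ideal_rep_eq_iff)

end


section \<open>Toeplitz families in C*-algebras\<close>

locale toeplitz_family = submonoid_in_group G P + A: unital_cstar_algebra A
  for G :: "('g, 'm) monoid_scheme" (structure) and P :: "'g set" and A :: "('a, 'n) cstar_scheme" +
  fixes w :: "'g \<Rightarrow> 'a"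
  assumes relations: "toeplitz_relations G P A w"
begin

abbreviation A_mult :: "'a \<Rightarrow> 'a \<Rightarrow> 'a" (infixl "\<cdot>" 70) where "x \<cdot> y \<equiv> x \<otimes>\<^bsub>A\<^esub> y"
abbreviation A_minus :: "'a \<Rightarrow> 'a \<Rightarrow> 'a" (infixl "\<ominus>\<^sub>A" 65) where "x \<ominus>\<^sub>A y \<equiv> x \<ominus>\<^bsub>A\<^esub> y"
abbreviation A_one :: "'a" ("\<one>\<^sub>A") where "\<one>\<^sub>A \<equiv> \<one>\<^bsub>A\<^esub>"
abbreviation A_zero :: "'a" ("\<zero>\<^sub>A") where "\<zero>\<^sub>A \<equiv> \<zero>\<^bsub>A\<^esub>"
abbreviation wt :: "'g list \<Rightarrow> 'a" where "wt \<equiv> word_eval A w"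

lemma gen_closed [simp]: "p \<in> P \<Longrightarrow> w p \<in> carrier A"
  and gen_one: "w \<one> = \<one>\<^sub>A"
  and wt_empty: "\<alpha> \<in> neutral \<Longrightarrow> K \<alpha> = {} \<Longrightarrow> wt \<alpha> = \<zero>\<^sub>A"
  and wt_cong: "\<alpha> \<in> neutral \<Longrightarrow> \<beta> \<in> neutral \<Longrightarrow> K \<alpha> = K \<beta> \<Longrightarrow> wt \<alpha> = wt \<beta>"
  and wt_cover: "\<alpha> \<in> neutral \<Longrightarrow> \<beta>s \<in> lists neutral \<Longrightarrow> distinct \<beta>s \<Longrightarrow> \<beta>s \<noteq> [] \<Longrightarrow>
      K \<alpha> = (\<Union>\<beta>\<in>set \<beta>s. K \<beta>) \<Longrightarrow> foldr (\<lambda>\<beta> x. (wt \<alpha> \<ominus>\<^sub>A wt \<beta>) \<cdot> x) \<beta>s \<one>\<^sub>A = \<zero>\<^sub>A"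
proof -
  note rel = relations[unfolded toeplitz_relations_def]
  show "p \<in> P \<Longrightarrow> w p \<in> carrier A" using rel by blast
  show "w \<one> = \<one>\<^sub>A" using rel by blast
  show "\<alpha> \<in> neutral \<Longrightarrow> K \<alpha> = {} \<Longrightarrow> wt \<alpha> = \<zero>\<^sub>A" using rel by blast
  show "\<alpha> \<in> neutral \<Longrightarrow> \<beta> \<in> neutral \<Longrightarrow> K \<alpha> = K \<beta> \<Longrightarrow> wt \<alpha> = wt \<beta>" using rel by blast
  show "foldr (\<lambda>\<beta> x. (wt \<alpha> \<ominus>\<^sub>A wt \<beta>) \<cdot> x) \<beta>s \<one>\<^sub>A = \<zero>\<^sub>A"
    if "\<alpha> \<in> neutral" "\<beta>s \<in> lists neutral" "distinct \<beta>s" "\<beta>s \<noteq> []" "K \<alpha> = (\<Union>\<beta>\<in>set \<beta>s. K \<beta>)"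
    using rel that by blast
qed

lemma wt_closed [simp]: "\<alpha> \<in> words P \<Longrightarrow> wt \<alpha> \<in> carrier A"
  by (induction rule: words_induct) (auto simp: A.adj_closed)

lemma wt_append: "\<alpha> \<in> words P \<Longrightarrow> \<beta> \<in> words P \<Longrightarrow> wt (\<alpha> @ \<beta>) = wt \<alpha> \<cdot> wt \<beta>"
  by (induction rule: words_induct) (auto simp: A.adj_closed A.m_assoc)

lemma wt_rev: "\<alpha> \<in> words P \<Longrightarrow> wt (rev \<alpha>) = adj A (wt \<alpha>)"
  by (induction rule: words_induct) (auto simp: wt_append A.adj_closed A.adj_mult A.adj_adj A.m_assoc)

lemma wt_gen: "p \<in> P \<Longrightarrow> wt [\<one>, p] = w p"
  by (simp add: gen_one)

text \<open>By \<open>wt_cong\<close> the choice of the word does not matter. In the left regular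
  representation this is multiplication by the indicator of \<open>S\<close>.\<close>

definition pr :: "'g set \<Rightarrow> 'a" where
  "pr S = wt (SOME \<alpha>. \<alpha> \<in> neutral \<and> K \<alpha> = S)"

lemma pr_word: assumes "\<alpha> \<in> neutral" shows "pr (K \<alpha>) = wt \<alpha>"
proof -
  have "(SOME \<beta>. \<beta> \<in> neutral \<and> K \<beta> = K \<alpha>) \<in> neutral \<and> K (SOME \<beta>. \<beta> \<in> neutral \<and> K \<beta> = K \<alpha>) = K \<alpha>"
    by (rule someI[of _ \<alpha>]) (simp add: assms)
  then show ?thesis unfolding pr_def using assms by (intro wt_cong) auto
qed

lemma pr_closed [simp]: "S \<in> J \<Longrightarrow> pr S \<in> carrier A"
  using constructible_neutral pr_word neutral_wordsD(1) wt_closed by metis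

lemma pr_adj: "S \<in> J \<Longrightarrow> adj A (pr S) = pr S"
  using constructible_neutral pr_word neutral_wordsD(1) wt_rev neutral_rev word_K_rev_neutral by metis

lemma pr_Int: "R \<in> J \<Longrightarrow> S \<in> J \<Longrightarrow> pr R \<cdot> pr S = pr (R \<inter> S)"
proof -
  assume "R \<in> J" "S \<in> J"
  then obtain \<alpha> \<beta> where "\<alpha> \<in> neutral" "R = K \<alpha>" "\<beta> \<in> neutral" "S = K \<beta>"
    using constructible_neutral by blast
  then show ?thesis
    by (simp add: pr_word wt_append[symmetric] neutral_wordsD word_K_append_neutral[symmetric] neutral_append)
qed

lemma pr_P: "pr P = \<one>\<^sub>A"
  using pr_word[of "[]"] by (simp add: neutral_words_def)

lemma pr_commute: "R \<in> J \<Longrightarrow> S \<in> J \<Longrightarrow> pr R \<cdot> pr S = pr S \<cdot> pr R"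
  by (simp add: pr_Int Int_commute)

text \<open>Carrying the commutation with all \<open>pr S\<close> along is what lets products of
  such projections be formed by induction.\<close>

definition cproj :: "'a \<Rightarrow> bool" where
  "cproj x \<longleftrightarrow> x \<in> carrier A \<and> adj A x = x \<and> x \<cdot> x = x \<and> (\<forall>S\<in>J. x \<cdot> pr S = pr S \<cdot> x)"

lemma cprojD: "cproj x \<Longrightarrow> x \<in> carrier A" "cproj x \<Longrightarrow> adj A x = x" "cproj x \<Longrightarrow> x \<cdot> x = x"
  "cproj x \<Longrightarrow> S \<in> J \<Longrightarrow> x \<cdot> pr S = pr S \<cdot> x"
  by (auto simp: cproj_def)

lemma cproj_pr: "S \<in> J \<Longrightarrow> cproj (pr S)"
  by (simp add: cproj_def pr_adj pr_Int Int_commute)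

lemma cproj_one: "cproj \<one>\<^sub>A"
  by (simp add: cproj_def)

lemma cproj_mult:
  assumes x: "cproj x" and y: "cproj y" and xy: "x \<cdot> y = y \<cdot> x" shows "cproj (x \<cdot> y)"
proof -
  note c = cprojD(1)[OF x] cprojD(1)[OF y]
  have "x \<cdot> y \<cdot> (x \<cdot> y) = x \<cdot> (y \<cdot> x) \<cdot> y" using c by (simp add: A.m_assoc)
  also have "\<dots> = (x \<cdot> x) \<cdot> (y \<cdot> y)" unfolding xy[symmetric] using c by (simp add: A.m_assoc)
  finally have "x \<cdot> y \<cdot> (x \<cdot> y) = x \<cdot> y" by (simp add: cprojD(3)[OF x] cprojD(3)[OF y])
  moreover have "x \<cdot> y \<cdot> pr S = pr S \<cdot> (x \<cdot> y)" if S: "S \<in> J" for S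
  proof -
    have "x \<cdot> y \<cdot> pr S = x \<cdot> (pr S \<cdot> y)" using c S by (simp add: A.m_assoc cprojD(4)[OF y S])
    also have "\<dots> = x \<cdot> pr S \<cdot> y" using c S by (simp add: A.m_assoc)
    also have "\<dots> = pr S \<cdot> (x \<cdot> y)" unfolding cprojD(4)[OF x S] using c S by (simp add: A.m_assoc)
    finally show ?thesis .
  qed
  ultimately show ?thesis
    using c xy by (simp add: cproj_def A.adj_mult cprojD(2)[OF x] cprojD(2)[OF y])
qed

lemma cproj_compl:
  assumes "cproj x" shows "cproj (\<one>\<^sub>A \<ominus>\<^sub>A x)"
  using cprojD[OF assms]
  by (simp add: cproj_def A.adj_add A.adj_minus a_minus_def A.l_distr A.r_distr A.l_minus A.r_minus A.r_neg)

text \<open>The product \<open>pr S \<cdot> compl Rs\<close> plays the role of the indicator function of \<open>S - \<Union>Rs\<close>.\<close>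

definition compl :: "'g set list \<Rightarrow> 'a" where
  "compl Rs = foldr (\<lambda>R x. (\<one>\<^sub>A \<ominus>\<^sub>A pr R) \<cdot> x) Rs \<one>\<^sub>A"

lemma compl_Nil [simp]: "compl [] = \<one>\<^sub>A"
  and compl_Cons: "compl (R # Rs) = (\<one>\<^sub>A \<ominus>\<^sub>A pr R) \<cdot> compl Rs"
  by (simp_all add: compl_def)

lemma cproj_compl_list: "set Rs \<subseteq> J \<Longrightarrow> cproj (compl Rs)"
proof (induction Rs)
  case (Cons R Rs)
  then have c: "cproj (compl Rs)" "R \<in> J" by auto
  have "(\<one>\<^sub>A \<ominus>\<^sub>A pr R) \<cdot> compl Rs = compl Rs \<cdot> (\<one>\<^sub>A \<ominus>\<^sub>A pr R)"
    using cprojD(1,4)[OF c(1)] c(2)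
    by (simp add: a_minus_def A.l_distr A.r_distr A.l_minus A.r_minus)
  then show ?case unfolding compl_Cons using c by (intro cproj_mult cproj_compl cproj_pr)
qed (simp add: cproj_one)

lemma compl_absorb: "set Rs \<subseteq> J \<Longrightarrow> R \<in> set Rs \<Longrightarrow> (\<one>\<^sub>A \<ominus>\<^sub>A pr R) \<cdot> compl Rs = compl Rs"
proof (induction Rs)
  case (Cons R' Rs)
  let ?p = "\<one>\<^sub>A \<ominus>\<^sub>A pr R" and ?p' = "\<one>\<^sub>A \<ominus>\<^sub>A pr R'"
  have RJ: "R \<in> J" "R' \<in> J" using Cons by auto
  have c: "?p \<in> carrier A" "?p' \<in> carrier A" "compl Rs \<in> carrier A"
    using cprojD(1)[OF cproj_compl_list] RJ Cons by auto
  show ?case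
  proof (cases "R = R'")
    case True
    then show ?thesis
      using c cprojD(3)[OF cproj_compl[OF cproj_pr[OF RJ(1)]]] by (simp add: compl_Cons A.m_assoc[symmetric])
  next
    case False
    have "?p \<cdot> ?p' = ?p' \<cdot> ?p"
      using RJ pr_commute[of R R'] by (simp add: a_minus_def A.l_distr A.r_distr A.l_minus A.r_minus A.minus_add A.a_ac)
    then have "?p \<cdot> compl (R' # Rs) = ?p' \<cdot> (?p \<cdot> compl Rs)"
      using c by (simp add: compl_Cons A.m_assoc[symmetric])
    then show ?thesis using Cons False by (simp add: compl_Cons)
  qed
qed simp

lemma compl_remdups: "set Rs \<subseteq> J \<Longrightarrow> compl (remdups Rs) = compl Rs"
  by (induction Rs) (auto simp: compl_Cons compl_absorb)

text \<open>Under \<open>pr S\<close> only the part of \<open>R\<close> inside \<open>S\<close>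
  matters. This replaces a cover of \<open>S\<close> by one whose union is exactly \<open>S\<close>,
  as the last Toeplitz relation demands.\<close>

lemma pr_compl_restrict:
  assumes S: "S \<in> J" shows "set Rs \<subseteq> J \<Longrightarrow> pr S \<cdot> compl (map ((\<inter>) S) Rs) = pr S \<cdot> compl Rs"
proof (induction Rs)
  case (Cons R Rs)
  let ?X = "compl (map ((\<inter>) S) Rs)" and ?Y = "compl Rs"
  have RJ: "R \<in> J" "S \<inter> R \<in> J" using Cons S constructible_Int by auto
  have mJ: "set (map ((\<inter>) S) Rs) \<subseteq> J" using Cons S constructible_Int by auto
  have c: "?X \<in> carrier A" "?Y \<in> carrier A"
    using cprojD(1)[OF cproj_compl_list[OF mJ]] cprojD(1)[OF cproj_compl_list, of Rs] Cons by auto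
  have move: "pr S \<cdot> (\<one>\<^sub>A \<ominus>\<^sub>A pr T) = (\<one>\<^sub>A \<ominus>\<^sub>A pr T) \<cdot> pr S" if "T \<in> J" for T
    using S that pr_commute[of S T] by (simp add: a_minus_def A.l_distr A.r_distr A.l_minus A.r_minus)
  have same: "pr S \<cdot> (\<one>\<^sub>A \<ominus>\<^sub>A pr (S \<inter> R)) = pr S \<cdot> (\<one>\<^sub>A \<ominus>\<^sub>A pr R)"
    using S RJ by (simp add: a_minus_def A.r_distr A.r_minus pr_Int flip: Int_assoc)
  have "pr S \<cdot> compl (map ((\<inter>) S) (R # Rs)) = pr S \<cdot> (\<one>\<^sub>A \<ominus>\<^sub>A pr (S \<inter> R)) \<cdot> ?X"
    using c S RJ by (simp add: compl_Cons A.m_assoc)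
  also have "\<dots> = (\<one>\<^sub>A \<ominus>\<^sub>A pr R) \<cdot> (pr S \<cdot> ?X)"
    unfolding same move[OF RJ(1)] using c S RJ by (simp add: A.m_assoc)
  also have "\<dots> = (\<one>\<^sub>A \<ominus>\<^sub>A pr R) \<cdot> pr S \<cdot> ?Y"
    using Cons c S RJ by (simp add: A.m_assoc)
  also have "\<dots> = pr S \<cdot> compl (R # Rs)"
    unfolding move[OF RJ(1), symmetric] using c S RJ by (simp add: compl_Cons A.m_assoc)
  finally show ?case .
qed simp

text \<open>Since \<open>pr S \<cdot> (pr S - pr R) = pr S \<cdot> (1 - pr R)\<close>,
  multiplication by \<open>pr S\<close> turns the product in the last Toeplitz relation into the
  product of complements.\<close>

lemma pr_cover_distinct:
  assumes S: "S \<in> J" and Rs: "set Rs \<subseteq> J" "distinct Rs" "Rs \<noteq> []" "S = \<Union>(set Rs)"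
  shows "pr S \<cdot> compl Rs = \<zero>\<^sub>A"
proof -
  obtain \<alpha> where \<alpha>: "\<alpha> \<in> neutral" "K \<alpha> = S" using S constructible_neutral by blast
  have "\<forall>R\<in>J. \<exists>\<beta>. \<beta> \<in> neutral \<and> K \<beta> = R" using constructible_neutral by blast
  then obtain c where c: "\<And>R. R \<in> J \<Longrightarrow> c R \<in> neutral" "\<And>R. R \<in> J \<Longrightarrow> K (c R) = R" by metis
  have wtc: "wt (c R) = pr R" if "R \<in> J" for R using pr_word[OF c(1)[OF that]] c(2)[OF that] by simp
  \<comment> \<open>The relation is stated for distinct words, and \<open>c\<close> picks one word
    for each ideal.\<close>
  have "inj_on c (set Rs)" using c(2) Rs(1) by (intro inj_on_inverseI[of _ K]) auto
  then have "foldr (\<lambda>\<beta> x. (wt \<alpha> \<ominus>\<^sub>A wt \<beta>) \<cdot> x) (map c Rs) \<one>\<^sub>A = \<zero>\<^sub>A"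
    using Rs c \<alpha> by (intro wt_cover) (auto simp: distinct_map subset_iff)
  moreover have "set Qs \<subseteq> J \<Longrightarrow> foldr (\<lambda>\<beta> x. (wt \<alpha> \<ominus>\<^sub>A wt \<beta>) \<cdot> x) (map c Qs) \<one>\<^sub>A \<in> carrier A \<and>
      pr S \<cdot> foldr (\<lambda>\<beta> x. (wt \<alpha> \<ominus>\<^sub>A wt \<beta>) \<cdot> x) (map c Qs) \<one>\<^sub>A = pr S \<cdot> compl Qs" for Qs
  proof (induction Qs)
    case (Cons R Qs)
    let ?F = "foldr (\<lambda>\<beta> x. (wt \<alpha> \<ominus>\<^sub>A wt \<beta>) \<cdot> x) (map c Qs) \<one>\<^sub>A"
    have RJ: "R \<in> J" using Cons by simp
    have F: "?F \<in> carrier A" "pr S \<cdot> ?F = pr S \<cdot> compl Qs" using Cons by auto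
    have X: "compl Qs \<in> carrier A" using cprojD(1)[OF cproj_compl_list] Cons by simp
    have unfold_F: "foldr (\<lambda>\<beta> x. (wt \<alpha> \<ominus>\<^sub>A wt \<beta>) \<cdot> x) (map c (R # Qs)) \<one>\<^sub>A = (pr S \<ominus>\<^sub>A pr R) \<cdot> ?F"
      using wtc[OF RJ] pr_word[OF \<alpha>(1)] \<alpha>(2) by simp
    have 1: "pr S \<cdot> (pr S \<ominus>\<^sub>A pr R) = (\<one>\<^sub>A \<ominus>\<^sub>A pr R) \<cdot> pr S"
      using S RJ by (simp add: a_minus_def A.l_distr A.r_distr A.l_minus A.r_minus pr_Int Int_commute)
    have 2: "(\<one>\<^sub>A \<ominus>\<^sub>A pr R) \<cdot> pr S = pr S \<cdot> (\<one>\<^sub>A \<ominus>\<^sub>A pr R)"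
      using S RJ by (simp add: a_minus_def A.l_distr A.r_distr A.l_minus A.r_minus pr_Int Int_commute)
    have "pr S \<cdot> ((pr S \<ominus>\<^sub>A pr R) \<cdot> ?F) = (\<one>\<^sub>A \<ominus>\<^sub>A pr R) \<cdot> (pr S \<cdot> ?F)"
      using S RJ F(1) by (simp add: A.m_assoc[symmetric] 1)
    also have "\<dots> = pr S \<cdot> compl (R # Qs)"
      unfolding F(2) compl_Cons using 2 S RJ X by (simp add: A.m_assoc[symmetric])
    finally show ?case unfolding unfold_F using S RJ F by simp
  qed simp
  ultimately show ?thesis using Rs(1) S by (metis A.r_null pr_closed)
qed

text \<open>Restriction to \<open>S\<close> and removal of repetitions bring a finite cover into the
  form of the relation. An empty cover means \<open>S = {}\<close>, which is the business of the
  relation for empty ideals.\<close>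

lemma pr_cover:
  assumes S: "S \<in> J" and Rs: "set Rs \<subseteq> J" "S \<subseteq> \<Union>(set Rs)"
  shows "pr S \<cdot> compl Rs = \<zero>\<^sub>A"
proof -
  let ?Qs = "remdups (map ((\<inter>) S) Rs)"
  have Q: "set (map ((\<inter>) S) Rs) \<subseteq> J" "S = \<Union>(set (map ((\<inter>) S) Rs))"
    using S Rs constructible_Int by auto
  have "pr S \<cdot> compl ?Qs = \<zero>\<^sub>A"
  proof (cases "Rs = []")
    case True
    then have "S = {}" using Rs by simp
    then obtain \<alpha> where "\<alpha> \<in> neutral" "K \<alpha> = {}" using S constructible_neutral by blast
    then have "pr S = \<zero>\<^sub>A" using wt_empty pr_word \<open>S = {}\<close> by metis
    then show ?thesis using True by simp
  next
    case False
    then have "?Qs \<noteq> []" by (metis map_is_Nil_conv remdups_eq_nil_iff)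
    then show ?thesis using Q S by (intro pr_cover_distinct) auto
  qed
  then show ?thesis using compl_remdups[OF Q(1)] pr_compl_restrict[OF S Rs(1)] by simp
qed

text \<open>A relation, because \<open>V\<close> can be written as such a difference in several
  ways; \<open>bas_absorb\<close>, used in both directions, shows that they all give the same
  \<open>h\<close>.\<close>

definition bas :: "'g set \<Rightarrow> 'a \<Rightarrow> bool" where
  "bas V h \<longleftrightarrow> (\<exists>S Rs. S \<in> J \<and> set Rs \<subseteq> J \<and> V = S - \<Union>(set Rs) \<and> h = pr S \<cdot> compl Rs)"

lemma bas_basic: "bas V h \<Longrightarrow> basic V"
  by (auto simp: bas_def basic_def)

lemma bas_subset: "bas V h \<Longrightarrow> V \<subseteq> P"
  using constructible_subset by (auto simp: bas_def)

lemma bas_cproj: assumes "bas V h" shows "cproj h"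
proof -
  obtain S Rs where "S \<in> J" "set Rs \<subseteq> J" "h = pr S \<cdot> compl Rs" using assms by (auto simp: bas_def)
  then show ?thesis
    using cprojD(4)[OF cproj_compl_list, of Rs S] by (auto intro!: cproj_mult cproj_pr cproj_compl_list)
qed

lemmas bas_closed = cprojD(1)[OF bas_cproj]
  and bas_adj = cprojD(2)[OF bas_cproj]
  and bas_idem = cprojD(3)[OF bas_cproj]

text \<open>Here the covering relations enter. As empty sets give zero, inclusions between sets of
  points turn into equations in \<open>A\<close>.\<close>

lemma bas_empty: "bas {} h \<Longrightarrow> h = \<zero>\<^sub>A"
  using pr_cover by (auto simp: bas_def)

lemma bas_pr: "S \<in> J \<Longrightarrow> bas S (pr S)"
  by (auto simp: bas_def intro!: exI[of _ S] exI[of _ "[]"])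

lemma bas_split:
  assumes h: "bas V h" and R: "R \<in> J"
  shows "bas (V \<inter> R) (h \<cdot> pr R)" "bas (V - R) (h \<cdot> (\<one>\<^sub>A \<ominus>\<^sub>A pr R))"
proof -
  obtain S Rs where S: "S \<in> J" "set Rs \<subseteq> J" "V = S - \<Union>(set Rs)" "h = pr S \<cdot> compl Rs"
    using h by (auto simp: bas_def)
  have X: "compl Rs \<in> carrier A" "compl Rs \<cdot> pr R = pr R \<cdot> compl Rs"
    using cprojD(1,4)[OF cproj_compl_list[OF S(2)]] R by auto
  have "h \<cdot> pr R = pr S \<cdot> pr R \<cdot> compl Rs" unfolding S(4) using X S R by (simp add: A.m_assoc)
  then have "h \<cdot> pr R = pr (S \<inter> R) \<cdot> compl Rs" by (simp add: pr_Int S R)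
  then show "bas (V \<inter> R) (h \<cdot> pr R)"
    unfolding bas_def using S R constructible_Int by (auto intro!: exI[of _ "S \<inter> R"] exI[of _ Rs])
  have "compl Rs \<cdot> (\<one>\<^sub>A \<ominus>\<^sub>A pr R) = (\<one>\<^sub>A \<ominus>\<^sub>A pr R) \<cdot> compl Rs"
    using X R by (simp add: a_minus_def A.l_distr A.r_distr A.l_minus A.r_minus)
  then have "h \<cdot> (\<one>\<^sub>A \<ominus>\<^sub>A pr R) = pr S \<cdot> compl (R # Rs)"
    unfolding S(4) compl_Cons using X S R by (simp add: A.m_assoc)
  then show "bas (V - R) (h \<cdot> (\<one>\<^sub>A \<ominus>\<^sub>A pr R))"
    unfolding bas_def using S R by (auto intro!: exI[of _ S] exI[of _ "R # Rs"])
qed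

lemma bas_disjoint: "bas V h \<Longrightarrow> R \<in> J \<Longrightarrow> V \<inter> R = {} \<Longrightarrow> h \<cdot> pr R = \<zero>\<^sub>A"
  using bas_split(1) bas_empty by metis

lemma bas_contained: assumes "bas V h" "R \<in> J" "V \<subseteq> R" shows "h \<cdot> pr R = h"
proof -
  have "h \<cdot> (\<one>\<^sub>A \<ominus>\<^sub>A pr R) = \<zero>\<^sub>A"
    using bas_split(2)[OF assms(1,2)] bas_empty assms(3) by (metis Diff_eq_empty_iff)
  then have "h \<ominus>\<^sub>A h \<cdot> pr R = \<zero>\<^sub>A"
    using bas_closed[OF assms(1)] assms(2) by (simp add: a_minus_def A.r_distr A.r_minus)
  then show ?thesis using bas_closed[OF assms(1)] assms(2) by simp
qed

lemma bas_absorb: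
  assumes h: "bas V h" and k: "bas W k" and VW: "V \<subseteq> W"
  shows "h \<cdot> k = h" "k \<cdot> h = h"
proof -
  obtain S Rs where S: "S \<in> J" "set Rs \<subseteq> J" "W = S - \<Union>(set Rs)" "k = pr S \<cdot> compl Rs"
    using k by (auto simp: bas_def)
  note hc = bas_closed[OF h]
  have "set Qs \<subseteq> set Rs \<Longrightarrow> h \<cdot> compl Qs = h" for Qs
  proof (induction Qs)
    case (Cons R Qs)
    then have R: "R \<in> J" "V \<inter> R = {}" using S VW by auto
    have X: "compl Qs \<in> carrier A" using cprojD(1)[OF cproj_compl_list] Cons S by auto
    have "h \<cdot> (\<one>\<^sub>A \<ominus>\<^sub>A pr R) = h"
      using hc R bas_disjoint[OF h R] by (simp add: a_minus_def A.r_distr A.r_minus)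
    then show ?case using Cons X hc R by (simp add: compl_Cons A.m_assoc[symmetric])
  qed (use hc in simp)
  moreover have "h \<cdot> pr S = h" using bas_contained[OF h S(1)] S VW by auto
  moreover have "compl Rs \<in> carrier A" using cprojD(1)[OF cproj_compl_list] S by auto
  ultimately show hk: "h \<cdot> k = h" unfolding S(4) using hc S by (simp add: A.m_assoc[symmetric])
  have "adj A (h \<cdot> k) = k \<cdot> h" using hc bas_closed[OF k] by (simp add: A.adj_mult bas_adj[OF h] bas_adj[OF k])
  then show "k \<cdot> h = h" using hk bas_adj[OF h] by simp
qed

section \<open>The span of the neutral words and its norm\<close>

abbreviation diag_span :: "'a set" where "diag_span \<equiv> cspan A (wt ` neutral)"

lemma wt_neutral_subset: "wt ` neutral \<subseteq> carrier A" "wt ` words P \<subseteq> carrier A"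
  using neutral_wordsD(1) by auto

lemma diag_span_props: "A.csubspace diag_span" "diag_span \<subseteq> closed_cspan A (wt ` neutral)"
  "\<And>x y. x \<in> diag_span \<Longrightarrow> y \<in> diag_span \<Longrightarrow> x \<cdot> y \<in> diag_span"
  "S \<in> J \<Longrightarrow> pr S \<in> diag_span" "\<one>\<^sub>A \<in> diag_span"
proof -
  show "A.csubspace diag_span" by (rule A.csubspace_cspan[OF wt_neutral_subset(1)])
  show "diag_span \<subseteq> closed_cspan A (wt ` neutral)"
    by (rule A.closed_cspan_props[OF wt_neutral_subset(1)])
  have "x \<cdot> y \<in> wt ` neutral" if xy: "x \<in> wt ` neutral" "y \<in> wt ` neutral" for x y
  proof -
    obtain \<alpha> \<beta> where "\<alpha> \<in> neutral" "\<beta> \<in> neutral" "x = wt \<alpha>" "y = wt \<beta>" using xy by blast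
    then show ?thesis using neutral_append[of \<alpha> \<beta>] wt_append[of \<alpha> \<beta>] neutral_wordsD(1) by force
  qed
  then show "\<And>x y. x \<in> diag_span \<Longrightarrow> y \<in> diag_span \<Longrightarrow> x \<cdot> y \<in> diag_span"
    by (rule A.cspan_mult[OF wt_neutral_subset(1)])
  have pr: "pr S \<in> diag_span" if "S \<in> J" for S
    using constructible_neutral[OF that] pr_word A.cspan_superset[of "wt ` neutral"] by auto
  then show "S \<in> J \<Longrightarrow> pr S \<in> diag_span" by blast
  show "\<one>\<^sub>A \<in> diag_span" using pr[of P] pr_P by simp
qed

lemma bas_diag: assumes "bas V h" shows "h \<in> diag_span"
proof -
  obtain S Rs where S: "S \<in> J" "set Rs \<subseteq> J" "h = pr S \<cdot> compl Rs" using assms by (auto simp: bas_def)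
  note D = A.csubspaceD[OF diag_span_props(1)]
  have "set Rs \<subseteq> J \<Longrightarrow> compl Rs \<in> diag_span"
  proof (induction Rs)
    case (Cons R Rs)
    then show ?case
      unfolding compl_Cons by (intro diag_span_props(3) D(5) diag_span_props(4,5)) auto
  qed (simp add: diag_span_props(5))
  then have "compl Rs \<in> diag_span" using S(2) .
  then show ?thesis unfolding S(3) by (rule diag_span_props(3)[OF diag_span_props(4)[OF S(1)]])
qed

definition diag_comm :: "'a set" where
  "diag_comm = {x \<in> carrier A. \<forall>S\<in>J. x \<cdot> pr S = pr S \<cdot> x}"

lemma diag_span_commutes: "diag_span \<subseteq> diag_comm"
proof (rule A.cspan_least)
  show "A.csubspace diag_comm"
    by (rule A.csubspaceI)
      (auto simp: diag_comm_def A.l_distr A.r_distr A.scl_mult_left A.scl_mult_right A.scl_closed)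
  have "wt \<alpha> \<in> diag_comm" if "\<alpha> \<in> neutral" for \<alpha>
    using cprojD(1,4)[OF cproj_pr[OF constructibleI[OF neutral_wordsD(1)[OF that]]]] pr_word[OF that]
    by (simp add: diag_comm_def)
  then show "wt ` neutral \<subseteq> diag_comm" by auto
qed

lemma diag_comm_mult:
  assumes "x \<in> diag_comm" "y \<in> diag_comm" shows "x \<cdot> y \<in> diag_comm"
proof -
  have "x \<cdot> y \<cdot> pr S = pr S \<cdot> (x \<cdot> y)" if S: "S \<in> J" for S
  proof -
    have c: "x \<in> carrier A" "y \<in> carrier A" "x \<cdot> pr S = pr S \<cdot> x" "y \<cdot> pr S = pr S \<cdot> y"
      using assms S by (auto simp: diag_comm_def)
    have "x \<cdot> y \<cdot> pr S = x \<cdot> (pr S \<cdot> y)" using c(1,2) S by (simp add: A.m_assoc c(4))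
    also have "\<dots> = (x \<cdot> pr S) \<cdot> y" using c(1,2) S by (simp add: A.m_assoc)
    also have "\<dots> = pr S \<cdot> (x \<cdot> y)" unfolding c(3) using c(1,2) S by (simp add: A.m_assoc)
    finally show ?thesis .
  qed
  then show ?thesis using assms by (simp add: diag_comm_def)
qed

text \<open>Splitting along one constructible ideal after another, always keeping the half on which the
  norm is attained, leads to a projection on which a diagonal element is a scalar of maximal modulus.\<close>

lemma diag_norm_attained:
  assumes a: "a \<in> diag_span"
  shows "\<exists>V h c. bas V h \<and> V \<noteq> {} \<and> a \<cdot> h = scl A c h \<and> nrm A a \<le> cmod c"
proof -
  \<comment> \<open>The extra element \<open>x\<close> makes \<open>Q\<close> a subspace: for a sum,
    the shrinkings for both summands watch the norm of the same \<open>x\<close>. At the end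
    \<open>x\<close> is \<open>a\<close> itself.\<close>
  define Q where "Q = {a \<in> carrier A. \<forall>x\<in>diag_comm. \<forall>V h. bas V h \<longrightarrow>
    (\<exists>V' h'. bas V' h' \<and> V' \<subseteq> V \<and> nrm A (x \<cdot> h) \<le> nrm A (x \<cdot> h') \<and> (\<exists>c. a \<cdot> h' = scl A c h'))}"
  have Qsub: "A.csubspace Q"
  proof (rule A.csubspaceI)
    have "\<exists>V' h'. bas V' h' \<and> V' \<subseteq> V \<and> nrm A (x \<cdot> h) \<le> nrm A (x \<cdot> h') \<and> (\<exists>c. \<zero>\<^sub>A \<cdot> h' = scl A c h')"
      if h: "bas V h" for x V h
      using h bas_closed[OF h] by (intro exI[of _ V] exI[of _ h] conjI exI[of _ 0]) auto
    then show "\<zero>\<^sub>A \<in> Q" unfolding Q_def by blast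
    fix a c assume a: "a \<in> Q"
    have ac: "a \<in> carrier A" using a by (simp add: Q_def)
    have "\<exists>V' h'. bas V' h' \<and> V' \<subseteq> V \<and> nrm A (x \<cdot> h) \<le> nrm A (x \<cdot> h') \<and> (\<exists>d. scl A c a \<cdot> h' = scl A d h')"
      if x: "x \<in> diag_comm" and h: "bas V h" for x V h
    proof -
      obtain V1 h1 d where 1: "bas V1 h1" "V1 \<subseteq> V" "nrm A (x \<cdot> h) \<le> nrm A (x \<cdot> h1)" "a \<cdot> h1 = scl A d h1"
        using a x h unfolding Q_def by blast
      have "scl A c a \<cdot> h1 = scl A (c * d) h1"
        using ac bas_closed[OF 1(1)] by (simp add: A.scl_mult_left 1(4) A.scl_scl)
      then show ?thesis using 1 by blast
    qed
    then show "scl A c a \<in> Q" using A.scl_closed[OF ac] unfolding Q_def by blast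
  next
    fix a b assume a: "a \<in> Q" and b: "b \<in> Q"
    have ab: "a \<in> carrier A" "b \<in> carrier A" using a b by (auto simp: Q_def)
    have "\<exists>V' h'. bas V' h' \<and> V' \<subseteq> V \<and> nrm A (x \<cdot> h) \<le> nrm A (x \<cdot> h') \<and> (\<exists>c. (a \<oplus>\<^bsub>A\<^esub> b) \<cdot> h' = scl A c h')"
      if x: "x \<in> diag_comm" and h: "bas V h" for x V h
    proof -
      obtain V1 h1 c where 1: "bas V1 h1" "V1 \<subseteq> V" "nrm A (x \<cdot> h) \<le> nrm A (x \<cdot> h1)" "a \<cdot> h1 = scl A c h1"
        using a x h unfolding Q_def by blast
      obtain V2 h2 d where 2: "bas V2 h2" "V2 \<subseteq> V1" "nrm A (x \<cdot> h1) \<le> nrm A (x \<cdot> h2)" "b \<cdot> h2 = scl A d h2"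
        using b x 1(1) unfolding Q_def by blast
      note cl = bas_closed[OF 1(1)] bas_closed[OF 2(1)] and abs = bas_absorb[OF 2(1) 1(1) 2(2)]
      have "a \<cdot> h2 = a \<cdot> h1 \<cdot> h2" using cl ab abs by (simp add: A.m_assoc)
      also have "\<dots> = scl A c h2" using cl abs 1(4) by (simp add: A.scl_mult_left)
      finally have "(a \<oplus>\<^bsub>A\<^esub> b) \<cdot> h2 = scl A (c + d) h2"
        using cl ab 2(4) by (simp add: A.l_distr A.scl_add_left)
      then show ?thesis using 1 2 by (intro exI[of _ V2] exI[of _ h2]) auto
    qed
    then show "a \<oplus>\<^bsub>A\<^esub> b \<in> Q" using ab by (auto simp: Q_def)
  qed (auto simp: Q_def)
  have "wt \<alpha> \<in> Q" if \<alpha>: "\<alpha> \<in> neutral" for \<alpha>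
  proof -
    define R where "R = K \<alpha>"
    have R: "R \<in> J" "wt \<alpha> = pr R"
      using constructibleI[OF neutral_wordsD(1)[OF \<alpha>]] pr_word[OF \<alpha>] by (auto simp: R_def)
    have "\<exists>V' h'. bas V' h' \<and> V' \<subseteq> V \<and> nrm A (x \<cdot> h) \<le> nrm A (x \<cdot> h') \<and> (\<exists>c. pr R \<cdot> h' = scl A c h')"
      if x: "x \<in> diag_comm" and h: "bas V h" for x V h
    proof -
      note hc = bas_closed[OF h] and split = bas_split[OF h R(1)]
      have xc: "x \<in> carrier A" using x by (simp add: diag_comm_def)
      have "x \<cdot> h \<in> diag_comm"
        using diag_comm_mult[OF x] bas_cproj[OF h] by (simp add: diag_comm_def cproj_def)
      then have comm: "pr R \<cdot> (x \<cdot> h) = x \<cdot> h \<cdot> pr R" using R by (simp add: diag_comm_def)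
      \<comment> \<open>The comparison is with the maximum of the two halves and not with their sum,
        so nothing is lost however many ideals are used.\<close>
      have max: "nrm A (x \<cdot> h) \<le> max (nrm A (x \<cdot> (h \<cdot> pr R))) (nrm A (x \<cdot> (h \<cdot> (\<one>\<^sub>A \<ominus>\<^sub>A pr R))))"
        using A.nrm_le_max_split[of "x \<cdot> h" "pr R", OF _ _ _ _ comm] xc hc R cprojD(2,3)[OF cproj_pr[OF R(1)]]
        by (simp add: A.m_assoc)
      have s1: "pr R \<cdot> (h \<cdot> pr R) = scl A 1 (h \<cdot> pr R)"
        using bas_absorb(2)[OF split(1) bas_pr[OF R(1)]] hc R by (simp add: A.scl_one)
      have "pr R \<cdot> (\<one>\<^sub>A \<ominus>\<^sub>A pr R) = \<zero>\<^sub>A"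
        using R cprojD(3)[OF cproj_pr[OF R(1)]] by (simp add: a_minus_def A.r_distr A.r_minus A.r_neg)
      moreover have "pr R \<cdot> (h \<cdot> (\<one>\<^sub>A \<ominus>\<^sub>A pr R)) = h \<cdot> (pr R \<cdot> (\<one>\<^sub>A \<ominus>\<^sub>A pr R))"
        using cprojD(4)[OF bas_cproj[OF h] R(1)] hc R by (simp add: A.m_assoc[symmetric])
      ultimately have s0: "pr R \<cdot> (h \<cdot> (\<one>\<^sub>A \<ominus>\<^sub>A pr R)) = scl A 0 (h \<cdot> (\<one>\<^sub>A \<ominus>\<^sub>A pr R))"
        using hc R by simp
      show ?thesis
      proof (cases "nrm A (x \<cdot> h) \<le> nrm A (x \<cdot> (h \<cdot> pr R))")
        case True
        then show ?thesis using split(1) s1 by (intro exI[of _ "V \<inter> R"] exI[of _ "h \<cdot> pr R"]) blast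
      next
        case False
        then have "nrm A (x \<cdot> h) \<le> nrm A (x \<cdot> (h \<cdot> (\<one>\<^sub>A \<ominus>\<^sub>A pr R)))" using max by linarith
        then show ?thesis using split(2) s0 by (intro exI[of _ "V - R"] exI[of _ "h \<cdot> (\<one>\<^sub>A \<ominus>\<^sub>A pr R)"]) blast
      qed
    qed
    then show ?thesis using R by (auto simp: Q_def)
  qed
  then have "diag_span \<subseteq> Q" by (intro A.cspan_least Qsub) auto
  then have aQ: "a \<in> Q" using a by blast
  have P1: "bas P \<one>\<^sub>A" using bas_pr[of P] pr_P by simp
  have ac: "a \<in> carrier A" using aQ by (simp add: Q_def)
  obtain V h c where h: "bas V h" "nrm A (a \<cdot> \<one>\<^sub>A) \<le> nrm A (a \<cdot> h)" "a \<cdot> h = scl A c h"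
    using aQ diag_span_commutes a P1 unfolding Q_def by blast
  have le: "nrm A a \<le> cmod c * nrm A h" using h ac bas_closed[OF h(1)] by (simp add: A.nrm_scl)
  show ?thesis
  proof (cases "V = {}")
    \<comment> \<open>The norm bound then forces \<open>a = 0\<close>, for which all of
      \<open>P\<close> with the scalar 0 does; the claim asks for a nonempty set.\<close>
    case True
    then have "h = \<zero>\<^sub>A" using bas_empty[of h] h(1) by simp
    then have "nrm A a = 0" using le A.nrm_nonneg[OF ac] by simp
    then have "a = \<zero>\<^sub>A" using ac A.nrm_eq_0 by simp
    moreover have "P \<noteq> {}" using one_closed by blast
    ultimately show ?thesis using P1 by (intro exI[of _ P] exI[of _ "\<one>\<^sub>A"] exI[of _ 0]) auto
  next
    case False
    have "nrm A h \<le> 1" using A.nrm_idem_le bas_closed bas_adj bas_idem h(1) by blast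
    then have "nrm A a \<le> cmod c" using le mult_left_le[of "nrm A h" "cmod c"] by simp
    then show ?thesis using h False by blast
  qed
qed

text \<open>Covariance: \<open>rev \<alpha> @ \<beta> @ \<alpha>\<close> is a neutral word whose
  domain is the preimage of \<open>K \<beta>\<close> under the partial translation of
  \<open>\<alpha>\<close>.\<close>

lemma wt_conj_pr:
  assumes \<alpha>: "\<alpha> \<in> words P" and S: "S \<in> J"
  shows "adj A (wt \<alpha>) \<cdot> (pr S \<cdot> wt \<alpha>) = pr {x \<in> K \<alpha>. dot \<alpha> \<otimes> x \<in> S}"
proof -
  obtain \<beta> where \<beta>: "\<beta> \<in> neutral" "S = K \<beta>" using S constructible_neutral by blast
  have w: "\<beta> @ \<alpha> \<in> words P" "dot (\<beta> @ \<alpha>) = dot \<alpha>"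
    using \<alpha> \<beta> by (auto simp: neutral_wordsD word_dot_append)
  have "dot (rev \<alpha> @ \<beta> @ \<alpha>) = \<one>" using \<alpha> w by (simp add: word_dot_append word_dot_rev)
  then have n: "rev \<alpha> @ \<beta> @ \<alpha> \<in> neutral" using \<alpha> w by (intro neutral_wordsI) auto
  have "x \<in> carrier G" if "x \<in> K \<alpha>" for x using that word_K_subset[OF \<alpha>] subset by auto
  then have "K (rev \<alpha> @ \<beta> @ \<alpha>) = {x \<in> K \<alpha>. dot \<alpha> \<otimes> x \<in> S}"
    using \<alpha> w \<beta> by (auto simp: word_K_append[of "rev \<alpha>" "\<beta> @ \<alpha>"] word_K_append[of \<beta> \<alpha>] neutral_wordsD word_K_rev_iff)
  then show ?thesis
    using pr_word[OF n] pr_word[OF \<beta>(1)] \<alpha> \<beta> w by (simp add: wt_append[of "rev \<alpha>"] wt_append[of \<beta>] wt_rev neutral_wordsD)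
qed

lemma zero_of_adj_mult: "x \<in> carrier A \<Longrightarrow> adj A x \<cdot> x = \<zero>\<^sub>A \<Longrightarrow> x = \<zero>\<^sub>A"
  using A.cstar_identity[of x] A.nrm_eq_0[of x] by simp

text \<open>Let \<open>x\<close> be the product in question and \<open>T\<close> the preimage of
  \<open>S\<close> under the word. By covariance \<open>adj A x \<cdot> x\<close> equals
  \<open>h \<cdot> pr T \<cdot> h\<close>, and \<open>h \<cdot> pr T\<close> vanishes as
  \<open>T\<close> misses \<open>V\<close>.\<close>

lemma pr_wt_bas_zero:
  assumes \<alpha>: "\<alpha> \<in> words P" and S: "S \<in> J" and h: "bas V h"
    and disj: "V \<inter> {x \<in> K \<alpha>. dot \<alpha> \<otimes> x \<in> S} = {}"
  shows "pr S \<cdot> (wt \<alpha> \<cdot> h) = \<zero>\<^sub>A"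
proof (rule zero_of_adj_mult)
  note cl = bas_closed[OF h] wt_closed[OF \<alpha>] pr_closed[OF S] A.adj_closed[OF wt_closed[OF \<alpha>]]
  note pr2 = cprojD(2,3)[OF cproj_pr[OF S]]
  have "adj A (pr S \<cdot> (wt \<alpha> \<cdot> h)) \<cdot> (pr S \<cdot> (wt \<alpha> \<cdot> h))
      = h \<cdot> adj A (wt \<alpha>) \<cdot> (pr S \<cdot> pr S) \<cdot> (wt \<alpha> \<cdot> h)"
    using cl by (simp add: A.adj_mult bas_adj[OF h] pr2(1) A.m_assoc)
  also have "\<dots> = h \<cdot> (adj A (wt \<alpha>) \<cdot> (pr S \<cdot> wt \<alpha>)) \<cdot> h"
    using cl by (simp add: pr2(2) A.m_assoc)
  also have "\<dots> = \<zero>\<^sub>A"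
    unfolding wt_conj_pr[OF \<alpha> S] bas_disjoint[OF h constructible_preimage[OF S \<alpha>] disj] using cl by simp
  finally show "adj A (pr S \<cdot> (wt \<alpha> \<cdot> h)) \<cdot> (pr S \<cdot> (wt \<alpha> \<cdot> h)) = \<zero>\<^sub>A" .
qed (use assms bas_closed in auto)

text \<open>The same computation for the complement of \<open>pr S\<close>: conjugated by the word
  it becomes \<open>pr (K \<alpha>) - pr T\<close> with \<open>T\<close> the preimage of
  \<open>S\<close>, and \<open>h\<close> annihilates this because \<open>V\<close> lies in both
  ideals.\<close>

lemma pr_wt_bas_absorb:
  assumes \<alpha>: "\<alpha> \<in> words P" and S: "S \<in> J" and h: "bas V h"
    and sub: "V \<subseteq> {x \<in> K \<alpha>. dot \<alpha> \<otimes> x \<in> S}"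
  shows "pr S \<cdot> (wt \<alpha> \<cdot> h) = wt \<alpha> \<cdot> h"
proof -
  note cl = bas_closed[OF h] wt_closed[OF \<alpha>] pr_closed[OF S] A.adj_closed[OF wt_closed[OF \<alpha>]]
  let ?q = "\<one>\<^sub>A \<ominus>\<^sub>A pr S"
  have q: "?q \<in> carrier A" "adj A ?q = ?q" "?q \<cdot> ?q = ?q"
    using cprojD(1-3)[OF cproj_compl[OF cproj_pr[OF S]]] by auto
  have KJ: "K \<alpha> = {x \<in> K \<alpha>. dot \<alpha> \<otimes> x \<in> P}" using word_K_dot_mem[OF \<alpha>] by auto
  have "adj A (wt \<alpha>) \<cdot> (\<one>\<^sub>A \<cdot> wt \<alpha>) = pr (K \<alpha>)"
    using wt_conj_pr[OF \<alpha> constructible_whole] KJ pr_P by simp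
  then have e1: "adj A (wt \<alpha>) \<cdot> (?q \<cdot> wt \<alpha>) = pr (K \<alpha>) \<ominus>\<^sub>A pr {x \<in> K \<alpha>. dot \<alpha> \<otimes> x \<in> S}"
    using wt_conj_pr[OF \<alpha> S] cl by (simp add: a_minus_def A.l_distr A.r_distr A.l_minus A.r_minus)
  have VK: "V \<subseteq> K \<alpha>" using sub by blast
  have e2: "h \<cdot> (pr (K \<alpha>) \<ominus>\<^sub>A pr {x \<in> K \<alpha>. dot \<alpha> \<otimes> x \<in> S}) = \<zero>\<^sub>A"
    using bas_contained[OF h constructible_preimage[OF S \<alpha>] sub] bas_contained[OF h constructibleI[OF \<alpha>] VK]
      cl constructible_preimage[OF S \<alpha>] constructibleI[OF \<alpha>]
    by (simp add: a_minus_def A.r_distr A.r_minus A.r_neg)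
  have "adj A (?q \<cdot> (wt \<alpha> \<cdot> h)) \<cdot> (?q \<cdot> (wt \<alpha> \<cdot> h)) = h \<cdot> adj A (wt \<alpha>) \<cdot> (?q \<cdot> ?q) \<cdot> (wt \<alpha> \<cdot> h)"
    using cl q(1) by (simp add: A.adj_mult bas_adj[OF h] q(2) A.m_assoc)
  also have "\<dots> = h \<cdot> (adj A (wt \<alpha>) \<cdot> (?q \<cdot> wt \<alpha>)) \<cdot> h"
    unfolding q(3) using cl q(1) by (simp add: A.m_assoc)
  also have "\<dots> = \<zero>\<^sub>A" unfolding e1 e2 using cl by simp
  finally have "?q \<cdot> (wt \<alpha> \<cdot> h) = \<zero>\<^sub>A"
    by (rule zero_of_adj_mult[rotated]) (use cl q(1) in simp)
  then have "wt \<alpha> \<cdot> h \<ominus>\<^sub>A pr S \<cdot> (wt \<alpha> \<cdot> h) = \<zero>\<^sub>A"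
    using cl by (simp add: a_minus_def A.l_distr A.l_minus)
  then show ?thesis using cl by simp
qed

end


section \<open>Ideals that do not meet the diagonal\<close>

lemma bounded_ops_zeroI:
  assumes T: "T \<in> bounded_ops X" and 0: "\<And>x. x \<in> X \<Longrightarrow> T (ell2_delta x) = (\<lambda>_. 0)"
  shows "T = (\<lambda>f x. 0)"
proof (intro ext)
  fix f x
  note TD = bounded_opsD[OF T]
  show "T f x = 0"
  proof (cases "f \<in> ell2 X")
    case True
    have bd: "cmod (T g x) \<le> opnorm X T * ell2_norm X g" if "g \<in> ell2 X" for g
      using ell2_component[OF TD(1)[OF that], of x] opnorm_bound[OF T that] by linarith
    have "((\<lambda>y. f y * T (ell2_delta y) x) has_sum T f x) X"
      using ell2_functional_has_sum(1)[of X "\<lambda>g. T g x", OF _ _ bd True] TD by simp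
    then have "T f x = (\<Sum>\<^sub>\<infinity>y\<in>X. f y * T (ell2_delta y) x)" by (simp add: infsumI)
    also have "\<dots> = 0" using 0 by (intro infsum_0) simp
    finally show ?thesis .
  qed (simp add: TD(4))
qed

locale represented_family = toeplitz_family G P A w + collapsed_representation G P \<rho>
  for G :: "('g, 'm) monoid_scheme" (structure) and P :: "'g set" and A :: "('a, 'n) cstar_scheme"
    and w :: "'g \<Rightarrow> 'a" and \<rho> :: "'g \<Rightarrow> 'g" +
  fixes L :: "'a \<Rightarrow> 'g operator"
  assumes L_hom: "L \<in> star_hom A (bounded_operators points)"
    and L_gen: "p \<in> P \<Longrightarrow> L (w p) = rep p"
begin

sublocale L: cstar_hom A "bounded_operators points" L
  by (intro cstar_hom.intro cstar_hom_axioms.intro A.unital_cstar_algebra_axioms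
      unital_cstar_algebra_bounded_operators L_hom)

lemma L_closed: "x \<in> carrier A \<Longrightarrow> L x \<in> bounded_ops points"
  using L.f_simps(1) by simp

lemma L_mult: "x \<in> carrier A \<Longrightarrow> y \<in> carrier A \<Longrightarrow> L (x \<cdot> y) f = L x (L y f)"
  using L.f_simps(3) by simp

lemma L_wt: "\<alpha> \<in> words P \<Longrightarrow> L (wt \<alpha>) = word_eval (bounded_operators points) rep \<alpha>"
proof (induction rule: words_induct)
  case Nil
  then show ?case using L.f_simps(4) by simp
next
  case (Cons p q \<alpha>)
  then show ?case
    using L.f_simps(3)[of "adj A (w p) \<cdot> w q" "wt \<alpha>"] L.f_simps(3)[of "adj A (w p)" "w q"] L.f_simps(6)[of "w p"]
    by (simp add: A.adj_closed L_gen)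
qed

lemma rho_points: "x \<in> P \<Longrightarrow> \<rho> x \<in> points"
  by (simp add: points_def)

lemma L_wt_delta:
  "\<alpha> \<in> words P \<Longrightarrow> x \<in> P \<Longrightarrow> L (wt \<alpha>) (ell2_delta (\<rho> x))
    = (if x \<in> K \<alpha> then ell2_delta (\<rho> (dot \<alpha> \<otimes> x)) else (\<lambda>_. 0))"
  by (simp add: L_wt word_eval_rep_delta)

lemma L_pr_delta:
  assumes "S \<in> J" "x \<in> P"
  shows "L (pr S) (ell2_delta (\<rho> x)) = (if x \<in> S then ell2_delta (\<rho> x) else (\<lambda>_. 0))"
proof -
  obtain \<alpha> where \<alpha>: "\<alpha> \<in> neutral" "S = K \<alpha>" using assms constructible_neutral by blast
  then show ?thesis
    using L_wt_delta[OF neutral_wordsD(1)[OF \<alpha>(1)] assms(2)] pr_word[OF \<alpha>(1)] assms(2)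
    by (simp add: neutral_wordsD)
qed

lemma L_minus_apply:
  "x \<in> carrier A \<Longrightarrow> y \<in> carrier A \<Longrightarrow> L (x \<ominus>\<^sub>A y) f = (\<lambda>z. L x f z - L y f z)"
  using L.f_diff[of x y] minus_bounded_operators[OF L_closed L_closed, of x y] by simp

lemma L_one_apply: "f \<in> ell2 points \<Longrightarrow> L \<one>\<^sub>A f = f"
  using L.f_simps(4) by simp

lemma L_zero_vector: "x \<in> carrier A \<Longrightarrow> L x (\<lambda>_. 0) = (\<lambda>_. 0)"
  using bounded_opsD(5)[OF L_closed] .

lemma L_compl_delta:
  assumes x: "x \<in> P"
  shows "set Rs \<subseteq> J \<Longrightarrow> L (compl Rs) (ell2_delta (\<rho> x)) = (if x \<in> \<Union>(set Rs) then (\<lambda>_. 0) else ell2_delta (\<rho> x))"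
proof (induction Rs)
  case Nil
  then show ?case by (simp add: L_one_apply rho_points x)
next
  case (Cons R Rs)
  have c: "compl Rs \<in> carrier A" "\<one>\<^sub>A \<ominus>\<^sub>A pr R \<in> carrier A" "pr R \<in> carrier A" "R \<in> J"
    using cprojD(1)[OF cproj_compl_list, of Rs] Cons by auto
  have "L (compl (R # Rs)) (ell2_delta (\<rho> x)) = L (\<one>\<^sub>A \<ominus>\<^sub>A pr R) (L (compl Rs) (ell2_delta (\<rho> x)))"
    using c by (simp add: compl_Cons L_mult)
  also have "\<dots> = (if x \<in> \<Union>(set (R # Rs)) then (\<lambda>_. 0) else ell2_delta (\<rho> x))"
  proof (cases "x \<in> \<Union>(set Rs)")
    case True
    then show ?thesis using Cons L_zero_vector[OF c(2)] by simp
  next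
    case False
    then show ?thesis
      using Cons c L_pr_delta[OF c(4) x]
      by (simp add: L_minus_apply L_one_apply rho_points x)
  qed
  finally show ?case .
qed

lemma L_bas_delta:
  assumes h: "bas V h" and x: "x \<in> P"
  shows "L h (ell2_delta (\<rho> x)) = (if x \<in> V then ell2_delta (\<rho> x) else (\<lambda>_. 0))"
proof -
  obtain S Rs where S: "S \<in> J" "set Rs \<subseteq> J" "V = S - \<Union>(set Rs)" "h = pr S \<cdot> compl Rs"
    using h by (auto simp: bas_def)
  have "compl Rs \<in> carrier A" using cprojD(1)[OF cproj_compl_list[OF S(2)]] .
  then show ?thesis
    unfolding S(4) using S L_compl_delta[OF x S(2)] L_pr_delta[OF S(1) x] L_zero_vector[OF pr_closed[OF S(1)]]
    by (simp add: L_mult)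
qed

lemma bas_nonzero: "bas V h \<Longrightarrow> V \<noteq> {} \<Longrightarrow> h \<noteq> \<zero>\<^sub>A"
proof
  assume h: "bas V h" "V \<noteq> {}" "h = \<zero>\<^sub>A"
  then obtain x where x: "x \<in> V" "x \<in> P" using bas_subset by blast
  have "ell2_delta (\<rho> x) = (\<lambda>_. 0)"
    using L_bas_delta[OF h(1) x(2)] x h(3) L.f_zero by simp
  then have "ell2_delta (\<rho> x) (\<rho> x) = 0" by (rule fun_cong)
  then show False by (simp add: ell2_delta_def)
qed

text \<open>On the span \<open>L\<close> is isometric: a diagonal element acts on the basis vector
  of a suitable point as a scalar of maximal modulus. Injectivity on the closure follows by
  approximation. The collapse \<open>\<rho>\<close> does not interfere, as it respects the sets
  \<open>V\<close>.\<close>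

lemma L_faithful_on_diagonal:
  assumes d: "d \<in> closed_cspan A (wt ` neutral)" and Ld: "L d = (\<lambda>f x. 0)"
  shows "d = \<zero>\<^sub>A"
proof -
  have dc: "d \<in> carrier A" using d A.in_closed_cspan_iff[OF wt_neutral_subset(1)] by blast
  have "nrm A d \<le> 0 + e" if "e > 0" for e
  proof -
    obtain a where a: "a \<in> diag_span" "nrm A (d \<ominus>\<^sub>A a) < e / 2"
      using d \<open>e > 0\<close> unfolding A.in_closed_cspan_iff[OF wt_neutral_subset(1)] by (meson half_gt_zero)
    have ac: "a \<in> carrier A" using a A.csubspaceD(1)[OF diag_span_props(1)] by blast
    obtain V h c where h: "bas V h" "V \<noteq> {}" "a \<cdot> h = scl A c h" "nrm A a \<le> cmod c"
      using diag_norm_attained[OF a(1)] by blast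
    obtain y where y: "y \<in> V" "y \<in> P" using h bas_subset by blast
    let ?\<delta> = "ell2_delta (\<rho> y)"
    have hd: "L h ?\<delta> = ?\<delta>" using L_bas_delta[OF h(1) y(2)] y(1) by simp
    have "L a ?\<delta> = L (a \<cdot> h) ?\<delta>" using L_mult[OF ac bas_closed[OF h(1)]] hd by simp
    also have "\<dots> = (\<lambda>z. c * ?\<delta> z)" unfolding h(3) using L.f_simps(5)[OF bas_closed[OF h(1)]] hd by simp
    finally have "L (a \<ominus>\<^sub>A d) ?\<delta> = (\<lambda>z. c * ?\<delta> z)" using ac dc by (simp add: L_minus_apply Ld)
    then have "cmod c = ell2_norm points (L (a \<ominus>\<^sub>A d) ?\<delta>)"
      using ell2_scale(2)[of ?\<delta> points c] rho_points[OF y(2)] by simp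
    also have "\<dots> \<le> opnorm points (L (a \<ominus>\<^sub>A d)) * 1"
      using opnorm_bound[OF L_closed[of "a \<ominus>\<^sub>A d"], of ?\<delta>] ac dc rho_points[OF y(2)] by simp
    also have "\<dots> \<le> nrm A (a \<ominus>\<^sub>A d)" using L.contractive[of "a \<ominus>\<^sub>A d"] ac dc by simp
    finally show ?thesis
      using h(4) a(2) A.nrm_le_diff[OF dc ac] A.nrm_minus_commute[OF dc ac] by linarith
  qed
  then have "nrm A d \<le> 0" by (rule field_le_epsilon)
  then show ?thesis using A.nrm_eq_0[OF dc] A.nrm_nonneg[OF dc] by simp
qed

end

locale regular_family = represented_family G P A w "\<lambda>x. x" L
  for G :: "('g, 'm) monoid_scheme" (structure) and P :: "'g set" and A :: "('a, 'n) cstar_scheme"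
    and w :: "'g \<Rightarrow> 'a" and L :: "'a \<Rightarrow> 'g operator" +
  assumes words_dense: "carrier A \<subseteq> closed_cspan A (wt ` words P)"
begin

lemma points_P: "points = P"
  by (simp add: points_def)

text \<open>A diagonal matrix coefficient; it takes the place of a conditional expectation onto the
  diagonal.\<close>

definition ev :: "'a \<Rightarrow> 'g \<Rightarrow> complex" where
  "ev a x = L a (ell2_delta x) x"

lemma ev_add: "a \<in> carrier A \<Longrightarrow> b \<in> carrier A \<Longrightarrow> ev (a \<oplus>\<^bsub>A\<^esub> b) x = ev a x + ev b x"
  using L.f_simps(2) by (simp add: ev_def)

lemma ev_scl: "a \<in> carrier A \<Longrightarrow> ev (scl A c a) x = c * ev a x"
  using L.f_simps(5) by (simp add: ev_def)

lemma ev_diff: "a \<in> carrier A \<Longrightarrow> b \<in> carrier A \<Longrightarrow> ev (a \<ominus>\<^sub>A b) x = ev a x - ev b x"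
  by (simp add: ev_def L_minus_apply)

lemma ev_bound:
  assumes "a \<in> carrier A" "x \<in> P" shows "cmod (ev a x) \<le> nrm A a"
proof -
  have \<delta>: "ell2_delta x \<in> ell2 points" "ell2_norm points (ell2_delta x) = 1"
    using assms(2) by (auto simp: points_P)
  have "cmod (ev a x) \<le> ell2_norm points (L a (ell2_delta x))"
    unfolding ev_def by (intro ell2_component bounded_ops_range[OF L_closed[OF assms(1)]])
  also have "\<dots> \<le> opnorm points (L a)" using opnorm_bound[OF L_closed[OF assms(1)] \<delta>(1)] \<delta>(2) by simp
  also have "\<dots> \<le> nrm A a" by (rule L.contractive[OF assms(1)])
  finally show ?thesis .
qed

text \<open>Without collapse, cancellation in \<open>G\<close> lets a word return \<open>x\<close>
  to itself only if its value is the identity.\<close>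

lemma ev_wt:
  assumes "\<alpha> \<in> words P" "x \<in> P"
  shows "ev (wt \<alpha>) x = (if x \<in> K \<alpha> \<and> dot \<alpha> = \<one> then 1 else 0)"
proof -
  have "dot \<alpha> \<otimes> x = x \<longleftrightarrow> dot \<alpha> = \<one>" using assms by (simp add: l_cancel_one r_cancel_one')
  then show ?thesis using L_wt_delta[OF assms] by (auto simp: ev_def ell2_delta_def)
qed

text \<open>If \<open>V\<close> lies in \<open>K \<alpha>\<close>, then \<open>\<alpha>\<close> moves the principal ideal of some \<open>y \<in> V\<close>; cutting \<open>V\<close> down to
  \<open>y <# P\<close> and then by one of the two ideals that tell \<open>y\<close> from its image makes \<open>V\<close> disjoint from its translate.\<close>

lemma compress_word:
  assumes cond: units_move_principal_ideals
    and \<alpha>: "\<alpha> \<in> words P" "dot \<alpha> \<noteq> \<one>" and h: "bas V h" "V \<noteq> {}"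
  shows "\<exists>W k. bas W k \<and> W \<subseteq> V \<and> W \<noteq> {} \<and> k \<cdot> wt \<alpha> \<cdot> k = \<zero>\<^sub>A"
proof -
  have KJ: "K \<alpha> \<in> J" by (rule constructibleI[OF \<alpha>(1)])
  have wc: "wt \<alpha> \<in> carrier A" using \<alpha>(1) by simp
  show ?thesis
  proof (cases "V \<subseteq> K \<alpha>")
    case False
    \<comment> \<open>At points outside \<open>K \<alpha>\<close> the word is undefined, so
      \<open>wt \<alpha>\<close> kills their projection.\<close>
    let ?W = "V - K \<alpha>" and ?k = "h \<cdot> (\<one>\<^sub>A \<ominus>\<^sub>A pr (K \<alpha>))"
    have k: "bas ?W ?k" by (rule bas_split(2)[OF h(1) KJ])
    have "pr P \<cdot> (wt \<alpha> \<cdot> ?k) = \<zero>\<^sub>A"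
      by (rule pr_wt_bas_zero[OF \<alpha>(1) constructible_whole k]) auto
    then have "wt \<alpha> \<cdot> ?k = \<zero>\<^sub>A" using wc bas_closed[OF k] by (simp add: pr_P)
    then have "?k \<cdot> wt \<alpha> \<cdot> ?k = \<zero>\<^sub>A" using wc bas_closed[OF k] by (simp add: A.m_assoc)
    then show ?thesis using k False by (intro exI[of _ ?W] exI[of _ ?k]) auto
  next
    case True
    obtain y where y: "y \<in> V" "dot \<alpha> \<otimes> y \<notin> P \<or> (dot \<alpha> \<otimes> y) <# P \<noteq> y <# P"
      using basic_moved_point[OF cond bas_basic[OF h(1)] h(2) _ \<alpha>(2)] \<alpha>(1) by auto
    let ?gy = "dot \<alpha> \<otimes> y"
    have yP: "y \<in> P" using y h bas_subset by blast
    have gyP: "?gy \<in> P" using word_K_dot_mem[OF \<alpha>(1)] y True by blast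
    then have ne: "?gy \<notin> y <# P \<or> y \<notin> ?gy <# P"
      using y(2) l_coset_eq_iff[of ?gy y] yP \<alpha>(1) by auto
    have yJ: "y <# P \<in> J" "?gy <# P \<in> J" using yP gyP by (auto intro: l_coset_constructible)
    have y_self: "y \<in> y <# P" "?gy \<in> ?gy <# P" using yP gyP l_coset_self by auto
    define V1 where "V1 = V \<inter> (y <# P)"
    define h1 where "h1 = h \<cdot> pr (y <# P)"
    have h1: "bas V1 h1" unfolding V1_def h1_def by (rule bas_split(1)[OF h(1) yJ(1)])
    have y1: "y \<in> V1" using y y_self by (simp add: V1_def)
    \<comment> \<open>The ideal \<open>T\<close> tells a set from its translate: \<open>pr T\<close>
      put between \<open>k\<close> and \<open>wt \<alpha> \<cdot> k\<close> is absorbed on one side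
      and gives zero on the other.\<close>
    have finish: ?thesis if k: "bas W k" "y \<in> W" "W \<subseteq> V1" and T: "T \<in> J" "k \<cdot> pr T \<cdot> (wt \<alpha> \<cdot> k) = k \<cdot> (wt \<alpha> \<cdot> k)"
      "k \<cdot> pr T = \<zero>\<^sub>A \<or> pr T \<cdot> (wt \<alpha> \<cdot> k) = \<zero>\<^sub>A" for W k T
    proof -
      have kc: "k \<in> carrier A" "pr T \<in> carrier A" using bas_closed[OF k(1)] T by auto
      have "k \<cdot> pr T \<cdot> (wt \<alpha> \<cdot> k) = \<zero>\<^sub>A" 
      proof (cases "k \<cdot> pr T = \<zero>\<^sub>A")
        case False
        then have "pr T \<cdot> (wt \<alpha> \<cdot> k) = \<zero>\<^sub>A" using T(3) by blast
        then show ?thesis using kc wc by (simp add: A.m_assoc[of k "pr T"])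
      qed (use kc wc in simp)
      then have "k \<cdot> wt \<alpha> \<cdot> k = \<zero>\<^sub>A" using T(2) kc wc by (simp add: A.m_assoc)
      then show ?thesis using k by (intro exI[of _ W] exI[of _ k]) (auto simp: V1_def)
    qed
    show ?thesis
    proof (cases "?gy \<in> y <# P")
      case False
      \<comment> \<open>Remove the points that are moved into \<open>y <# P\<close>. What is left
        lies in \<open>y <# P\<close> but is moved off it, and \<open>y\<close> survives because its
        image is not in \<open>y <# P\<close>.\<close>
      define R where "R = {x \<in> K \<alpha>. dot \<alpha> \<otimes> x \<in> y <# P}"
      have R: "R \<in> J" unfolding R_def by (rule constructible_preimage[OF yJ(1) \<alpha>(1)])
      let ?W = "V1 - R" and ?k = "h1 \<cdot> (\<one>\<^sub>A \<ominus>\<^sub>A pr R)"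
      have k: "bas ?W ?k" by (rule bas_split(2)[OF h1 R])
      have 1: "?k \<cdot> pr (y <# P) = ?k" by (rule bas_contained[OF k yJ(1)]) (auto simp: V1_def)
      have 2: "pr (y <# P) \<cdot> (wt \<alpha> \<cdot> ?k) = \<zero>\<^sub>A"
        by (rule pr_wt_bas_zero[OF \<alpha>(1) yJ(1) k]) (auto simp: R_def)
      show ?thesis
        by (rule finish[OF k _ _ yJ(1)]) (use y1 False 1 2 in \<open>auto simp: R_def\<close>)
    next
      case True
      then have ny: "y \<notin> ?gy <# P" using ne by blast
      \<comment> \<open>Now the remaining points avoid \<open>?gy <# P\<close>, while every point of
        \<open>y <# P\<close> at which the word is defined is moved into it.\<close>
      let ?W = "V1 - (?gy <# P)" and ?k = "h1 \<cdot> (\<one>\<^sub>A \<ominus>\<^sub>A pr (?gy <# P))"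
      have k: "bas ?W ?k" by (rule bas_split(2)[OF h1 yJ(2)])
      have 1: "?k \<cdot> pr (?gy <# P) = \<zero>\<^sub>A" by (rule bas_disjoint[OF k yJ(2)]) auto
      have 2: "pr (?gy <# P) \<cdot> (wt \<alpha> \<cdot> ?k) = wt \<alpha> \<cdot> ?k"
      proof (rule pr_wt_bas_absorb[OF \<alpha>(1) yJ(2) k], rule subsetI)
        fix x assume x: "x \<in> ?W"
        then obtain p where p: "p \<in> P" "x = y \<otimes> p" by (auto simp: V1_def l_coset_def)
        then have "dot \<alpha> \<otimes> x = ?gy \<otimes> p" using yP \<alpha>(1) by (simp add: m_assoc)
        then show "x \<in> {x \<in> K \<alpha>. dot \<alpha> \<otimes> x \<in> ?gy <# P}"
          using x p \<open>V \<subseteq> K \<alpha>\<close> by (auto simp: V1_def l_coset_def)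
      qed
      have kc: "?k \<in> carrier A" "pr (?gy <# P) \<in> carrier A" using bas_closed[OF k] yJ by auto
      have 3: "?k \<cdot> pr (?gy <# P) \<cdot> (wt \<alpha> \<cdot> ?k) = ?k \<cdot> (wt \<alpha> \<cdot> ?k)"
        using A.m_assoc[OF kc A.m_closed[OF wc kc(1)]] 2 by simp
      show ?thesis
        by (rule finish[OF k _ _ yJ(2) 3]) (use y1 ny 1 in auto)
    qed
  qed
qed

text \<open>The quantification over all smaller nonempty sets lets several summands be compressed
  one after the other.\<close>

definition compressible_at :: "'a \<Rightarrow> complex \<Rightarrow> 'g set \<Rightarrow> bool" where
  "compressible_at a c V0 \<longleftrightarrow> (\<forall>V1 h1. bas V1 h1 \<longrightarrow> V1 \<subseteq> V0 \<longrightarrow> V1 \<noteq> {} \<longrightarrow>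
    (\<exists>V2 h2. bas V2 h2 \<and> V2 \<subseteq> V1 \<and> V2 \<noteq> {} \<and> h2 \<cdot> a \<cdot> h2 = scl A c h2))"

text \<open>The set \<open>V0\<close> has to keep \<open>x\<close>, which ties the scalar to
  \<open>ev a x\<close>; the sets \<open>V2\<close> inside it may lose \<open>x\<close>.\<close>

definition compressible :: "'a set" where
  "compressible = {a \<in> carrier A. \<forall>V h x. bas V h \<longrightarrow> x \<in> V \<longrightarrow>
    (\<exists>V0 h0. bas V0 h0 \<and> x \<in> V0 \<and> V0 \<subseteq> V \<and> compressible_at a (ev a x) V0)}"

lemma compressible_atE:
  assumes "compressible_at a c V0" "bas V1 h1" "V1 \<subseteq> V0" "V1 \<noteq> {}"
  obtains V2 h2 where "bas V2 h2" "V2 \<subseteq> V1" "V2 \<noteq> {}" "h2 \<cdot> a \<cdot> h2 = scl A c h2"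
  using assms unfolding compressible_at_def by blast

lemma compressible_atI:
  assumes "\<And>V1 h1. bas V1 h1 \<Longrightarrow> V1 \<subseteq> V0 \<Longrightarrow> V1 \<noteq> {} \<Longrightarrow>
    \<exists>V2 h2. bas V2 h2 \<and> V2 \<subseteq> V1 \<and> V2 \<noteq> {} \<and> h2 \<cdot> a \<cdot> h2 = scl A c h2"
  shows "compressible_at a c V0"
  unfolding compressible_at_def using assms by blast

lemma compressible_carrier: "a \<in> compressible \<Longrightarrow> a \<in> carrier A"
  by (simp add: compressible_def)

lemma compressibleE:
  assumes "a \<in> compressible" "bas V h" "x \<in> V"
  obtains V0 h0 where "bas V0 h0" "x \<in> V0" "V0 \<subseteq> V" "compressible_at a (ev a x) V0"
  using assms unfolding compressible_def by blast

lemma compressibleI: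
  assumes "a \<in> carrier A"
    "\<And>V h x. bas V h \<Longrightarrow> x \<in> V \<Longrightarrow>
      \<exists>V0 h0. bas V0 h0 \<and> x \<in> V0 \<and> V0 \<subseteq> V \<and> compressible_at a (ev a x) V0"
  shows "a \<in> compressible"
  using assms unfolding compressible_def by blast

text \<open>For a sum, the sets around \<open>x\<close> are nested and so are the compressing
  projections. A compression found for \<open>a\<close> stays valid below, since the smaller
  projection absorbs the larger one.\<close>

lemma csubspace_compressible: "A.csubspace compressible"
proof (rule A.csubspaceI)
  show "compressible \<subseteq> carrier A" using compressible_carrier by blast
  have "ev \<zero>\<^sub>A x = 0" for x using L.f_zero by (simp add: ev_def)
  then have z: "h \<cdot> \<zero>\<^sub>A \<cdot> h = scl A (ev \<zero>\<^sub>A x) h" if "bas V h" for V h x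
    using bas_closed[OF that] by simp
  have "compressible_at \<zero>\<^sub>A (ev \<zero>\<^sub>A x) V" for x V
    using z by (intro compressible_atI) blast
  then show "\<zero>\<^sub>A \<in> compressible" by (intro compressibleI) auto
next
  fix a b assume a: "a \<in> compressible" and b: "b \<in> compressible"
  have ab: "a \<in> carrier A" "b \<in> carrier A" using compressible_carrier[OF a] compressible_carrier[OF b] .
  show "a \<oplus>\<^bsub>A\<^esub> b \<in> compressible"
  proof (rule compressibleI)
    fix V h x assume h: "bas V h" "x \<in> V"
    obtain Va ha where Va: "bas Va ha" "x \<in> Va" "Va \<subseteq> V" "compressible_at a (ev a x) Va"
      by (rule compressibleE[OF a h])
    obtain Vb hb where Vb: "bas Vb hb" "x \<in> Vb" "Vb \<subseteq> Va" "compressible_at b (ev b x) Vb"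
      by (rule compressibleE[OF b Va(1,2)])
    have "compressible_at (a \<oplus>\<^bsub>A\<^esub> b) (ev (a \<oplus>\<^bsub>A\<^esub> b) x) Vb"
    proof (rule compressible_atI)
      fix V1 h1 assume V1: "bas V1 h1" "V1 \<subseteq> Vb" "V1 \<noteq> {}"
      obtain V2 h2 where 2: "bas V2 h2" "V2 \<subseteq> V1" "V2 \<noteq> {}" "h2 \<cdot> a \<cdot> h2 = scl A (ev a x) h2"
        by (rule compressible_atE[OF Va(4) V1(1) order.trans[OF V1(2) Vb(3)] V1(3)])
      obtain V3 h3 where 3: "bas V3 h3" "V3 \<subseteq> V2" "V3 \<noteq> {}" "h3 \<cdot> b \<cdot> h3 = scl A (ev b x) h3"
        by (rule compressible_atE[OF Vb(4) 2(1) order.trans[OF 2(2) V1(2)] 2(3)])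
      note cl = bas_closed[OF 2(1)] bas_closed[OF 3(1)] and abs = bas_absorb[OF 3(1) 2(1) 3(2)]
      have "h3 \<cdot> a \<cdot> h3 = (h3 \<cdot> h2) \<cdot> a \<cdot> (h2 \<cdot> h3)" by (simp only: abs)
      also have "\<dots> = h3 \<cdot> (h2 \<cdot> a \<cdot> h2) \<cdot> h3" using cl ab by (simp add: A.m_assoc)
      also have "\<dots> = scl A (ev a x) h3"
        unfolding 2(4) using cl by (simp add: A.scl_mult_left A.scl_mult_right abs bas_idem[OF 3(1)])
      finally have "h3 \<cdot> (a \<oplus>\<^bsub>A\<^esub> b) \<cdot> h3 = scl A (ev (a \<oplus>\<^bsub>A\<^esub> b) x) h3"
        using cl ab 3(4) by (simp add: A.l_distr A.r_distr ev_add A.scl_add_left)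
      then show "\<exists>V2 h2. bas V2 h2 \<and> V2 \<subseteq> V1 \<and> V2 \<noteq> {} \<and>
          h2 \<cdot> (a \<oplus>\<^bsub>A\<^esub> b) \<cdot> h2 = scl A (ev (a \<oplus>\<^bsub>A\<^esub> b) x) h2"
        using 3 order.trans[OF 3(2) 2(2)] by blast
    qed
    then show "\<exists>V0 h0. bas V0 h0 \<and> x \<in> V0 \<and> V0 \<subseteq> V \<and> compressible_at (a \<oplus>\<^bsub>A\<^esub> b) (ev (a \<oplus>\<^bsub>A\<^esub> b) x) V0"
      using Vb(1,2) order.trans[OF Vb(3) Va(3)] by blast
  qed (use ab in simp)
next
  fix c a assume a: "a \<in> compressible"
  have ac: "a \<in> carrier A" by (rule compressible_carrier[OF a])
  show "scl A c a \<in> compressible"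
  proof (rule compressibleI)
    fix V h x assume h: "bas V h" "x \<in> V"
    obtain V0 h0 where V0: "bas V0 h0" "x \<in> V0" "V0 \<subseteq> V" "compressible_at a (ev a x) V0"
      by (rule compressibleE[OF a h])
    have "compressible_at (scl A c a) (ev (scl A c a) x) V0"
    proof (rule compressible_atI)
      fix V1 h1 assume V1: "bas V1 h1" "V1 \<subseteq> V0" "V1 \<noteq> {}"
      obtain V2 h2 where 2: "bas V2 h2" "V2 \<subseteq> V1" "V2 \<noteq> {}" "h2 \<cdot> a \<cdot> h2 = scl A (ev a x) h2"
        by (rule compressible_atE[OF V0(4) V1])
      have "h2 \<cdot> scl A c a \<cdot> h2 = scl A (ev (scl A c a) x) h2"
        using ac bas_closed[OF 2(1)] 2(4)
        by (simp add: A.scl_mult_left A.scl_mult_right ev_scl A.scl_scl)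
      then show "\<exists>V2 h2. bas V2 h2 \<and> V2 \<subseteq> V1 \<and> V2 \<noteq> {} \<and> h2 \<cdot> scl A c a \<cdot> h2 = scl A (ev (scl A c a) x) h2"
        using 2 by blast
    qed
    then show "\<exists>V0 h0. bas V0 h0 \<and> x \<in> V0 \<and> V0 \<subseteq> V \<and> compressible_at (scl A c a) (ev (scl A c a) x) V0"
      using V0 by blast
  qed (use ac in \<open>simp add: A.scl_closed\<close>)
qed

text \<open>For a neutral word, \<open>V0\<close> is cut down to the side of
  \<open>K \<alpha>\<close> on which \<open>x\<close> lies. For the others the scalar is 0, and
  \<open>compress_word\<close> provides the second shrinking; this is where (3) enters.\<close>

lemma wt_compressible:
  assumes cond: units_move_principal_ideals and \<alpha>: "\<alpha> \<in> words P"
  shows "wt \<alpha> \<in> compressible"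
proof (rule compressibleI)
  show "wt \<alpha> \<in> carrier A" using \<alpha> by simp
  fix V h x assume h: "bas V h" "x \<in> V"
  have xP: "x \<in> P" using h bas_subset by blast
  show "\<exists>V0 h0. bas V0 h0 \<and> x \<in> V0 \<and> V0 \<subseteq> V \<and> compressible_at (wt \<alpha>) (ev (wt \<alpha>) x) V0"
  proof (cases "dot \<alpha> = \<one>")
    case False
    have ev0: "ev (wt \<alpha>) x = 0" using ev_wt[OF \<alpha> xP] False by simp
    have "compressible_at (wt \<alpha>) 0 V"
    proof (rule compressible_atI)
      fix V1 h1 assume V1: "bas V1 h1" "V1 \<noteq> {}"
      obtain W k where W: "bas W k" "W \<subseteq> V1" "W \<noteq> {}" "k \<cdot> wt \<alpha> \<cdot> k = \<zero>\<^sub>A"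
        using compress_word[OF cond \<alpha> False V1] by blast
      then have "k \<cdot> wt \<alpha> \<cdot> k = scl A 0 k" using bas_closed[OF W(1)] by simp
      then show "\<exists>V2 h2. bas V2 h2 \<and> V2 \<subseteq> V1 \<and> V2 \<noteq> {} \<and> h2 \<cdot> wt \<alpha> \<cdot> h2 = scl A 0 h2"
        using W by blast
    qed
    then show ?thesis unfolding ev0 using h by blast
  next
    case True
    define S where "S = K \<alpha>"
    have n: "\<alpha> \<in> neutral" using \<alpha> True by (rule neutral_wordsI)
    have S: "S \<in> J" "wt \<alpha> = pr S" using constructibleI[OF \<alpha>] pr_word[OF n] by (auto simp: S_def)
    show ?thesis
    proof (cases "x \<in> S")
      case xS: True
      have ev1: "ev (wt \<alpha>) x = 1" using ev_wt[OF \<alpha> xP] True xS by (simp add: S_def)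
      have "h1 \<cdot> wt \<alpha> \<cdot> h1 = scl A 1 h1" if "bas V1 h1" "V1 \<subseteq> V \<inter> S" for V1 h1
        using bas_contained[OF that(1) S(1)] that bas_idem[OF that(1)] bas_closed[OF that(1)]
        by (simp add: S(2) A.scl_one)
      then have "compressible_at (wt \<alpha>) 1 (V \<inter> S)" by (intro compressible_atI) blast
      then show ?thesis unfolding ev1 using bas_split(1)[OF h(1) S(1)] h(2) xS by blast
    next
      case xS: False
      have ev0: "ev (wt \<alpha>) x = 0" using ev_wt[OF \<alpha> xP] xS by (simp add: S_def)
      have "h1 \<cdot> wt \<alpha> \<cdot> h1 = scl A 0 h1" if "bas V1 h1" "V1 \<subseteq> V - S" for V1 h1
      proof -
        have "V1 \<inter> S = {}" using that by blast
        then show ?thesis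
          using bas_disjoint[OF that(1) S(1)] bas_closed[OF that(1)] by (simp add: S(2))
      qed
      then have "compressible_at (wt \<alpha>) 0 (V - S)" by (intro compressible_atI) blast
      then show ?thesis unfolding ev0 using bas_split(2)[OF h(1) S(1)] h(2) xS by blast
    qed
  qed
qed

text \<open>Compressing a positive element \<open>b\<close> of the ideal by a suitable projection \<open>h\<close> of the diagonal
  gives nearly a nonzero multiple of \<open>h\<close>, which forces \<open>h\<close> into the ideal.\<close>

theorem ideal_in_kernel:
  assumes cond: units_move_principal_ideals
    and I: "cstar_ideal I A" and trivial: "I \<inter> closed_cspan A (wt ` neutral) = {\<zero>\<^sub>A}"
    and s: "s \<in> I"
  shows "L s = (\<lambda>f x. 0)"
proof (rule ccontr)
  assume "L s \<noteq> (\<lambda>f x. 0)"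
  note ID = A.cstar_idealD[OF I]
  have sc: "s \<in> carrier A" using s ID(1) by blast
  obtain x where x: "x \<in> P" "L s (ell2_delta x) \<noteq> (\<lambda>_. 0)"
    using bounded_ops_zeroI[OF L_closed[OF sc]] \<open>L s \<noteq> (\<lambda>f x. 0)\<close> points_P by blast
  let ?v = "L s (ell2_delta x)"
  have \<delta>: "ell2_delta x \<in> ell2 points" using x by (simp add: points_P)
  have v: "?v \<in> ell2 points" by (rule bounded_ops_range[OF L_closed[OF sc]])
  \<comment> \<open>The coefficient of \<open>b\<close> at \<open>x\<close> is a squared norm and
    therefore positive, whereas \<open>s\<close> itself may have zero diagonal.\<close>
  define b where "b = adj A s \<cdot> s"
  have bI: "b \<in> I" and bc: "b \<in> carrier A" using s sc ID(5) A.adj_closed by (auto simp: b_def)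
  define r where "r = (ell2_norm points ?v)\<^sup>2"
  have r: "r > 0" unfolding r_def using ell2_norm_zeroD[OF v] x(2) by auto
  have "ev b x = adjoint points (L s) ?v x"
    unfolding ev_def b_def using L_mult[OF A.adj_closed[OF sc] sc] L.f_simps(6)[OF sc] by simp
  also have "\<dots> = ell2_inner points (adjoint points (L s) ?v) (ell2_delta x)"
    using ell2_inner_delta[of x points] x(1) points_P by simp
  also have "\<dots> = ell2_inner points ?v ?v"
    by (rule adjoint_props(3)[OF L_closed[OF sc] v \<delta>])
  also have "\<dots> = complex_of_real r" unfolding r_def by (rule ell2_inner_self[OF v])
  finally have evb: "ev b x = complex_of_real r" .
  \<comment> \<open>With tolerance \<open>r / 2\<close> the scalar \<open>ev a x\<close> keeps
    modulus above \<open>r / 2\<close>, while the compression of \<open>a - b\<close> has norm below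
    \<open>r / 2\<close>. Dividing by the scalar leaves an error below 1, as
    \<open>idempotent_in_ideal\<close> needs.\<close>
  obtain a where a: "a \<in> cspan A (wt ` words P)" "nrm A (b \<ominus>\<^sub>A a) < r / 2"
    using words_dense bc r A.in_closed_cspan_iff[OF wt_neutral_subset(2)] by (meson half_gt_zero subsetD)
  have ac: "a \<in> carrier A" using a(1) A.cspan_subset_carrier[OF wt_neutral_subset(2)] by blast
  have "cspan A (wt ` words P) \<subseteq> compressible"
    using wt_compressible[OF cond] by (intro A.cspan_least csubspace_compressible) auto
  then have "a \<in> compressible" using a by blast
  then obtain V0 h0 where V0: "bas V0 h0" "x \<in> V0" "compressible_at a (ev a x) V0"
    by (rule compressibleE[OF _ bas_pr[OF constructible_whole] x(1)])
  then have "V0 \<noteq> {}" by blast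
  then obtain V h where h: "bas V h" "V \<noteq> {}" "h \<cdot> a \<cdot> h = scl A (ev a x) h"
    by (rule compressible_atE[OF V0(3,1) order.refl])
  note hc = bas_closed[OF h(1)]
  define c where "c = ev a x"
  have "cmod (ev b x - c) < r / 2"
    using ev_bound[of "b \<ominus>\<^sub>A a" x] ev_diff[of b a x] a(2) bc ac x(1) by (simp add: c_def)
  then have c: "cmod c > r / 2"
    using norm_triangle_ineq2[of "ev b x" "ev b x - c"] r by (simp add: evb)
  then have c0: "c \<noteq> 0" using r by auto
  have h1: "nrm A h \<le> 1" using A.nrm_idem_le[OF hc bas_adj[OF h(1)] bas_idem[OF h(1)]] .
  have "nrm A (h \<cdot> (a \<ominus>\<^sub>A b) \<cdot> h) \<le> nrm A h * nrm A (a \<ominus>\<^sub>A b) * nrm A h"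
    using hc ac bc by (intro order.trans[OF A.nrm_mult] mult_right_mono A.nrm_mult A.nrm_nonneg) auto
  also have "\<dots> \<le> 1 * nrm A (a \<ominus>\<^sub>A b) * 1"
    using h1 hc ac bc by (intro mult_mono) (auto simp: A.nrm_nonneg)
  also have "\<dots> < cmod c" using a(2) c A.nrm_minus_commute[OF ac bc] by simp
  finally have small: "nrm A (h \<cdot> (a \<ominus>\<^sub>A b) \<cdot> h) < cmod c" .
  let ?y = "scl A (1 / c) b"
  have "h \<ominus>\<^sub>A h \<cdot> ?y \<cdot> h = scl A (1 / c) (h \<cdot> (a \<ominus>\<^sub>A b) \<cdot> h)"
  proof -
    have "h \<cdot> (a \<ominus>\<^sub>A b) \<cdot> h = h \<cdot> a \<cdot> h \<ominus>\<^sub>A h \<cdot> b \<cdot> h"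
      using hc ac bc by (simp add: a_minus_def A.l_distr A.r_distr A.l_minus A.r_minus)
    then have "scl A (1 / c) (h \<cdot> (a \<ominus>\<^sub>A b) \<cdot> h) = scl A (1 / c) (scl A c h) \<ominus>\<^sub>A scl A (1 / c) (h \<cdot> b \<cdot> h)"
      unfolding h(3) c_def[symmetric] using hc bc by (simp add: A.scl_diff_right A.scl_closed)
    then show ?thesis
      using hc bc c0 by (simp add: A.scl_scl A.scl_one A.scl_mult_left A.scl_mult_right)
  qed
  then have "nrm A (h \<ominus>\<^sub>A h \<cdot> ?y \<cdot> h) = cmod (1 / c) * nrm A (h \<cdot> (a \<ominus>\<^sub>A b) \<cdot> h)"
    using hc ac bc by (simp add: A.nrm_scl)
  also have "\<dots> < 1" using small c0 by (simp add: norm_divide divide_less_eq)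
  finally have "h \<in> I"
    using A.idempotent_in_ideal[OF I hc bas_idem[OF h(1)] ID(7)[OF bI]] by blast
  moreover have "h \<in> closed_cspan A (wt ` neutral)" using bas_diag[OF h(1)] diag_span_props(2) by blast
  ultimately show False using trivial bas_nonzero[OF h(1,2)] by blast
qed

end


section \<open>The universal and the reduced Toeplitz algebra\<close>

text \<open>To be read in two representations: the difference vanishes where \<open>x\<close> and
  \<open>u \<otimes> x\<close> are identified, but not in the left regular one.\<close>

lemma (in represented_family) L_unit_difference:
  assumes u: "u \<in> P" and x: "x \<in> P" and Rs: "set Rs \<subseteq> J"
  shows "L ((w u \<ominus>\<^sub>A \<one>\<^sub>A) \<cdot> compl Rs) (ell2_delta (\<rho> x))
    = (if x \<in> \<Union>(set Rs) then (\<lambda>_. 0) else (\<lambda>z. ell2_delta (\<rho> (u \<otimes> x)) z - ell2_delta (\<rho> x) z))"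
proof -
  have c: "compl Rs \<in> carrier A" "w u \<in> carrier A" using cprojD(1)[OF cproj_compl_list[OF Rs]] u by auto
  have "L (w u) (ell2_delta (\<rho> x)) = ell2_delta (\<rho> (u \<otimes> x))"
    using L_wt_delta[of "[\<one>, u]" x] word_K_unit_left[OF u] u x wt_gen[OF u]
    by (simp del: word_dot.simps word_eval.simps)
  then show ?thesis
    using c L_compl_delta[OF x Rs] L_zero_vector[of "w u \<ominus>\<^sub>A \<one>\<^sub>A"] rho_points[OF x]
    by (simp add: L_mult L_minus_apply L_one_apply)
qed

section \<open>Passing between an algebra and a subalgebra\<close>

lemma word_eval_carrier_update: "word_eval (A\<lparr>carrier := C\<rparr>) w \<alpha> = word_eval A w \<alpha>"
  by (induction \<alpha> rule: induct_list012) auto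

lemma word_eval_cong:
  "\<alpha> \<in> words P \<Longrightarrow> (\<And>p. p \<in> P \<Longrightarrow> w p = w' p) \<Longrightarrow> word_eval A w \<alpha> = word_eval A w' \<alpha>"
  by (induction rule: words_induct) auto

context unital_cstar_algebra
begin

lemma subalgebra_word_eval:
  assumes "cstar_subalgebra C A" "w \<in> P \<rightarrow> C"
  shows "\<alpha> \<in> words P \<Longrightarrow> word_eval A w \<alpha> \<in> C"
proof (induction rule: words_induct)
  case Nil
  then show ?case using assms subringE(3) by (auto simp: cstar_subalgebra_def)
next
  case (Cons p q \<alpha>)
  then have "w p \<in> C" "w q \<in> C" using assms(2) by auto
  then show ?case using Cons assms(1) subringE(6)[of C A] by (simp add: cstar_subalgebra_def)
qed

text \<open>Neither spans nor limits leave a closed subalgebra. This is needed because the reduced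
  diagonal is formed among all bounded operators, while the ideals live in the reduced
  algebra.\<close>

lemma closed_cspan_subalgebra:
  assumes C: "cstar_subalgebra C A" and S: "S \<subseteq> C"
  shows "closed_cspan (A\<lparr>carrier := C\<rparr>) S = closed_cspan A S"
proof -
  let ?C = "A\<lparr>carrier := C\<rparr>"
  interpret C: unital_cstar_algebra ?C by (rule cstar_subalgebra_is_cstar_algebra[OF C])
  have sr: "subring C A" and cl: "closedin (cstar_topology A) C" and scl: "\<And>c x. x \<in> C \<Longrightarrow> scl A c x \<in> C"
    using C by (auto simp: cstar_subalgebra_def)
  note sub = subringE[OF sr]
  have SA: "S \<subseteq> carrier A" using S sub(1) by blast
  have SC: "S \<subseteq> carrier ?C" using S by simp
  have "csubspace C" by (intro csubspaceI sub scl)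
  then have inC: "cspan A S \<subseteq> C" by (rule cspan_least[OF _ S])
  have span: "cspan ?C S = cspan A S"
  proof
    note V = csubspaceD[OF csubspace_cspan[OF SA]]
    show "cspan ?C S \<subseteq> cspan A S"
      using inC V by (intro C.cspan_least C.csubspaceI cspan_superset) auto
    note W = C.csubspaceD[OF C.csubspace_cspan[OF SC]]
    show "cspan A S \<subseteq> cspan ?C S"
      using W sub(1) by (intro cspan_least csubspaceI C.cspan_superset) auto
  qed
  show ?thesis
  proof (intro equalityI subsetI)
    fix x assume "x \<in> closed_cspan ?C S"
    then have x: "x \<in> C" "\<And>e. e > 0 \<Longrightarrow> \<exists>y\<in>cspan A S. nrm A (x \<ominus>\<^bsub>?C\<^esub> y) < e"
      unfolding C.in_closed_cspan_iff[OF SC] span by auto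
    have "\<exists>y\<in>cspan A S. nrm A (x \<ominus> y) < e" if "e > 0" for e
      using x(2)[OF that] a_minus_subalgebra[OF sr x(1)] inC by (metis subsetD)
    then show "x \<in> closed_cspan A S"
      unfolding in_closed_cspan_iff[OF SA] using x(1) sub(1) by blast
  next
    fix x assume "x \<in> closed_cspan A S"
    then have x: "x \<in> carrier A" "\<And>e. e > 0 \<Longrightarrow> \<exists>y\<in>cspan A S. nrm A (x \<ominus> y) < e"
      unfolding in_closed_cspan_iff[OF SA] by auto
    then have xC: "x \<in> C" using cl inC unfolding closedin_iff[OF sub(1)] by blast
    have "\<exists>y\<in>cspan A S. nrm A (x \<ominus>\<^bsub>?C\<^esub> y) < e" if "e > 0" for e
      using x(2)[OF that] a_minus_subalgebra[OF sr xC] inC by (metis subsetD)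
    then show "x \<in> closed_cspan ?C S"
      unfolding C.in_closed_cspan_iff[OF SC] span using xC by simp
  qed
qed

end

text \<open>Appending and reversing words realise products and adjoints, and
  \<open>[\<one>, p]\<close> realises the generator of \<open>p\<close>.\<close>

lemma (in toeplitz_family) generated_words_dense:
  "cstar_generated A (w ` P) \<subseteq> closed_cspan A (wt ` words P)"
proof (rule A.cstar_generated_subset[OF wt_neutral_subset(2)])
  show "x \<cdot> y \<in> wt ` words P" if xy: "x \<in> wt ` words P" "y \<in> wt ` words P" for x y
  proof -
    obtain \<alpha> \<beta> where "\<alpha> \<in> words P" "\<beta> \<in> words P" "x = wt \<alpha>" "y = wt \<beta>" using xy by blast
    then have "\<alpha> @ \<beta> \<in> words P" "x \<cdot> y = wt (\<alpha> @ \<beta>)" by (simp_all add: wt_append)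
    then show ?thesis by blast
  qed
  show "adj A x \<in> wt ` words P" if x: "x \<in> wt ` words P" for x
  proof -
    obtain \<alpha> where "\<alpha> \<in> words P" "x = wt \<alpha>" using x by blast
    then have "rev \<alpha> \<in> words P" "adj A x = wt (rev \<alpha>)" by (simp_all add: wt_rev)
    then show ?thesis by blast
  qed
  show "\<one>\<^sub>A \<in> wt ` words P" by (rule image_eqI[of _ _ "[]"]) auto
  show "w ` P \<subseteq> wt ` words P"
  proof
    fix x assume "x \<in> w ` P"
    then obtain p where "p \<in> P" "x = w p" by blast
    then show "x \<in> wt ` words P"
      using wt_gen[of p] by (intro image_eqI[of _ _ "[\<one>, p]"]) (auto simp del: word_eval.simps)
  qed
qed

context submonoid_in_group
begin

lemma toeplitz_relations_subalgebra:
  assumes A: "unital_cstar_algebra A" and C: "cstar_subalgebra C A"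
    and rel: "toeplitz_relations G P A w" and w': "w' \<in> P \<rightarrow> C" and eq: "\<And>p. p \<in> P \<Longrightarrow> w p = w' p"
  shows "toeplitz_relations G P (A\<lparr>carrier := C\<rparr>) w'"
proof -
  interpret A: unital_cstar_algebra A by (rule A)
  have sr: "subring C A" using C by (simp add: cstar_subalgebra_def)
  have we: "word_eval (A\<lparr>carrier := C\<rparr>) w' \<alpha> = word_eval A w \<alpha>" if "\<alpha> \<in> neutral" for \<alpha>
    using word_eval_cong[of \<alpha> P w w' A, OF neutral_wordsD(1)[OF that] eq] by (simp add: word_eval_carrier_update)
  have inC: "word_eval A w \<alpha> \<in> C" if "\<alpha> \<in> neutral" for \<alpha>
    using A.subalgebra_word_eval[OF C w' neutral_wordsD(1)[OF that]]
      word_eval_cong[of \<alpha> P w w' A, OF neutral_wordsD(1)[OF that] eq] by simp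
  \<comment> \<open>Subtraction refers to the carrier, so the product in the last relation has to be
    rewritten factor by factor.\<close>
  have foldr: "foldr (\<lambda>\<beta> x. (word_eval (A\<lparr>carrier := C\<rparr>) w' \<alpha> \<ominus>\<^bsub>A\<lparr>carrier := C\<rparr>\<^esub> word_eval (A\<lparr>carrier := C\<rparr>) w' \<beta>)
        \<otimes>\<^bsub>A\<lparr>carrier := C\<rparr>\<^esub> x) \<beta>s \<one>\<^bsub>A\<lparr>carrier := C\<rparr>\<^esub>
      = foldr (\<lambda>\<beta> x. (word_eval A w \<alpha> \<ominus>\<^bsub>A\<^esub> word_eval A w \<beta>) \<otimes>\<^bsub>A\<^esub> x) \<beta>s \<one>\<^bsub>A\<^esub>"
    if \<alpha>: "\<alpha> \<in> neutral" and \<beta>s: "\<beta>s \<in> lists neutral" for \<alpha> \<beta>s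
  proof (rule foldr_cong)
    fix x \<beta> assume "\<beta> \<in> set \<beta>s"
    then have \<beta>: "\<beta> \<in> neutral" using \<beta>s by auto
    show "(word_eval (A\<lparr>carrier := C\<rparr>) w' \<alpha> \<ominus>\<^bsub>A\<lparr>carrier := C\<rparr>\<^esub> word_eval (A\<lparr>carrier := C\<rparr>) w' \<beta>) \<otimes>\<^bsub>A\<lparr>carrier := C\<rparr>\<^esub> x
        = (word_eval A w \<alpha> \<ominus>\<^bsub>A\<^esub> word_eval A w \<beta>) \<otimes>\<^bsub>A\<^esub> x"
      using A.a_minus_subalgebra[OF sr inC[OF \<alpha>] inC[OF \<beta>]] by (simp add: we[OF \<alpha>] we[OF \<beta>])
  qed simp_all
  note R = rel[unfolded toeplitz_relations_def]
  show ?thesis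
    unfolding toeplitz_relations_def
  proof (intro conjI ballI impI)
    show "w' \<in> P \<rightarrow> carrier (A\<lparr>carrier := C\<rparr>)" using w' by simp
    have "w \<one> = \<one>\<^bsub>A\<^esub>" using R by blast
    then show "w' \<one> = \<one>\<^bsub>A\<lparr>carrier := C\<rparr>\<^esub>" using eq[of \<one>] by simp
    fix \<alpha> assume \<alpha>: "\<alpha> \<in> neutral"
    show "word_eval (A\<lparr>carrier := C\<rparr>) w' \<alpha> = \<zero>\<^bsub>A\<lparr>carrier := C\<rparr>\<^esub>" if "K \<alpha> = {}"
      using R \<alpha> that we[OF \<alpha>] by simp
    show "word_eval (A\<lparr>carrier := C\<rparr>) w' \<alpha> = word_eval (A\<lparr>carrier := C\<rparr>) w' \<beta>" if "\<beta> \<in> neutral" "K \<alpha> = K \<beta>" for \<beta>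
    proof -
      have "word_eval A w \<alpha> = word_eval A w \<beta>" using R \<alpha> that by blast
      then show ?thesis using we[OF \<alpha>] we[OF that(1)] by simp
    qed
    fix \<beta>s assume \<beta>s: "\<beta>s \<in> lists neutral" "distinct \<beta>s \<and> \<beta>s \<noteq> [] \<and> K \<alpha> = (\<Union>\<beta>\<in>set \<beta>s. K \<beta>)"
    have "foldr (\<lambda>\<beta> x. (word_eval A w \<alpha> \<ominus>\<^bsub>A\<^esub> word_eval A w \<beta>) \<otimes>\<^bsub>A\<^esub> x) \<beta>s \<one>\<^bsub>A\<^esub> = \<zero>\<^bsub>A\<^esub>"
      using R \<alpha> \<beta>s by blast
    then show "foldr (\<lambda>\<beta> x. (word_eval (A\<lparr>carrier := C\<rparr>) w' \<alpha> \<ominus>\<^bsub>A\<lparr>carrier := C\<rparr>\<^esub> word_eval (A\<lparr>carrier := C\<rparr>) w' \<beta>)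
        \<otimes>\<^bsub>A\<lparr>carrier := C\<rparr>\<^esub> x) \<beta>s \<one>\<^bsub>A\<lparr>carrier := C\<rparr>\<^esub> = \<zero>\<^bsub>A\<lparr>carrier := C\<rparr>\<^esub>"
      unfolding foldr[OF \<alpha> \<beta>s(1)] by simp
  qed
qed

lemma left_regular_bounded: "p \<in> P \<Longrightarrow> left_regular G P p \<in> bounded_ops P"
proof -
  interpret Id: collapsed_representation G P "\<lambda>x. x" by (rule collapsed_id)
  assume p: "p \<in> P"
  have "Id.rep p \<in> bounded_ops Id.points"
    unfolding Id.rep_def by (rule pbij_op_bounded[OF Id.gen_pbij[OF p]])
  then show ?thesis using left_regular_rep[OF p] by (simp add: Id.points_def)
qed

lemma reduced_subalgebra:
  "cstar_subalgebra (cstar_generated (bounded_operators P) (left_regular G P ` P)) (bounded_operators P)"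
  "left_regular G P ` P \<subseteq> cstar_generated (bounded_operators P) (left_regular G P ` P)"
proof -
  interpret B: unital_cstar_algebra "bounded_operators P" by (rule unital_cstar_algebra_bounded_operators)
  have "left_regular G P ` P \<subseteq> carrier (bounded_operators P)" using left_regular_bounded by auto
  then show "cstar_subalgebra (cstar_generated (bounded_operators P) (left_regular G P ` P)) (bounded_operators P)"
    "left_regular G P ` P \<subseteq> cstar_generated (bounded_operators P) (left_regular G P ` P)"
    by (rule B.cstar_subalgebra_generated)+
qed

lemma word_eval_left_regular:
  "\<alpha> \<in> words P \<Longrightarrow> word_eval (bounded_operators P) (left_regular G P) \<alpha>
    \<in> cstar_generated (bounded_operators P) (left_regular G P ` P)"
proof -
  have "left_regular G P \<in> P \<rightarrow> cstar_generated (bounded_operators P) (left_regular G P ` P)"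
    using reduced_subalgebra(2) by blast
  then show "\<alpha> \<in> words P \<Longrightarrow> word_eval (bounded_operators P) (left_regular G P) \<alpha>
    \<in> cstar_generated (bounded_operators P) (left_regular G P ` P)"
    by (rule unital_cstar_algebra.subalgebra_word_eval[OF unital_cstar_algebra_bounded_operators reduced_subalgebra(1)])
qed

lemma unital_cstar_algebra_reduced: "unital_cstar_algebra (reduced_toeplitz G P)"
  unfolding reduced_toeplitz_def
  by (rule unital_cstar_algebra.cstar_subalgebra_is_cstar_algebra[OF
      unital_cstar_algebra_bounded_operators reduced_subalgebra(1)])

lemma reduced_toeplitz_simps [simp]:
  "\<zero>\<^bsub>reduced_toeplitz G P\<^esub> = (\<lambda>f x. 0)"
  "nrm (reduced_toeplitz G P) = opnorm P"
  by (simp_all add: reduced_toeplitz_def)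

lemma star_hom_reduced_bounded:
  assumes "f \<in> star_hom A (reduced_toeplitz G P)" shows "f \<in> star_hom A (bounded_operators P)"
proof -
  have "cstar_generated (bounded_operators P) (left_regular G P ` P) \<subseteq> bounded_ops P"
    using subringE(1) reduced_subalgebra(1) by (fastforce simp: cstar_subalgebra_def)
  then show ?thesis
    using assms unfolding star_hom_def ring_hom_def reduced_toeplitz_def
    by (auto simp del: bounded_operators_simps(2-6))
qed

lemma toeplitz_relations_regular: "toeplitz_relations G P (reduced_toeplitz G P) (left_regular G P)"
proof -
  interpret Id: collapsed_representation G P "\<lambda>x. x" by (rule collapsed_id)
  have pts: "Id.points = P" by (simp add: Id.points_def)
  show ?thesis
    unfolding reduced_toeplitz_def
  proof (rule toeplitz_relations_subalgebra[OF unital_cstar_algebra_bounded_operators reduced_subalgebra(1)])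
    show "toeplitz_relations G P (bounded_operators P) Id.rep"
      using Id.toeplitz_relations_rep by (simp only: pts)
  qed (use reduced_subalgebra(2) left_regular_rep in auto)
qed

lemma mult_operator_indicator:
  assumes \<alpha>: "\<alpha> \<in> neutral"
  shows "mult_operator P (indicator (K \<alpha>)) = word_eval (bounded_operators P) (left_regular G P) \<alpha>"
proof -
  interpret Id: collapsed_representation G P "\<lambda>x. x" by (rule collapsed_id)
  have pts: "Id.points = P" by (simp add: Id.points_def)
  have eq: "word_eval (bounded_operators P) (left_regular G P) \<alpha> = word_eval (bounded_operators P) Id.rep \<alpha>"
    by (rule word_eval_cong[OF neutral_wordsD(1)[OF \<alpha>]]) (simp add: left_regular_rep)
  note bdd = Id.word_eval_rep_bounded[OF neutral_wordsD(1)[OF \<alpha>], unfolded pts]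
  show ?thesis
    unfolding eq
  proof (intro ext)
    fix f x
    show "mult_operator P (indicator (K \<alpha>)) f x = word_eval (bounded_operators P) Id.rep \<alpha> f x"
    proof (cases "f \<in> ell2 P")
      case True
      show ?thesis
      proof (cases "x \<in> P")
        case xP: True
        show ?thesis
          using Id.word_eval_neutral_rep[OF \<alpha> _ xP, unfolded pts, OF True] True
          by (simp add: mult_operator_def indicator_def)
      next
        case False
        then show ?thesis
          using True ell2_off[OF True False] ell2_off[OF bounded_ops_range[OF bdd, of f] False]
          by (simp add: mult_operator_def)
      qed
    qed (use bounded_opsD(4)[OF bdd, of f] in \<open>simp add: mult_operator_def\<close>)
  qed
qed

lemma reduced_diagonal_words:
  "reduced_diagonal G P = closed_cspan (bounded_operators P) (word_eval (bounded_operators P) (left_regular G P) ` neutral)"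
proof -
  have "(\<lambda>S. mult_operator P (indicator S)) ` J = word_eval (bounded_operators P) (left_regular G P) ` neutral"
  proof (intro equalityI subsetI)
    fix T assume "T \<in> (\<lambda>S. mult_operator P (indicator S)) ` J"
    then obtain S where S: "S \<in> J" "T = mult_operator P (indicator S)" by (rule imageE)
    obtain \<alpha> where \<alpha>: "\<alpha> \<in> neutral" "S = K \<alpha>" using constructible_neutral[OF S(1)] by (rule bexE)
    show "T \<in> word_eval (bounded_operators P) (left_regular G P) ` neutral"
      unfolding S(2) \<alpha>(2) mult_operator_indicator[OF \<alpha>(1)] by (rule imageI[OF \<alpha>(1)])
  next
    fix T assume "T \<in> word_eval (bounded_operators P) (left_regular G P) ` neutral"
    then obtain \<alpha> where \<alpha>: "T = word_eval (bounded_operators P) (left_regular G P) \<alpha>" "\<alpha> \<in> neutral"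
      by (rule imageE)
    show "T \<in> (\<lambda>S. mult_operator P (indicator S)) ` J"
      unfolding \<alpha>(1) mult_operator_indicator[OF \<alpha>(2), symmetric]
      by (rule imageI[OF constructibleI[OF neutral_wordsD(1)[OF \<alpha>(2)]]])
  qed
  then show ?thesis by (simp only: reduced_diagonal_def)
qed

text \<open>Here \<open>L\<close> is the inclusion into the bounded operators, so
  \<open>ideal_in_kernel\<close> will force the ideal itself to vanish.\<close>

lemma regular_family_reduced: "regular_family G P (reduced_toeplitz G P) (left_regular G P) (\<lambda>T. T)"
proof -
  interpret Id: collapsed_representation G P "\<lambda>x. x" by (rule collapsed_id)
  interpret T: toeplitz_family G P "reduced_toeplitz G P" "left_regular G P"
    by (intro toeplitz_family.intro toeplitz_family_axioms.intro submonoid_in_group_axioms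
        unital_cstar_algebra_reduced toeplitz_relations_regular)
  interpret B: unital_cstar_algebra "bounded_operators P" by (rule unital_cstar_algebra_bounded_operators)
  let ?C = "cstar_generated (bounded_operators P) (left_regular G P ` P)"
  have pts: "Id.points = P" by (simp add: Id.points_def)
  have "(\<lambda>T. T) \<in> star_hom (reduced_toeplitz G P) (reduced_toeplitz G P)"
    by (auto simp: star_hom_def ring_hom_def)
  then have hom: "(\<lambda>T. T) \<in> star_hom (reduced_toeplitz G P) (bounded_operators Id.points)"
    unfolding pts by (rule star_hom_reduced_bounded)
  have rel: "toeplitz_relations G P (bounded_operators P) (left_regular G P)"
  proof -
    have "toeplitz_relations G P (bounded_operators P\<lparr>carrier := carrier (bounded_operators P)\<rparr>) (left_regular G P)"
    proof (rule toeplitz_relations_subalgebra[OF unital_cstar_algebra_bounded_operators B.cstar_subalgebra_carrier])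
      show "toeplitz_relations G P (bounded_operators P) Id.rep"
        using Id.toeplitz_relations_rep by (simp only: pts)
    qed (use left_regular_bounded left_regular_rep in auto)
    moreover have "bounded_operators P\<lparr>carrier := carrier (bounded_operators P)\<rparr> = bounded_operators P"
      by (simp add: bounded_operators_def)
    ultimately show ?thesis by (simp only:)
  qed
  \<comment> \<open>The reduced algebra is generated inside \<open>bounded_operators P\<close>, so
    density of the words is obtained there and then moved to the subalgebra.\<close>
  interpret BT: toeplitz_family G P "bounded_operators P" "left_regular G P"
    by (intro toeplitz_family.intro toeplitz_family_axioms.intro submonoid_in_group_axioms
        unital_cstar_algebra_bounded_operators rel)
  have weval: "word_eval (reduced_toeplitz G P) (left_regular G P) = word_eval (bounded_operators P) (left_regular G P)"
    by (intro ext) (simp add: reduced_toeplitz_def word_eval_carrier_update)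
  have "word_eval (bounded_operators P) (left_regular G P) ` words P \<subseteq> ?C"
    using word_eval_left_regular by blast
  then have "carrier (reduced_toeplitz G P)
      \<subseteq> closed_cspan (reduced_toeplitz G P) (word_eval (reduced_toeplitz G P) (left_regular G P) ` words P)"
    unfolding weval using BT.generated_words_dense B.closed_cspan_subalgebra[OF reduced_subalgebra(1)]
    by (simp add: reduced_toeplitz_def)
  then show ?thesis
    using hom
    by (intro regular_family.intro represented_family.intro regular_family_axioms.intro represented_family_axioms.intro
        T.toeplitz_family_axioms collapsed_id) (auto simp: left_regular_rep)
qed

lemma ideals_meet_reduced_diagonal_of_units_move:
  assumes units_move_principal_ideals
  shows "ideals_meet_reduced_diagonal G P"
  unfolding ideals_meet_reduced_diagonal_def
proof (intro allI impI, elim conjE)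
  interpret R: regular_family G P "reduced_toeplitz G P" "left_regular G P" "\<lambda>T. T"
    by (rule regular_family_reduced)
  interpret B: unital_cstar_algebra "bounded_operators P" by (rule unital_cstar_algebra_bounded_operators)
  let ?C = "cstar_generated (bounded_operators P) (left_regular G P ` P)"
  fix I assume I: "cstar_ideal I (reduced_toeplitz G P)" and ne: "I \<noteq> {\<zero>\<^bsub>reduced_toeplitz G P\<^esub>}"
  have weval: "word_eval (reduced_toeplitz G P) (left_regular G P) = word_eval (bounded_operators P) (left_regular G P)"
    by (intro ext) (simp add: reduced_toeplitz_def word_eval_carrier_update)
  have "word_eval (bounded_operators P) (left_regular G P) ` neutral \<subseteq> ?C"
    using word_eval_left_regular neutral_wordsD(1) by blast
  then have diag: "closed_cspan (reduced_toeplitz G P) (word_eval (reduced_toeplitz G P) (left_regular G P) ` neutral)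
      = reduced_diagonal G P"
    unfolding weval reduced_diagonal_words
    using B.closed_cspan_subalgebra[OF reduced_subalgebra(1)] by (simp add: reduced_toeplitz_def)
  show "I \<inter> reduced_diagonal G P \<noteq> {\<zero>\<^bsub>reduced_toeplitz G P\<^esub>}"
  proof
    assume "I \<inter> reduced_diagonal G P = {\<zero>\<^bsub>reduced_toeplitz G P\<^esub>}"
    then have "s = (\<lambda>f x. 0)" if "s \<in> I" for s
      using R.ideal_in_kernel[OF assms I _ that] diag by simp
    then have "I \<subseteq> {\<zero>\<^bsub>reduced_toeplitz G P\<^esub>}" by auto
    moreover have "\<zero>\<^bsub>reduced_toeplitz G P\<^esub> \<in> I" by (rule R.A.cstar_idealD(2)[OF I])
    ultimately show False using ne by blast
  qed
qed

lemma regular_family_universal: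
  assumes A: "universal_toeplitz_algebra G P A t" and \<Lambda>: "canonical_surjection G P A t \<Lambda>"
  shows "regular_family G P A t \<Lambda>"
proof -
  interpret Id: collapsed_representation G P "\<lambda>x. x" by (rule collapsed_id)
  have pts: "Id.points = P" by (simp add: Id.points_def)
  interpret T: toeplitz_family G P A t
    using A by (intro toeplitz_family.intro toeplitz_family_axioms.intro submonoid_in_group_axioms)
      (auto simp: universal_toeplitz_algebra_def)
  have "\<Lambda> \<in> star_hom A (bounded_operators Id.points)"
    using \<Lambda> star_hom_reduced_bounded unfolding pts canonical_surjection_def by blast
  moreover have "carrier A \<subseteq> closed_cspan A (word_eval A t ` words P)"
    using T.generated_words_dense A by (simp add: universal_toeplitz_algebra_def)
  ultimately show ?thesis
    using \<Lambda>
    by (intro regular_family.intro represented_family.intro regular_family_axioms.intro represented_family_axioms.intro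
        T.toeplitz_family_axioms collapsed_id) (auto simp: left_regular_rep canonical_surjection_def)
qed

text \<open>If \<open>u\<close> fixes all principal ideals off \<open>\<Union>Rs\<close>, then \<open>(t\<^sub>u - 1) \<Prod>(1 - t\<^sub>R)\<close> vanishes in the
  representation on the set of principal ideals, but not in the left regular one.\<close>

lemma units_move_of_ideals_in_kernel:
  assumes A: "universal_toeplitz_algebra G P A t" and \<Lambda>: "canonical_surjection G P A t \<Lambda>"
    and ker: "\<And>I. cstar_ideal I A \<Longrightarrow> I \<inter> universal_diagonal G P A t = {\<zero>\<^bsub>A\<^esub>} \<Longrightarrow>
      I \<subseteq> a_kernel A (reduced_toeplitz G P) \<Lambda>"
  shows units_move_principal_ideals
  unfolding units_move_principal_ideals_def
proof (intro ballI allI impI, rule ccontr)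
  interpret R: regular_family G P A t \<Lambda> by (rule regular_family_universal[OF A \<Lambda>])
  interpret Q: collapsed_representation G P ideal_rep by (rule collapsed_ideals)
  fix u C assume u: "u \<in> unit_group G P - {\<one>}" and C: "finite C \<and> C \<subseteq> J - {P}"
    and "\<not> (\<exists>s\<in>P - \<Union>C. (u \<otimes> s) <# P \<noteq> s <# P)"
  then have fixd: "(u \<otimes> s) <# P = s <# P" if "s \<in> P" "s \<notin> \<Union>C" for s using that by blast
  have uP: "u \<in> P" using u by (simp add: unit_group_def)
  obtain Rs where Rs: "set Rs = C" using C finite_list by blast
  have RJ: "set Rs \<subseteq> J" using Rs C by blast
  have "\<exists>\<pi>\<in>star_hom A (bounded_operators Q.points). \<forall>p\<in>P. \<pi> (t p) = Q.rep p"
    using A unital_cstar_algebra_bounded_operators Q.toeplitz_relations_rep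
    unfolding universal_toeplitz_algebra_def by blast
  then obtain \<pi> where \<pi>: "\<pi> \<in> star_hom A (bounded_operators Q.points)" "\<And>p. p \<in> P \<Longrightarrow> \<pi> (t p) = Q.rep p"
    by blast
  interpret S: represented_family G P A t ideal_rep \<pi>
    by (intro represented_family.intro represented_family_axioms.intro R.toeplitz_family_axioms
        collapsed_ideals \<pi>)
  let ?I = "a_kernel A (bounded_operators Q.points) \<pi>"
  have I: "cstar_ideal ?I A" by (rule S.L.kernel_cstar_ideal)
  \<comment> \<open>Faithfulness on the diagonal holds for every collapse, so the kernel of
    \<open>\<pi>\<close> qualifies for the hypothesis on ideals.\<close>
  have "?I \<inter> universal_diagonal G P A t \<subseteq> {\<zero>\<^bsub>A\<^esub>}"
    using S.L_faithful_on_diagonal by (auto simp: a_kernel_def' universal_diagonal_def)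
  moreover have "\<zero>\<^bsub>A\<^esub> \<in> ?I" by (rule R.A.cstar_idealD(2)[OF I])
  moreover have "\<zero>\<^bsub>A\<^esub> \<in> universal_diagonal G P A t"
    unfolding universal_diagonal_def
    using R.A.csubspaceD(2)[OF R.A.closed_cspan_props(1)[OF R.wt_neutral_subset(1)]] .
  ultimately have sub: "?I \<subseteq> a_kernel A (reduced_toeplitz G P) \<Lambda>"
    by (intro ker[OF I]) blast
  define z where "z = (t u \<ominus>\<^bsub>A\<^esub> \<one>\<^bsub>A\<^esub>) \<otimes>\<^bsub>A\<^esub> R.compl Rs"
  have zc: "z \<in> carrier A"
    using R.cprojD(1)[OF R.cproj_compl_list[OF RJ]] uP by (simp add: z_def)
  have "\<pi> z = (\<lambda>f x. 0)"
  proof (rule bounded_ops_zeroI[OF S.L_closed[OF zc]])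
    fix y assume "y \<in> Q.points"
    then obtain x where x: "x \<in> P" "y = ideal_rep x" by (auto simp: Q.points_def)
    have "ideal_rep (u \<otimes> x) = ideal_rep x" if "x \<notin> \<Union>C"
      using fixd[OF x(1) that] ideal_rep_eq_iff[of "u \<otimes> x" x] uP x(1) by simp
    then show "\<pi> z (ell2_delta y) = (\<lambda>_. 0)"
      unfolding z_def x(2) S.L_unit_difference[OF uP x(1) RJ] by (simp add: Rs)
  qed
  then have "z \<in> ?I" using zc by (simp add: a_kernel_def')
  then have "\<Lambda> z = (\<lambda>f x. 0)" using sub by (auto simp: a_kernel_def')
  \<comment> \<open>Proper constructible ideals miss \<open>\<one>\<close>, so at its basis vector
    the complement acts as the identity, and the left regular representation separates
    \<open>u\<close> from \<open>\<one>\<close>.\<close>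
  moreover have "\<one> \<notin> \<Union>(set Rs)" using C Rs constructible_eq_whole by auto
  ultimately have "(\<lambda>v. ell2_delta (u \<otimes> \<one>) v - ell2_delta \<one> v) = (\<lambda>_. 0)"
    using R.L_unit_difference[OF uP one_closed RJ] unfolding z_def by simp
  then have "ell2_delta u u - ell2_delta \<one> u = 0" using uP by (metis mem_carrier r_one)
  then show False using u by (simp add: ell2_delta_def split: if_splits)
qed

text \<open>A bijective \<open>\<Lambda>\<close> is isometric, so it maps \<open>I\<close> onto a
  closed ideal, and whatever it maps into the reduced diagonal comes from the universal one. Thus
  the image of \<open>I\<close> meets the reduced diagonal trivially and must vanish.\<close>

lemma ideals_in_kernel_of_isomorphism:
  assumes A: "universal_toeplitz_algebra G P A t" and \<Lambda>: "canonical_surjection G P A t \<Lambda>"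
    and bij: "bij_betw \<Lambda> (carrier A) (carrier (reduced_toeplitz G P))"
    and meet: "ideals_meet_reduced_diagonal G P"
    and I: "cstar_ideal I A" and triv: "I \<inter> universal_diagonal G P A t = {\<zero>\<^bsub>A\<^esub>}"
  shows "I \<subseteq> a_kernel A (reduced_toeplitz G P) \<Lambda>"
proof -
  interpret R: regular_family G P A t \<Lambda> by (rule regular_family_universal[OF A \<Lambda>])
  interpret H: cstar_hom A "reduced_toeplitz G P" \<Lambda>
    using \<Lambda> by (intro cstar_hom.intro cstar_hom_axioms.intro R.A.unital_cstar_algebra_axioms unital_cstar_algebra_reduced)
      (simp add: canonical_surjection_def)
  interpret B: unital_cstar_algebra "bounded_operators P" by (rule unital_cstar_algebra_bounded_operators)
  note ID = R.A.cstar_idealD[OF I]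
  let ?T = "reduced_toeplitz G P"
  have pts: "R.points = P" by (rule R.points_P)
  have iso: "opnorm P (\<Lambda> x) = nrm A x" if "x \<in> carrier A" for x
    using H.isometric[OF bij that] by simp
  have lift: "\<exists>x\<in>carrier A. \<Lambda> x = y" if "y \<in> carrier ?T" for y
  proof -
    have "y \<in> \<Lambda> ` carrier A" using bij that by (simp add: bij_betw_def)
    then show ?thesis by blast
  qed
  have ideal: "cstar_ideal (\<Lambda> ` I) ?T"
  proof (rule H.B.cstar_idealI)
    show "H.B.csubspace (\<Lambda> ` I)"
    proof (rule H.B.csubspaceI)
      show "\<Lambda> ` I \<subseteq> carrier ?T" using ID(1) H.f_simps(1) by blast
      show "\<zero>\<^bsub>?T\<^esub> \<in> \<Lambda> ` I" using ID(2) H.f_zero by (metis image_eqI)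
      fix x y assume "x \<in> \<Lambda> ` I" "y \<in> \<Lambda> ` I"
      then obtain a b where "a \<in> I" "b \<in> I" "x = \<Lambda> a" "y = \<Lambda> b" by blast
      then show "x \<oplus>\<^bsub>?T\<^esub> y \<in> \<Lambda> ` I"
        using H.f_simps(2)[of a b] ID(1) ID(3)[of a b] by (metis image_eqI subsetD)
    next
      fix c x assume "x \<in> \<Lambda> ` I"
      then obtain a where "a \<in> I" "x = \<Lambda> a" by blast
      then show "scl ?T c x \<in> \<Lambda> ` I"
        using H.f_simps(5)[of a c] ID(1) ID(7)[of a c] by (metis image_eqI subsetD)
    qed
    fix x y assume x: "x \<in> carrier ?T" and y: "y \<in> \<Lambda> ` I"
    obtain a b where ab: "a \<in> carrier A" "x = \<Lambda> a" "b \<in> I" "y = \<Lambda> b" using lift[OF x] y by blast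
    have bc: "b \<in> carrier A" using ab ID(1) by blast
    show "x \<otimes>\<^bsub>?T\<^esub> y \<in> \<Lambda> ` I" "y \<otimes>\<^bsub>?T\<^esub> x \<in> \<Lambda> ` I"
      unfolding ab(2,4) H.f_simps(3)[OF ab(1) bc, symmetric] H.f_simps(3)[OF bc ab(1), symmetric]
      using ID(5,6)[OF ab(1,3)] by auto
  next
    fix x assume x: "x \<in> carrier ?T" and approx: "\<And>e. e > 0 \<Longrightarrow> \<exists>y\<in>\<Lambda> ` I. nrm ?T (x \<ominus>\<^bsub>?T\<^esub> y) < e"
    obtain a where a: "a \<in> carrier A" "\<Lambda> a = x" using lift[OF x] by blast
    have "\<exists>b\<in>I. nrm A (a \<ominus>\<^bsub>A\<^esub> b) < e" if "e > 0" for e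
    proof -
      obtain b where b: "b \<in> I" "nrm ?T (\<Lambda> a \<ominus>\<^bsub>?T\<^esub> \<Lambda> b) < e" using approx[OF \<open>e > 0\<close>] a(2) by blast
      have bc: "b \<in> carrier A" using b ID(1) by blast
      then show ?thesis
        using b H.f_diff[OF a(1) bc] H.isometric[OF bij, of "a \<ominus>\<^bsub>A\<^esub> b"] a(1) by (intro bexI[of _ b]) auto
    qed
    then have "a \<in> I" using ID(8)[OF a(1)] by blast
    then show "x \<in> \<Lambda> ` I" using a(2) by blast
  qed
  let ?D = "cspan A (R.wt ` neutral)"
  have span: "cspan (bounded_operators P) (word_eval (bounded_operators P) (left_regular G P) ` neutral) \<subseteq> \<Lambda> ` ?D"
  proof (rule B.cspan_least)
    note D = R.A.csubspaceD[OF R.diag_span_props(1)]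
    show "B.csubspace (\<Lambda> ` ?D)"
    proof (rule B.csubspaceI)
      show "\<Lambda> ` ?D \<subseteq> carrier (bounded_operators P)" using D(1) R.L_closed pts by auto
      show "\<zero>\<^bsub>bounded_operators P\<^esub> \<in> \<Lambda> ` ?D"
        using D(2) R.L.f_zero unfolding pts by (metis image_eqI)
      fix x y assume "x \<in> \<Lambda> ` ?D" "y \<in> \<Lambda> ` ?D"
      then obtain a b where "a \<in> ?D" "b \<in> ?D" "x = \<Lambda> a" "y = \<Lambda> b" by blast
      then show "x \<oplus>\<^bsub>bounded_operators P\<^esub> y \<in> \<Lambda> ` ?D"
        using R.L.f_simps(2)[of a b] D(1) D(3)[of a b] unfolding pts by (metis image_eqI subsetD)
    next
      fix c x assume "x \<in> \<Lambda> ` ?D"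
      then obtain a where "a \<in> ?D" "x = \<Lambda> a" by blast
      then show "scl (bounded_operators P) c x \<in> \<Lambda> ` ?D"
        using R.L.f_simps(5)[of a c] D(1) D(4)[of a c] unfolding pts by (metis image_eqI subsetD)
    qed
    show "word_eval (bounded_operators P) (left_regular G P) ` neutral \<subseteq> \<Lambda> ` ?D"
    proof
      fix T assume "T \<in> word_eval (bounded_operators P) (left_regular G P) ` neutral"
      then obtain \<alpha> where \<alpha>: "\<alpha> \<in> neutral" "T = word_eval (bounded_operators P) (left_regular G P) \<alpha>" by blast
      have "T = \<Lambda> (R.wt \<alpha>)"
        unfolding \<alpha>(2) R.L_wt[OF neutral_wordsD(1)[OF \<alpha>(1)]] pts
        by (rule word_eval_cong[OF neutral_wordsD(1)[OF \<alpha>(1)]]) (simp add: left_regular_rep)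
      then show "T \<in> \<Lambda> ` ?D" using \<alpha>(1) R.A.cspan_superset[of "R.wt ` neutral"] by blast
    qed
  qed
  have wB: "word_eval (bounded_operators P) (left_regular G P) ` neutral \<subseteq> carrier (bounded_operators P)"
    using word_eval_left_regular neutral_wordsD(1) reduced_subalgebra(1) subringE(1)
    unfolding cstar_subalgebra_def by blast
  \<comment> \<open>Approximations of \<open>\<Lambda> x\<close> by combinations of neutral words
    lift to the universal algebra with the same error, because \<open>\<Lambda>\<close> is
    isometric.\<close>
  have diag: "x \<in> universal_diagonal G P A t" if x: "x \<in> carrier A" "\<Lambda> x \<in> reduced_diagonal G P" for x
    unfolding universal_diagonal_def R.A.in_closed_cspan_iff[OF R.wt_neutral_subset(1)]
  proof (intro conjI allI impI)
    fix e :: real assume "e > 0"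
    then obtain z where z: "z \<in> cspan (bounded_operators P) (word_eval (bounded_operators P) (left_regular G P) ` neutral)"
      "opnorm P (\<Lambda> x \<ominus>\<^bsub>bounded_operators P\<^esub> z) < e"
      using x(2) unfolding reduced_diagonal_words B.in_closed_cspan_iff[OF wB] by blast
    then obtain a where a: "a \<in> ?D" "z = \<Lambda> a" using span by blast
    have ac: "a \<in> carrier A" using a R.A.csubspaceD(1)[OF R.diag_span_props(1)] by blast
    have "nrm A (x \<ominus>\<^bsub>A\<^esub> a) = opnorm P (\<Lambda> x \<ominus>\<^bsub>bounded_operators P\<^esub> z)"
      using iso[of "x \<ominus>\<^bsub>A\<^esub> a"] R.L.f_diff[OF x(1) ac] x(1) ac unfolding pts a(2) by simp
    then show "\<exists>y\<in>?D. nrm A (x \<ominus>\<^bsub>A\<^esub> y) < e" using z(2) a(1) by (intro bexI[of _ a]) simp_all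
  qed (rule x(1))
  have "\<Lambda> ` I \<inter> reduced_diagonal G P \<subseteq> {\<zero>\<^bsub>?T\<^esub>}"
  proof
    fix y assume y: "y \<in> \<Lambda> ` I \<inter> reduced_diagonal G P"
    then obtain x where x: "x \<in> I" "y = \<Lambda> x" by (elim IntE imageE)
    have "x \<in> universal_diagonal G P A t" using diag[of x] x y ID(1) by auto
    then have "x = \<zero>\<^bsub>A\<^esub>" using triv x(1) by auto
    then show "y \<in> {\<zero>\<^bsub>?T\<^esub>}" using x(2) H.f_zero by simp
  qed
  moreover have "\<zero>\<^bsub>?T\<^esub> \<in> reduced_diagonal G P"
    using B.csubspaceD(2)[OF B.closed_cspan_props(1)[OF wB]] by (simp add: reduced_diagonal_words)
  moreover have "\<zero>\<^bsub>?T\<^esub> \<in> \<Lambda> ` I" by (rule H.B.cstar_idealD(2)[OF ideal])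
  ultimately have "\<Lambda> ` I \<inter> reduced_diagonal G P = {\<zero>\<^bsub>?T\<^esub>}" by blast
  then have "\<Lambda> ` I = {\<zero>\<^bsub>?T\<^esub>}"
    using meet ideal unfolding ideals_meet_reduced_diagonal_def by blast
  then show ?thesis using ID(1) unfolding a_kernel_def' by blast
qed

end

theorem corollary5p10:
  fixes G :: "('g, 'm) monoid_scheme" and P :: "'g set"
    and A :: "'a cstar" and t :: "'g \<Rightarrow> 'a" and \<Lambda> :: "'a \<Rightarrow> 'g operator"
  assumes "group G" and "submonoid P G"
    and "universal_toeplitz_algebra G P A t"
    and "canonical_surjection G P A t \<Lambda>"
  shows "(action_topologically_free G P (carrier G) \<longleftrightarrow>
            action_topologically_free G P (unit_group G P)) \<and>
         (action_topologically_free G P (unit_group G P) \<longleftrightarrow>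
            (\<forall>u\<in>unit_group G P - {\<one>\<^bsub>G\<^esub>}. \<forall>C. finite C \<and> C \<subseteq> constructible_ideals G P - {P} \<longrightarrow>
               (\<exists>s\<in>P - \<Union>C. (u \<otimes>\<^bsub>G\<^esub> s) <#\<^bsub>G\<^esub> P \<noteq> s <#\<^bsub>G\<^esub> P))) \<and>
         ((\<forall>u\<in>unit_group G P - {\<one>\<^bsub>G\<^esub>}. \<forall>C. finite C \<and> C \<subseteq> constructible_ideals G P - {P} \<longrightarrow>
               (\<exists>s\<in>P - \<Union>C. (u \<otimes>\<^bsub>G\<^esub> s) <#\<^bsub>G\<^esub> P \<noteq> s <#\<^bsub>G\<^esub> P)) \<longleftrightarrow>
            (\<forall>I. cstar_ideal I A \<and> I \<inter> universal_diagonal G P A t = {\<zero>\<^bsub>A\<^esub>} \<longrightarrow>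
               I \<subseteq> a_kernel A (reduced_toeplitz G P) \<Lambda>)) \<and>
         (action_topologically_free G P (carrier G) \<longrightarrow> ideals_meet_reduced_diagonal G P) \<and>
         (bij_betw \<Lambda> (carrier A) (carrier (reduced_toeplitz G P)) \<longrightarrow>
            ideals_meet_reduced_diagonal G P \<longrightarrow> action_topologically_free G P (carrier G))"
proof -
  interpret submonoid_in_group G P using assms(1,2) by (rule submonoid_in_group.intro)
  interpret R: regular_family G P A t \<Lambda> by (rule regular_family_universal[OF assms(3,4)])
  have kernel: "I \<subseteq> a_kernel A (reduced_toeplitz G P) \<Lambda>"
    if "units_move_principal_ideals" "cstar_ideal I A" "I \<inter> universal_diagonal G P A t = {\<zero>\<^bsub>A\<^esub>}" for I
    using R.ideal_in_kernel[OF that(1,2)] that(3) R.A.cstar_idealD(1)[OF that(2)]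
    unfolding universal_diagonal_def a_kernel_def' by auto
  have four: "units_move_principal_ideals \<longleftrightarrow>
    (\<forall>I. cstar_ideal I A \<and> I \<inter> universal_diagonal G P A t = {\<zero>\<^bsub>A\<^esub>} \<longrightarrow>
      I \<subseteq> a_kernel A (reduced_toeplitz G P) \<Lambda>)"
    using kernel units_move_of_ideals_in_kernel[OF assms(3,4)] by blast
  have converse: "units_move_principal_ideals"
    if "bij_betw \<Lambda> (carrier A) (carrier (reduced_toeplitz G P))" "ideals_meet_reduced_diagonal G P"
    using ideals_in_kernel_of_isomorphism[OF assms(3,4) that] units_move_of_ideals_in_kernel[OF assms(3,4)] by blast
  show ?thesis
    unfolding topologically_free_iff four[symmetric] units_move_principal_ideals_def[symmetric]
    using ideals_meet_reduced_diagonal_of_units_move converse by blast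
qed

end
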